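(* Let $d\ge 2$ and let $\nu$ be a nearly gamma probability measure on $\mathbb{R}_+$ with an exponential moment, i.e. such that there exists $\delta>0$ with $\int e^{\delta x}\,d\nu(x)<\infty$. Let $E$ be the set of edges of $\mathbb{Z}^d$ and let $\mu=\nu^{\otimes E}$ on $\mathbb{R}_+^E$. Then there exist two positive constants $C_1$ and $C_2$ such that, for any vertex $v\in\mathbb{Z}^d$ with $|v|\ge 2$ and any positive real number $t\le |v|$, $$\mu\left(\left|d_x(0,v)-\int d_x(0,v)\,d\mu(x)\right|> t\sqrt{\frac{|v|}{\log |v|}}\right)\le C_1e^{-C_2t}.$$
   Context: $\mathbb{Z}^d$ is the nearest-neighbour lattice and $|\cdot|$ denotes the $L^1$-norm of vertices. For $x=(x_e)_{e\in E}\in\mathbb{R}_+^E$ and vertices $u,v$, the first passage time is $d_x(u,v)=\inf_{\alpha}\sum_{e\in\alpha}x_e$, the infimum being over all paths $\alpha$ with end points $u$ and $v$. Let $g(x)=\frac{1}{\sqrt{2\pi}}e^{-x^2/2}$ and $G(x)=\int_{-\infty}^x g(u)\,du$, with the convention $g\circ G^{-1}(0)=g\circ G^{-1}(1)=0$. Nearly gamma: let $\nu$ be a probability measure on $\mathbb{R}_+$, absolutely continuous with respect to Lebesgue measure, with density $h$ and distribution function $H(t)=\int_0^t h(u)\,du$. Let $I=\{t\ge 0 : h(t)>0\}$ and define $\psi:I\to\mathbb{R}$ by $\psi(y)=\frac{g\circ G^{-1}(H(y))}{h(y)}$. Then $\nu$ is nearly gamma if (i) $I$ is an interval; (ii) $h$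 restricted to $I$ is continuous; (iii) there exists a positive real number $A$ such that $\psi(y)\le A\sqrt{y}$ for all $y\in I$. *)

theory Defs
  imports "HOL-Probability.Probability"
begin

section \<open>First passage percolation on the lattice\<close>

definition l1_norm :: "int ^ 'd::finite \<Rightarrow> int" where
  "l1_norm v = (\<Sum>i\<in>UNIV. \<bar>v $ i\<bar>)"

definition lattice_adj :: "int ^ 'd::finite \<Rightarrow> int ^ 'd \<Rightarrow> bool" where
  "lattice_adj u v \<longleftrightarrow> l1_norm (u - v) = 1"

definition lattice_edges :: "(int ^ 'd::finite) set set" where
  "lattice_edges = {{u, v} |u v. lattice_adj u v}"

text \<open>A path is given by the list of its successive vertices; repetitions are allowed.\<close>

definition lattice_path :: "int ^ 'd::finite \<Rightarrow> (int ^ 'd) list \<Rightarrow> int ^ 'd \<Rightarrow> bool" where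
  "lattice_path u p v \<longleftrightarrow> p \<noteq> [] \<and> hd p = u \<and> last p = v \<and> successively lattice_adj p"

definition path_edges :: "'v list \<Rightarrow> 'v set list" where
  "path_edges p = map2 (\<lambda>a b. {a, b}) p (tl p)"

text \<open>For nonnegative edge weights the infimum below is over a nonempty set bounded below by 0.\<close>

definition passage_time ::
  "((int ^ 'd::finite) set \<Rightarrow> real) \<Rightarrow> int ^ 'd \<Rightarrow> int ^ 'd \<Rightarrow> real" where
  "passage_time x u v = (INF p \<in> {p. lattice_path u p v}. \<Sum>e\<leftarrow>path_edges p. x e)"

definition edge_measure :: "real measure \<Rightarrow> ((int ^ 'd::finite) set \<Rightarrow> real) measure" where
  "edge_measure \<nu> = PiM lattice_edges (\<lambda>_. \<nu>)"


section \<open>Nearly gamma measures\<close>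

definition normal_cdf :: "real \<Rightarrow> real" where
  "normal_cdf x = (LINT u:{..x}|lborel. std_normal_density u)"

definition gauss_profile :: "real \<Rightarrow> real" where
  "gauss_profile p =
    (if p = 0 \<or> p = 1 then 0 else std_normal_density (the_inv normal_cdf p))"

definition nearly_gamma_psi :: "(real \<Rightarrow> real) \<Rightarrow> real \<Rightarrow> real" where
  "nearly_gamma_psi h y = gauss_profile (LINT u:{0..y}|lborel. h u) / h y"

text \<open>
  The measure lives on the space of nonnegative reals, so that \<^const>\<open>edge_measure\<close> is a measure
  on nonnegative edge weights. A density is only determined up to null sets; the conditions
  are required of some version of it.
\<close>

definition nearly_gamma :: "real measure \<Rightarrow> bool" where
  "nearly_gamma \<nu> \<longleftrightarrow> prob_space \<nu> \<and>
    (\<exists>h :: real \<Rightarrow> real.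
      h \<in> borel_measurable (restrict_space lborel {0..}) \<and>
      (\<forall>t\<ge>0. 0 \<le> h t) \<and>
      \<nu> = density (restrict_space lborel {0..}) (\<lambda>t. ennreal (h t)) \<and>
      (let I = {t. 0 \<le> t \<and> 0 < h t} in
        is_interval I \<and>
        continuous_on I h \<and>
        (\<exists>A>0. \<forall>y\<in>I. nearly_gamma_psi h y \<le> A * sqrt y)))"

end

theory Submission
  imports Defs "HOL-Real_Asymp.Real_Asymp"
begin

text \<open>
  The fluctuations of the passage time \<open>T = d_x(0,v)\<close> are exponential on the scale
  \<open>sqrt(n / ln n)\<close>, \<open>n = |v|\<close>, because of three facts.

  (1) \<^emph>\<open>A superconcentration inequality on the discrete cube.\<close> If \<open>f\<close> depends on independent coin
  flips and every single flip has an \<open>L\<^sup>1\<close> effect that is a factor \<open>\<kappa>\<close> smaller than its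
  \<open>L\<^sup>2\<close> effect, then the variance of \<open>f\<close> is smaller than the Efron-Stein bound by a factor of order
  \<open>ln (1 / \<kappa>)\<close>: Walsh levels above \<open>k\<close> gain \<open>1 / k\<close> directly and the levels up to \<open>k\<close> are
  controlled by hypercontractivity (lemma \<open>cube_variance_bound\<close>).

  (2) \<^emph>\<open>The square root structure of nearly gamma measures.\<close> A nearly gamma measure is the image of
  the Gaussian law under a map \<open>U\<close> whose square root is Lipschitz (\<open>nearly_gamma_transport\<close>).
  By the central limit theorem the Gaussian variable may be replaced by a normalised sum of \<open>N\<close> signs,
  and flipping one sign changes a weight \<open>x\<^sub>e\<close> by about \<open>sqrt(x\<^sub>e / N)\<close>. Only weights on a
  geodesic matter, so the sum over all signs of the squared effects on the passage time is of order
  \<open>\<Sum> x\<^sub>e\<close> over the geodesic, that is, of order of the passage time itself, which is cut off at a multiple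
  of \<open>n\<close> (\<open>sum_weight_influence_le\<close>, \<open>cube_exp_variance_bound\<close>).

  (3) \<^emph>\<open>Averaging over translations makes all influences small.\<close> The passage time is replaced by the average
  of the passage times from \<open>z\<close> to \<open>z + v\<close> over \<open>z\<close> in a cube of side \<open>m\<close> of order \<open>n\<^sup>1\<^sup>/\<^sup>4\<close>. The
  influence of an edge becomes the expected proportion of a cube that is visited by a geodesic. A geodesic visits
  only \<open>O(m)\<close> of the \<open>m\<^sup>d\<close> vertices, since many visits would force a long path with a small passage time,
  while a direct path through the cube is cheap (\<open>card_geodesic_inter_le\<close>, \<open>visit_bound_integral\<close>).
  This is where \<open>d \<ge> 2\<close> enters: only then is a cube much larger than its diameter.

  Applied to \<open>f = exp(u F / 2)\<close>, with \<open>F\<close> the averaged and truncated passage time, these facts give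
  \<open>Var (exp(u F / 2)) \<le> C (n / ln n) u\<^sup>2 E (exp(u F))\<close> for \<open>|u| \<le> 1\<close> (\<open>box_passage_variance\<close>). Iterating
  this inequality along \<open>u, u/2, u/4, ...\<close> bounds the Laplace transform of \<open>F - E F\<close> at
  \<open>u\<close> of order \<open>sqrt(ln n / n)\<close> (\<open>laplace_bound\<close>), and Markov's inequality yields the exponential tail.
  Finally \<open>T\<close> and \<open>F\<close> differ by passage times between points at distance \<open>O(m)\<close>, which have
  exponential moments and live on a scale below \<open>sqrt(n / ln n)\<close> (\<open>deviation_bounds\<close>).

  Everything up to the variance inequality takes place on finite cubes and with finitely many paths; the
  number of signs tends to infinity by Levy's continuity theorem and Skorohod's representation
  (\<open>cube_avg_limit\<close>), and afterwards the bound on the length of the paths tends to infinity.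
\<close>


section \<open>Fourier analysis on the discrete cube\<close>

text \<open>
  A point of the cube \<open>{-1, 1}\<^sup>Q\<close> is encoded by the subset of \<open>Q\<close> on which it equals \<open>1\<close>, so that
  expectations are finite sums over a power set.
\<close>

definition cube_avg :: "'q set \<Rightarrow> ('q set \<Rightarrow> real) \<Rightarrow> real" where
  "cube_avg Q f = (\<Sum>A\<in>Pow Q. f A) / 2 ^ card Q"

lemma cube_avg_empty [simp]: "cube_avg {} f = f {}"
  by (simp add: cube_avg_def)

lemma sum_Pow_insert:
  assumes "finite Q" "j \<notin> Q"
  shows "(\<Sum>A\<in>Pow (insert j Q). f A) = (\<Sum>A\<in>Pow Q. f A) + (\<Sum>A\<in>Pow Q. f (insert j A))"
proof -
  have inj: "inj_on (insert j) (Pow Q)"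
    using assms(2) by (fastforce simp: inj_on_def)
  have "(\<Sum>A\<in>Pow (insert j Q). f A) = (\<Sum>A\<in>Pow Q. f A) + (\<Sum>A\<in>insert j ` Pow Q. f A)"
    unfolding Pow_insert using assms by (intro sum.union_disjoint) auto
  also have "(\<Sum>A\<in>insert j ` Pow Q. f A) = (\<Sum>A\<in>Pow Q. f (insert j A))"
    using inj by (simp add: sum.reindex)
  finally show ?thesis .
qed

lemma cube_avg_insert:
  assumes "finite Q" "j \<notin> Q"
  shows "cube_avg (insert j Q) f = (cube_avg Q f + cube_avg Q (\<lambda>A. f (insert j A))) / 2"
  using assms by (simp add: cube_avg_def sum_Pow_insert add_divide_distrib)

lemma cube_avg_add: "cube_avg Q (\<lambda>A. f A + g A) = cube_avg Q f + cube_avg Q g"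
  by (simp add: cube_avg_def sum.distrib add_divide_distrib)

lemma cube_avg_diff: "cube_avg Q (\<lambda>A. f A - g A) = cube_avg Q f - cube_avg Q g"
  by (simp add: cube_avg_def sum_subtractf diff_divide_distrib)

lemma cube_avg_cmult: "cube_avg Q (\<lambda>A. c * f A) = c * cube_avg Q f"
  by (simp add: cube_avg_def sum_distrib_left)

lemma cube_avg_sum: "cube_avg Q (\<lambda>A. \<Sum>i\<in>I. f i A) = (\<Sum>i\<in>I. cube_avg Q (f i))"
  unfolding cube_avg_def sum_divide_distrib[symmetric] by (subst sum.swap) simp

lemma cube_avg_cong: "(\<And>A. A \<subseteq> Q \<Longrightarrow> f A = g A) \<Longrightarrow> cube_avg Q f = cube_avg Q g"
  unfolding cube_avg_def by (intro arg_cong2[where f="(/)"] sum.cong) auto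

lemma cube_avg_mono: "(\<And>A. A \<subseteq> Q \<Longrightarrow> f A \<le> g A) \<Longrightarrow> cube_avg Q f \<le> cube_avg Q g"
  unfolding cube_avg_def by (intro divide_right_mono sum_mono) auto

lemma cube_avg_nonneg: "(\<And>A. A \<subseteq> Q \<Longrightarrow> 0 \<le> f A) \<Longrightarrow> 0 \<le> cube_avg Q f"
  unfolding cube_avg_def by (intro divide_nonneg_nonneg sum_nonneg) auto

lemma cube_avg_const: "finite Q \<Longrightarrow> cube_avg Q (\<lambda>A. c) = c"
  by (simp add: cube_avg_def card_Pow)

lemma cube_avg_Cauchy_Schwarz:
  "(cube_avg Q (\<lambda>A. f A * g A))\<^sup>2 \<le> cube_avg Q (\<lambda>A. (f A)\<^sup>2) * cube_avg Q (\<lambda>A. (g A)\<^sup>2)"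
proof -
  have "(\<Sum>A\<in>Pow Q. f A * g A)\<^sup>2 \<le> (\<Sum>A\<in>Pow Q. (f A)\<^sup>2) * (\<Sum>A\<in>Pow Q. (g A)\<^sup>2)"
    by (rule Cauchy_Schwarz_ineq_sum)
  then show ?thesis
    unfolding cube_avg_def by (simp add: power_divide divide_right_mono power2_eq_square[symmetric])
qed

definition walsh :: "'q set \<Rightarrow> 'q set \<Rightarrow> real" where
  "walsh S A = (-1) ^ card (S \<inter> A)"

definition walsh_coeff :: "'q set \<Rightarrow> ('q set \<Rightarrow> real) \<Rightarrow> 'q set \<Rightarrow> real" where
  "walsh_coeff Q f S = cube_avg Q (\<lambda>A. f A * walsh S A)"

lemma walsh_empty [simp]: "walsh {} A = 1" "walsh S {} = 1"
  by (simp_all add: walsh_def)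

lemma walsh_insert:
  assumes "j \<notin> S" "j \<notin> A" "finite S"
  shows "walsh S (insert j A) = walsh S A" "walsh (insert j S) A = walsh S A"
    "walsh (insert j S) (insert j A) = - walsh S A"
  using assms by (auto simp: walsh_def)

lemma walsh_coeff_insert:
  assumes "finite Q" "j \<notin> Q" "S \<subseteq> Q"
  shows "walsh_coeff (insert j Q) f S = (walsh_coeff Q f S + walsh_coeff Q (\<lambda>A. f (insert j A)) S) / 2"
    "walsh_coeff (insert j Q) f (insert j S) = (walsh_coeff Q f S - walsh_coeff Q (\<lambda>A. f (insert j A)) S) / 2"
proof -
  have S: "finite S" "j \<notin> S" using assms finite_subset by auto
  have 1: "cube_avg Q (\<lambda>A. f (insert j A) * walsh S (insert j A)) = walsh_coeff Q (\<lambda>A. f (insert j A)) S"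
    unfolding walsh_coeff_def
  proof (rule cube_avg_cong)
    fix A assume "A \<subseteq> Q"
    with assms have "j \<notin> A" by auto
    with S show "f (insert j A) * walsh S (insert j A) = f (insert j A) * walsh S A"
      by (simp add: walsh_insert)
  qed
  have 2: "cube_avg Q (\<lambda>A. f A * walsh (insert j S) A) = walsh_coeff Q f S"
    unfolding walsh_coeff_def
  proof (rule cube_avg_cong)
    fix A assume "A \<subseteq> Q"
    with assms have "j \<notin> A" by auto
    with S show "f A * walsh (insert j S) A = f A * walsh S A" by (simp add: walsh_insert)
  qed
  have 3: "cube_avg Q (\<lambda>A. f (insert j A) * walsh (insert j S) (insert j A))
      = - walsh_coeff Q (\<lambda>A. f (insert j A)) S"
  proof -
    have "cube_avg Q (\<lambda>A. f (insert j A) * walsh (insert j S) (insert j A))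
      = cube_avg Q (\<lambda>A. (-1) * (f (insert j A) * walsh S A))"
    proof (rule cube_avg_cong)
      fix A assume "A \<subseteq> Q"
      with assms have "j \<notin> A" by auto
      with S show "f (insert j A) * walsh (insert j S) (insert j A) = (-1) * (f (insert j A) * walsh S A)"
        by (simp add: walsh_insert)
    qed
    then show ?thesis by (simp only: cube_avg_cmult walsh_coeff_def)
  qed
  show "walsh_coeff (insert j Q) f S = (walsh_coeff Q f S + walsh_coeff Q (\<lambda>A. f (insert j A)) S) / 2"
    using 1 assms by (simp add: walsh_coeff_def cube_avg_insert)
  show "walsh_coeff (insert j Q) f (insert j S) = (walsh_coeff Q f S - walsh_coeff Q (\<lambda>A. f (insert j A)) S) / 2"
    using 2 3 assms by (simp add: walsh_coeff_def cube_avg_insert)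
qed

text \<open>
  Splitting off one coordinate replaces the coefficients \<open>a\<close>, \<open>b\<close> of the two halves by
  \<open>(a + b) / 2\<close> and \<open>(a - b) / 2\<close>, and \<open>((a + b) / 2)\<^sup>2 + ((a - b) / 2)\<^sup>2 = (a\<^sup>2 + b\<^sup>2) / 2\<close>.
\<close>

lemma parseval:
  assumes "finite Q"
  shows "cube_avg Q (\<lambda>A. (f A)\<^sup>2) = (\<Sum>S\<in>Pow Q. (walsh_coeff Q f S)\<^sup>2)"
  using assms
proof (induction Q arbitrary: f)
  case empty
  then show ?case by (simp add: walsh_coeff_def)
next
  case (insert j Q)
  let ?a = "walsh_coeff Q f" and ?b = "walsh_coeff Q (\<lambda>A. f (insert j A))"
  have "(\<Sum>S\<in>Pow (insert j Q). (walsh_coeff (insert j Q) f S)\<^sup>2)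
    = (\<Sum>S\<in>Pow Q. ((?a S + ?b S) / 2)\<^sup>2) + (\<Sum>S\<in>Pow Q. ((?a S - ?b S) / 2)\<^sup>2)"
    unfolding sum_Pow_insert[OF insert.hyps]
    by (intro arg_cong2[where f="(+)"] sum.cong refl) (simp_all add: walsh_coeff_insert[OF insert.hyps])
  also have "\<dots> = (\<Sum>S\<in>Pow Q. ((?a S)\<^sup>2 + (?b S)\<^sup>2) / 2)"
    unfolding sum.distrib[symmetric] by (intro sum.cong) (auto simp: power2_eq_square field_simps)
  also have "\<dots> = cube_avg (insert j Q) (\<lambda>A. (f A)\<^sup>2)"
    using insert by (simp add: cube_avg_insert sum.distrib sum_divide_distrib[symmetric])
  finally show ?case by simp
qed

text \<open>
  Bonami's inequality for the noise operator that multiplies level \<open>k\<close> by \<open>r ^ k\<close>. Writing the function as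
  \<open>p + \<epsilon> r q\<close> with a sign \<open>\<epsilon>\<close> that is independent of \<open>p\<close> and \<open>q\<close>, its fourth moment is
  \<open>E p\<^sup>4 + 6 r\<^sup>2 E p\<^sup>2 q\<^sup>2 + r\<^sup>4 E q\<^sup>4\<close>; with \<open>r\<^sup>2 \<le> 1 / 3\<close> the Cauchy-Schwarz inequality and the
  induction hypothesis bound it by the square \<open>(a + b)\<^sup>2\<close>.
\<close>

lemma hypercontractivity_2_4:
  fixes c :: "'q set \<Rightarrow> real" and r :: real
  assumes "finite Q" "r\<^sup>2 \<le> 1 / 3"
  shows "cube_avg Q (\<lambda>A. (\<Sum>S\<in>Pow Q. r ^ card S * c S * walsh S A) ^ 4) \<le> (\<Sum>S\<in>Pow Q. (c S)\<^sup>2)\<^sup>2"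
  using assms(1)
proof (induction Q arbitrary: c)
  case empty
  then show ?case by (simp flip: power_mult)
next
  case (insert j Q)
  define p where "p A = (\<Sum>S\<in>Pow Q. r ^ card S * c S * walsh S A)" for A
  define q where "q A = (\<Sum>S\<in>Pow Q. r ^ card S * c (insert j S) * walsh S A)" for A
  define a where "a = (\<Sum>S\<in>Pow Q. (c S)\<^sup>2)"
  define b where "b = (\<Sum>S\<in>Pow Q. (c (insert j S))\<^sup>2)"
  have a: "0 \<le> a" and b: "0 \<le> b" by (auto simp: a_def b_def sum_nonneg)
  have fin: "finite S \<and> j \<notin> S" if "S \<subseteq> Q" for S
    using that insert.hyps finite_subset by auto
  have card: "card (insert j S) = Suc (card S)" if "S \<subseteq> Q" for S
    using fin[OF that] by simp
  have e0: "(\<Sum>S\<in>Pow (insert j Q). r ^ card S * c S * walsh S A) = p A + r * q A" if "A \<subseteq> Q" for A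
    using insert.hyps fin[OF that] fin
    by (auto simp: sum_Pow_insert p_def q_def sum_distrib_left walsh_insert intro!: sum.cong)
  have e1: "(\<Sum>S\<in>Pow (insert j Q). r ^ card S * c S * walsh S (insert j A)) = p A - r * q A"
    if "A \<subseteq> Q" for A
    using insert.hyps fin[OF that] fin
    by (auto simp: sum_Pow_insert p_def q_def sum_distrib_left walsh_insert sum_negf[symmetric] intro!: sum.cong)
  have P: "cube_avg Q (\<lambda>A. p A ^ 4) \<le> a\<^sup>2" unfolding p_def a_def by (rule insert.IH)
  have Q: "cube_avg Q (\<lambda>A. q A ^ 4) \<le> b\<^sup>2" unfolding q_def b_def by (rule insert.IH)
  have PQ: "cube_avg Q (\<lambda>A. (p A)\<^sup>2 * (q A)\<^sup>2) \<le> a * b"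
  proof (rule power2_le_imp_le)
    have "(cube_avg Q (\<lambda>A. (p A)\<^sup>2 * (q A)\<^sup>2))\<^sup>2 \<le> cube_avg Q (\<lambda>A. ((p A)\<^sup>2)\<^sup>2) * cube_avg Q (\<lambda>A. ((q A)\<^sup>2)\<^sup>2)"
      by (rule cube_avg_Cauchy_Schwarz)
    also have "\<dots> = cube_avg Q (\<lambda>A. p A ^ 4) * cube_avg Q (\<lambda>A. q A ^ 4)"
      by (simp flip: power_mult)
    also have "\<dots> \<le> a\<^sup>2 * b\<^sup>2"
      by (intro mult_mono P Q) (auto intro!: cube_avg_nonneg)
    finally show "(cube_avg Q (\<lambda>A. (p A)\<^sup>2 * (q A)\<^sup>2))\<^sup>2 \<le> (a * b)\<^sup>2" by (simp add: power_mult_distrib)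
  qed (use a b in simp)
  have r4: "r ^ 4 \<le> 1"
  proof -
    have "r ^ 4 = (r\<^sup>2)\<^sup>2" by simp
    also have "\<dots> \<le> (1/3)\<^sup>2" using assms(2) by (intro power_mono) auto
    finally show ?thesis by (simp add: power2_eq_square)
  qed
  have "cube_avg (insert j Q) (\<lambda>A. (\<Sum>S\<in>Pow (insert j Q). r ^ card S * c S * walsh S A) ^ 4)
    = (cube_avg Q (\<lambda>A. (p A + r * q A) ^ 4) + cube_avg Q (\<lambda>A. (p A - r * q A) ^ 4)) / 2"
    unfolding cube_avg_insert[OF insert.hyps]
    by (intro arg_cong2[where f="(/)"] arg_cong2[where f="(+)"] cube_avg_cong refl) (simp_all add: e0 e1)
  also have "\<dots> = cube_avg Q (\<lambda>A. p A ^ 4 + ((6 * r\<^sup>2) * ((p A)\<^sup>2 * (q A)\<^sup>2) + r ^ 4 * q A ^ 4))"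
    unfolding cube_avg_add[symmetric] 
    by (simp add: cube_avg_def sum_divide_distrib, rule sum.cong)
       (auto simp: field_simps power2_eq_square power4_eq_xxxx)
  also have "\<dots> = cube_avg Q (\<lambda>A. p A ^ 4) + (6 * r\<^sup>2 * cube_avg Q (\<lambda>A. (p A)\<^sup>2 * (q A)\<^sup>2)
      + r ^ 4 * cube_avg Q (\<lambda>A. q A ^ 4))"
    by (simp only: cube_avg_add cube_avg_cmult)
  also have "\<dots> \<le> a\<^sup>2 + (2 * (a * b) + 1 * b\<^sup>2)"
    using assms(2) r4 a b by (intro add_mono mult_mono P Q PQ) (auto intro!: cube_avg_nonneg)
  also have "\<dots> = (a + b)\<^sup>2" by (simp add: power2_eq_square algebra_simps)
  also have "a + b = (\<Sum>S\<in>Pow (insert j Q). (c S)\<^sup>2)"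
    using insert.hyps by (simp add: sum_Pow_insert a_def b_def)
  finally show ?case .
qed

text \<open>
  The dual form of hypercontractivity, interpolated between the first and the second moment. The left-hand side
  \<open>X\<close> equals \<open>E (g h)\<close> for a function \<open>h\<close> with \<open>E h\<^sup>4 \<le> X\<^sup>2\<close>; applying the Cauchy-Schwarz inequality to
  \<open>|g|\<^sup>1\<^sup>/\<^sup>2 * |g|\<^sup>1\<^sup>/\<^sup>2 |h|\<close> and then to \<open>|g| * h\<^sup>2\<close> gives \<open>X\<^sup>2 \<le> |g|\<^sub>1 |g|\<^sub>2 X\<close>.
\<close>

lemma noise_norm_le:
  assumes "finite Q"
  shows "(\<Sum>S\<in>Pow Q. (1/3) ^ card S * (walsh_coeff Q g S)\<^sup>2)
    \<le> cube_avg Q (\<lambda>A. \<bar>g A\<bar>) * sqrt (cube_avg Q (\<lambda>A. (g A)\<^sup>2))"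
proof -
  define X where "X = (\<Sum>S\<in>Pow Q. (1/3) ^ card S * (walsh_coeff Q g S)\<^sup>2)"
  define r :: real where "r = sqrt (1/3)"
  have r2: "r * r = 1/3" by (simp add: r_def)
  \<comment> \<open>Half of the noise is kept for the coefficients to which hypercontractivity is applied.\<close>
  define h where "h A = (\<Sum>S\<in>Pow Q. r ^ card S * (r ^ card S * walsh_coeff Q g S) * walsh S A)" for A
  have rr: "r ^ k * (r ^ k * z) = (1/3) ^ k * z" for k z
    by (metis mult.assoc power_mult_distrib r2)
  have rr2: "r ^ k * r ^ k = (1/3) ^ k" for k
    by (metis power_mult_distrib r2)
  have X0: "0 \<le> X" unfolding X_def by (auto intro!: sum_nonneg)
  have Xgh: "X = cube_avg Q (\<lambda>A. g A * h A)"
  proof -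
    have "cube_avg Q (\<lambda>A. g A * h A)
      = cube_avg Q (\<lambda>A. \<Sum>S\<in>Pow Q. (1/3) ^ card S * walsh_coeff Q g S * (g A * walsh S A))"
      by (intro cube_avg_cong) (simp add: h_def rr sum_distrib_left mult_ac rr2)
    also have "\<dots> = X" by (simp add: cube_avg_sum cube_avg_cmult X_def power2_eq_square walsh_coeff_def mult.assoc)
    finally show ?thesis by simp
  qed
  have h4: "cube_avg Q (\<lambda>A. h A ^ 4) \<le> X\<^sup>2"
  proof -
    have "cube_avg Q (\<lambda>A. h A ^ 4) \<le> (\<Sum>S\<in>Pow Q. (r ^ card S * walsh_coeff Q g S)\<^sup>2)\<^sup>2"
      unfolding h_def using assms r2 by (intro hypercontractivity_2_4) (simp_all add: power2_eq_square)
    also have "(\<Sum>S\<in>Pow Q. (r ^ card S * walsh_coeff Q g S)\<^sup>2) = X"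
      unfolding X_def by (intro sum.cong refl) (simp add: power2_eq_square rr mult.left_commute)
    finally show ?thesis .
  qed
  define n1 where "n1 = cube_avg Q (\<lambda>A. \<bar>g A\<bar>)"
  define n2 where "n2 = sqrt (cube_avg Q (\<lambda>A. (g A)\<^sup>2))"
  have n: "0 \<le> n1" "0 \<le> n2" by (auto simp: n1_def n2_def intro!: cube_avg_nonneg)
  have gh2: "cube_avg Q (\<lambda>A. \<bar>g A\<bar> * (h A)\<^sup>2) \<le> n2 * X"
  proof (rule power2_le_imp_le)
    have "(cube_avg Q (\<lambda>A. \<bar>g A\<bar> * (h A)\<^sup>2))\<^sup>2 \<le> cube_avg Q (\<lambda>A. \<bar>g A\<bar>\<^sup>2) * cube_avg Q (\<lambda>A. ((h A)\<^sup>2)\<^sup>2)"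
      by (rule cube_avg_Cauchy_Schwarz)
    also have "\<dots> \<le> n2\<^sup>2 * X\<^sup>2"
      using h4 by (intro mult_mono) (auto simp: n2_def power_mult[symmetric] real_sqrt_pow2 cube_avg_nonneg intro!: cube_avg_nonneg)
    finally show "(cube_avg Q (\<lambda>A. \<bar>g A\<bar> * (h A)\<^sup>2))\<^sup>2 \<le> (n2 * X)\<^sup>2" by (simp add: power_mult_distrib)
  qed (use n X0 in simp)
  have "X\<^sup>2 \<le> (cube_avg Q (\<lambda>A. sqrt \<bar>g A\<bar> * (sqrt \<bar>g A\<bar> * \<bar>h A\<bar>)))\<^sup>2"
  proof (rule power_mono)
    show "X \<le> cube_avg Q (\<lambda>A. sqrt \<bar>g A\<bar> * (sqrt \<bar>g A\<bar> * \<bar>h A\<bar>))"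
      unfolding Xgh by (intro cube_avg_mono) (simp add: mult.assoc[symmetric] abs_mult[symmetric])
  qed (rule X0)
  also have "\<dots> \<le> cube_avg Q (\<lambda>A. (sqrt \<bar>g A\<bar>)\<^sup>2) * cube_avg Q (\<lambda>A. (sqrt \<bar>g A\<bar> * \<bar>h A\<bar>)\<^sup>2)"
    by (rule cube_avg_Cauchy_Schwarz)
  also have "\<dots> = n1 * cube_avg Q (\<lambda>A. \<bar>g A\<bar> * (h A)\<^sup>2)"
    by (simp add: n1_def power_mult_distrib)
  also have "\<dots> \<le> n1 * (n2 * X)" using gh2 n by (intro mult_left_mono)
  finally have "X * X \<le> (n1 * n2) * X" by (simp add: power2_eq_square algebra_simps)
  then have "X \<le> n1 * n2" using X0 n by (cases "X = 0") auto
  then show ?thesis by (simp add: X_def n1_def n2_def)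
qed

definition flip :: "'q \<Rightarrow> 'q set \<Rightarrow> 'q set" where
  "flip j A = (if j \<in> A then A - {j} else insert j A)"

lemma flip_flip [simp]: "flip j (flip j A) = A"
  by (auto simp: flip_def)

lemma flip_subset: "j \<in> Q \<Longrightarrow> A \<subseteq> Q \<Longrightarrow> flip j A \<subseteq> Q"
  by (auto simp: flip_def)

lemma cube_avg_flip:
  assumes "j \<in> Q"
  shows "cube_avg Q (\<lambda>A. f (flip j A)) = cube_avg Q f"
proof -
  have "(\<Sum>A\<in>Pow Q. f (flip j A)) = (\<Sum>A\<in>Pow Q. f A)"
    by (rule sum.reindex_bij_witness[where i="flip j" and j="flip j"]) (simp_all add: flip_subset assms)
  then show ?thesis by (simp add: cube_avg_def)
qed

lemma walsh_flip:
  assumes "finite S"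
  shows "walsh S (flip j A) = (if j \<in> S then - walsh S A else walsh S A)"
proof (cases "j \<in> S")
  case True
  show ?thesis
  proof (cases "j \<in> A")
    case jA: True
    have "S \<inter> A = insert j (S \<inter> (A - {j}))" using True jA by auto
    moreover have "card (insert j (S \<inter> (A - {j}))) = Suc (card (S \<inter> (A - {j})))" using assms by simp
    ultimately have "card (S \<inter> A) = Suc (card (S \<inter> (A - {j})))" by simp
    then show ?thesis using True jA by (simp add: walsh_def flip_def)
  next
    case jA: False
    have "S \<inter> insert j A = insert j (S \<inter> A)" using True by auto
    then have "card (S \<inter> insert j A) = Suc (card (S \<inter> A))" using assms jA by simp
    then show ?thesis using True jA by (simp add: walsh_def flip_def)
  qed
next
  case False
  then have "S \<inter> flip j A = S \<inter> A" by (auto simp: flip_def)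
  then show ?thesis using False by (simp add: walsh_def)
qed

lemma walsh_coeff_diff_flip:
  assumes "finite Q" "j \<in> Q" "S \<subseteq> Q"
  shows "walsh_coeff Q (\<lambda>A. f A - f (flip j A)) S = (if j \<in> S then 2 * walsh_coeff Q f S else 0)"
proof -
  have fS: "finite S" using assms finite_subset by auto
  have "cube_avg Q (\<lambda>A. f (flip j A) * walsh S A) = cube_avg Q (\<lambda>A. f (flip j (flip j A)) * walsh S (flip j A))"
    using cube_avg_flip[OF assms(2), of "\<lambda>A. f (flip j A) * walsh S A"] by simp
  also have "\<dots> = cube_avg Q (\<lambda>A. (if j \<in> S then -1 else 1) * (f A * walsh S A))"
    by (intro cube_avg_cong) (simp add: walsh_flip[OF fS])
  also have "\<dots> = (if j \<in> S then -1 else 1) * walsh_coeff Q f S"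
    by (simp only: cube_avg_cmult walsh_coeff_def)
  finally show ?thesis
    by (simp add: walsh_coeff_def left_diff_distrib cube_avg_diff)
qed

text \<open>
  A bound of Talagrand type, proved in the manner of Kahn, Kalai and Linial. The variance is the sum of the squared
  Walsh coefficients over nonempty \<open>S\<close>, and each of them is counted \<open>|S|\<close> times by the discrete derivatives.
  For \<open>|S| > k\<close> this already gains a factor \<open>k\<close>; for \<open>|S| \<le> k\<close> the coefficients are compared with
  the noisy ones at the price \<open>3 ^ k\<close>, and there the smallness \<open>\<kappa>\<close> of the first moments enters.
\<close>

theorem cube_variance_bound:
  fixes f :: "'q set \<Rightarrow> real" and b :: "'q \<Rightarrow> real"
  assumes fin: "finite Q" and k: "0 < k" and \<kappa>: "0 \<le> \<kappa>"
    and L2: "\<And>j. j \<in> Q \<Longrightarrow> cube_avg Q (\<lambda>A. (f A - f (flip j A))\<^sup>2) \<le> b j"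
    and L1: "\<And>j. j \<in> Q \<Longrightarrow> (cube_avg Q (\<lambda>A. \<bar>f A - f (flip j A)\<bar>))\<^sup>2 \<le> \<kappa>\<^sup>2 * b j"
  shows "4 * (cube_avg Q (\<lambda>A. (f A)\<^sup>2) - (cube_avg Q f)\<^sup>2) \<le> (3 ^ k * \<kappa> + 1 / real k) * (\<Sum>j\<in>Q. b j)"
proof -
  define c where "c = walsh_coeff Q f"
  \<comment> \<open>The weight with which \<open>S\<close> is counted, once by the noise bound and once by the plain second moment.\<close>
  define w where "w S = (3 ^ k * (1/3) ^ card S + 1 / real k :: real)" for S :: "'q set"
  have card_ge: "1 \<le> real (card S) * w S" if "S \<subseteq> Q" "S \<noteq> {}" for S
  proof -
    have cS: "1 \<le> card S" using that fin finite_subset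
      by (metis One_nat_def Suc_leI card_gt_0_iff)
    show ?thesis
    proof (cases "card S \<le> k")
      case True
      have "(1::real) \<le> 3 ^ k * (1/3) ^ card S"
        using True by (simp add: power_divide field_simps power_increasing)
      then have "1 \<le> w S" using k by (simp add: w_def add_increasing2)
      then have "1 * 1 \<le> real (card S) * w S" using cS by (intro mult_mono) auto
      then show ?thesis by simp
    next
      case False
      then have "1 \<le> real (card S) * (1 / real k)" using k by simp
      also have "\<dots> \<le> real (card S) * w S" by (intro mult_left_mono) (auto simp: w_def)
      finally show ?thesis .
    qed
  qed
  have var: "cube_avg Q (\<lambda>A. (f A)\<^sup>2) - (cube_avg Q f)\<^sup>2 = (\<Sum>S\<in>Pow Q - {{}}. (c S)\<^sup>2)"
  proof -
    have "(\<Sum>S\<in>Pow Q. (c S)\<^sup>2) = (c {})\<^sup>2 + (\<Sum>S\<in>Pow Q - {{}}. (c S)\<^sup>2)"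
      using fin by (intro sum.remove) auto
    moreover have "c {} = cube_avg Q f" by (simp add: c_def walsh_coeff_def)
    ultimately show ?thesis using parseval[OF fin, of f] by (simp add: c_def)
  qed
  have "4 * (\<Sum>S\<in>Pow Q - {{}}. (c S)\<^sup>2) \<le> (\<Sum>S\<in>Pow Q - {{}}. real (card S) * w S * (4 * (c S)\<^sup>2))"
    unfolding sum_distrib_left
  proof (rule sum_mono)
    fix S assume "S \<in> Pow Q - {{}}"
    then have "1 * (4 * (c S)\<^sup>2) \<le> real (card S) * w S * (4 * (c S)\<^sup>2)"
      by (intro mult_right_mono card_ge) auto
    then show "4 * (c S)\<^sup>2 \<le> real (card S) * w S * (4 * (c S)\<^sup>2)" by simp
  qed
  also have "\<dots> \<le> (\<Sum>S\<in>Pow Q. real (card S) * w S * (4 * (c S)\<^sup>2))"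
    using fin by (intro sum_mono2) (auto simp: w_def)
  also have "\<dots> = (\<Sum>S\<in>Pow Q. \<Sum>j\<in>Q. (if j \<in> S then w S * (4 * (c S)\<^sup>2) else 0))"
  proof (intro sum.cong refl)
    fix S assume "S \<in> Pow Q"
    then have "Q \<inter> S = S" by auto
    then show "real (card S) * w S * (4 * (c S)\<^sup>2) = (\<Sum>j\<in>Q. (if j \<in> S then w S * (4 * (c S)\<^sup>2) else 0))"
      using fin by (simp add: sum.inter_restrict[symmetric])
  qed
  also have "\<dots> = (\<Sum>j\<in>Q. \<Sum>S\<in>Pow Q. (if j \<in> S then w S * (4 * (c S)\<^sup>2) else 0))"
    by (rule sum.swap)
  also have "\<dots> \<le> (\<Sum>j\<in>Q. (3 ^ k * \<kappa> + 1 / real k) * b j)"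
  proof (rule sum_mono)
    fix j assume j: "j \<in> Q"
    define g where "g A = f A - f (flip j A)" for A
    have gh: "walsh_coeff Q g S = (if j \<in> S then 2 * c S else 0)" if "S \<subseteq> Q" for S
      unfolding g_def c_def using walsh_coeff_diff_flip[OF fin j that] .
    have "(\<Sum>S\<in>Pow Q. (if j \<in> S then w S * (4 * (c S)\<^sup>2) else 0))
      = (\<Sum>S\<in>Pow Q. 3 ^ k * ((1/3) ^ card S * (walsh_coeff Q g S)\<^sup>2) + 1 / real k * (walsh_coeff Q g S)\<^sup>2)"
      by (intro sum.cong refl) (auto simp: gh w_def power_mult_distrib algebra_simps)
    also have "\<dots> = 3 ^ k * (\<Sum>S\<in>Pow Q. (1/3) ^ card S * (walsh_coeff Q g S)\<^sup>2)
        + 1 / real k * cube_avg Q (\<lambda>A. (g A)\<^sup>2)"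
      by (simp only: sum.distrib sum_distrib_left[symmetric] parseval[OF fin])
    also have "\<dots> \<le> 3 ^ k * (\<kappa> * b j) + 1 / real k * b j"
    proof (intro add_mono mult_left_mono)
      have b0: "0 \<le> b j"
        using L2[OF j] cube_avg_nonneg[of Q "\<lambda>A. (f A - f (flip j A))\<^sup>2"] by simp
      have "(cube_avg Q (\<lambda>A. \<bar>g A\<bar>))\<^sup>2 * cube_avg Q (\<lambda>A. (g A)\<^sup>2) \<le> (\<kappa>\<^sup>2 * b j) * b j"
        unfolding g_def using L1[OF j] L2[OF j] b0
        by (intro mult_mono) (auto intro!: cube_avg_nonneg)
      then have "sqrt ((cube_avg Q (\<lambda>A. \<bar>g A\<bar>))\<^sup>2 * cube_avg Q (\<lambda>A. (g A)\<^sup>2)) \<le> sqrt ((\<kappa> * b j)\<^sup>2)"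
        by (intro real_sqrt_le_mono) (simp add: power2_eq_square algebra_simps)
      then have "cube_avg Q (\<lambda>A. \<bar>g A\<bar>) * sqrt (cube_avg Q (\<lambda>A. (g A)\<^sup>2)) \<le> \<kappa> * b j"
        using \<kappa> b0 cube_avg_nonneg[of Q "\<lambda>A. \<bar>g A\<bar>"] by (simp add: real_sqrt_mult)
      then show "(\<Sum>S\<in>Pow Q. (1/3) ^ card S * (walsh_coeff Q g S)\<^sup>2) \<le> \<kappa> * b j"
        using noise_norm_le[OF fin, of g] by linarith
      show "cube_avg Q (\<lambda>A. (g A)\<^sup>2) \<le> b j" unfolding g_def by (rule L2[OF j])
    qed auto
    finally show "(\<Sum>S\<in>Pow Q. (if j \<in> S then w S * (4 * (c S)\<^sup>2) else 0)) \<le> (3 ^ k * \<kappa> + 1 / real k) * b j"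
      by (simp add: algebra_simps)
  qed
  finally show ?thesis using var by (simp add: sum_distrib_left)
qed


section \<open>Averages of optimal sums driven by coin flips\<close>

text \<open>
  Each index \<open>e\<close> owns the \<open>N\<close> signs indexed by \<open>(e, 0), ..., (e, N - 1)\<close>; their normalised sum is the
  discrete substitute of a Gaussian variable attached to \<open>e\<close>.
\<close>

definition signsum :: "nat \<Rightarrow> ('e \<times> nat) set \<Rightarrow> 'e \<Rightarrow> real" where
  "signsum N \<omega> e = (\<Sum>l<N. if (e, l) \<in> \<omega> then 1 else - 1) / sqrt (real N)"

lemma signsum_flip_other: "e' \<noteq> e \<Longrightarrow> signsum N (flip (e, l) \<omega>) e' = signsum N \<omega> e'"
  unfolding signsum_def flip_def by (intro arg_cong2[where f="(/)"] sum.cong refl) auto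

lemma signsum_flip:
  assumes "l < N"
  shows "\<bar>signsum N (flip (e, l) \<omega>) e - signsum N \<omega> e\<bar> = 2 / sqrt (real N)"
proof -
  let ?s = "\<lambda>\<omega> l. if (e, l) \<in> \<omega> then 1 else - 1 :: real"
  have "(\<Sum>i<N. ?s (flip (e, l) \<omega>) i) - (\<Sum>i<N. ?s \<omega> i) = (\<Sum>i<N. ?s (flip (e, l) \<omega>) i - ?s \<omega> i)"
    by (simp add: sum_subtractf)
  also have "\<dots> = (\<Sum>i\<in>{l}. ?s (flip (e, l) \<omega>) i - ?s \<omega> i)"
    using assms by (intro sum.mono_neutral_right) (auto simp: flip_def)
  finally have "\<bar>(\<Sum>i<N. ?s (flip (e, l) \<omega>) i) - (\<Sum>i<N. ?s \<omega> i)\<bar> = 2"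
    by (auto simp: flip_def)
  then show ?thesis
    unfolding signsum_def by (simp add: diff_divide_distrib[symmetric])
qed

lemma signsum_abs_le: "\<bar>signsum N \<omega> e\<bar> \<le> sqrt (real N)"
proof -
  have "\<bar>\<Sum>l<N. if (e, l) \<in> \<omega> then 1 else - 1 :: real\<bar> \<le> (\<Sum>l<N. \<bar>if (e, l) \<in> \<omega> then 1 else - 1 :: real\<bar>)"
    by (rule sum_abs)
  also have "\<dots> \<le> (\<Sum>l<N. 1)" by (intro sum_mono) auto
  finally have "\<bar>\<Sum>l<N. if (e, l) \<in> \<omega> then 1 else - 1 :: real\<bar> \<le> real N" by simp
  then have "\<bar>signsum N \<omega> e\<bar> \<le> real N / sqrt (real N)"
    unfolding signsum_def by (simp add: divide_right_mono)
  then show ?thesis by (simp add: real_div_sqrt)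
qed

text \<open>
  This is all that the variance estimate needs to know about geodesics: \<open>tm z x\<close> is the cost of the set
  \<open>opt z x\<close>, and after a change of the weights the old optimal set is still an admissible competitor. The index
  \<open>z\<close> runs through the translations over which the average is taken.
\<close>

locale optimal_sets =
  fixes E :: "'e set" and Z :: "'z set" and K :: real
    and opt :: "'z \<Rightarrow> ('e \<Rightarrow> real) \<Rightarrow> 'e set" and tm :: "'z \<Rightarrow> ('e \<Rightarrow> real) \<Rightarrow> real"
  assumes finite_E: "finite E" and finite_Z: "finite Z" and Z_nonempty: "Z \<noteq> {}" and K_nonneg: "0 \<le> K"
    and opt_subset: "\<And>z x. z \<in> Z \<Longrightarrow> opt z x \<subseteq> E"
    and tm_opt: "\<And>z x. z \<in> Z \<Longrightarrow> tm z x = (\<Sum>e\<in>opt z x. x e)"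
    and tm_le: "\<And>z x y. z \<in> Z \<Longrightarrow> tm z y \<le> (\<Sum>e\<in>opt z x. y e)"
begin

definition avg_time :: "('e \<Rightarrow> real) \<Rightarrow> real" where
  "avg_time x = (\<Sum>z\<in>Z. min K (tm z x)) / card Z"

text \<open>
  The proportion of the truncated optimal sums that react to an increase of the weight of \<open>e\<close>; it plays
  the role of the partial derivative of \<open>avg_time\<close>.
\<close>

definition influence :: "'e \<Rightarrow> ('e \<Rightarrow> real) \<Rightarrow> real" where
  "influence e x = (\<Sum>z\<in>Z. if e \<in> opt z x \<and> tm z x < K then 1 else 0) / card Z"

lemma card_Z: "0 < real (card Z)"
  using finite_Z Z_nonempty by (simp add: card_gt_0_iff)

lemma influence_nonneg: "0 \<le> influence e x"
  unfolding influence_def by (intro divide_nonneg_nonneg sum_nonneg) auto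

lemma influence_le_1: "influence e x \<le> 1"
proof -
  have "(\<Sum>z\<in>Z. if e \<in> opt z x \<and> tm z x < K then 1 else 0 :: real) \<le> (\<Sum>z\<in>Z. 1)"
    by (intro sum_mono) auto
  then show ?thesis unfolding influence_def using card_Z by simp
qed

text \<open>
  The optimal sets for \<open>x\<close> are competitors for the modified weights, and only those that contain \<open>e\<close> are
  affected by the modification. The bound is one-sided: the influence is taken at the configuration from which the
  increase is measured.
\<close>

lemma avg_time_diff: "avg_time (x(e := t)) - avg_time x \<le> \<bar>t - x e\<bar> * influence e x"
proof -
  let ?y = "x(e := t)"
  have "min K (tm z ?y) - min K (tm z x) \<le> \<bar>t - x e\<bar> * (if e \<in> opt z x \<and> tm z x < K then 1 else 0)"
    if z: "z \<in> Z" for z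
  proof (cases "tm z x < K")
    case False
    then show ?thesis by auto
  next
    case True
    have fin: "finite (opt z x)" by (rule finite_subset[OF opt_subset[OF z] finite_E])
    have "tm z ?y \<le> (\<Sum>e'\<in>opt z x. ?y e')" by (rule tm_le[OF z])
    also have "\<dots> = (\<Sum>e'\<in>opt z x. x e' + (if e' = e then t - x e else 0))"
      by (intro sum.cong) auto
    also have "\<dots> = tm z x + (if e \<in> opt z x then t - x e else 0)"
      using fin by (simp add: sum.distrib tm_opt[OF z] sum.delta)
    finally have "tm z ?y \<le> tm z x + (if e \<in> opt z x then t - x e else 0)" .
    then show ?thesis using True by (auto split: if_splits)
  qed
  then have "(\<Sum>z\<in>Z. min K (tm z ?y) - min K (tm z x)) \<le> (\<Sum>z\<in>Z. \<bar>t - x e\<bar> * (if e \<in> opt z x \<and> tm z x < K then 1 else 0))"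
    by (intro sum_mono)
  then have "(\<Sum>z\<in>Z. min K (tm z ?y) - min K (tm z x)) / card Z
      \<le> (\<Sum>z\<in>Z. \<bar>t - x e\<bar> * (if e \<in> opt z x \<and> tm z x < K then 1 else 0)) / card Z"
    by (intro divide_right_mono) auto
  then show ?thesis
    by (simp only: avg_time_def influence_def sum_subtractf diff_divide_distrib sum_distrib_left[symmetric] times_divide_eq_right)
qed

text \<open>
  For a single \<open>z\<close> the sum over \<open>e\<close> of the weights on the optimal set is the optimal cost, and it only
  counts when it lies below the truncation level \<open>K\<close>. It is this weighting by \<open>x e\<close> that makes a count of
  the edges of a geodesic superfluous here.
\<close>

lemma sum_weight_influence_le: "(\<Sum>e\<in>E. x e * influence e x) \<le> K"
proof -
  have "(\<Sum>e\<in>E. x e * influence e x)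
      = (\<Sum>e\<in>E. \<Sum>z\<in>Z. x e * (if e \<in> opt z x \<and> tm z x < K then 1 else 0) / card Z)"
    by (simp add: influence_def sum_distrib_left sum_divide_distrib)
  also have "\<dots> = (\<Sum>z\<in>Z. \<Sum>e\<in>E. x e * (if e \<in> opt z x \<and> tm z x < K then 1 else 0) / card Z)"
    by (rule sum.swap)
  also have "\<dots> \<le> (\<Sum>z\<in>Z. K / card Z)"
  proof (rule sum_mono)
    fix z assume z: "z \<in> Z"
    have "(\<Sum>e\<in>E. x e * (if e \<in> opt z x \<and> tm z x < K then 1 else 0)) \<le> K"
    proof (cases "tm z x < K")
      case True
      have "(\<Sum>e\<in>E. x e * (if e \<in> opt z x \<and> tm z x < K then 1 else 0)) = (\<Sum>e\<in>opt z x. x e)"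
        using True opt_subset[OF z] finite_E by (intro sum.mono_neutral_cong_right) auto
      then show ?thesis using True by (simp add: tm_opt[OF z])
    qed (use K_nonneg in simp)
    then show "(\<Sum>e\<in>E. x e * (if e \<in> opt z x \<and> tm z x < K then 1 else 0) / card Z) \<le> K / card Z"
      by (simp add: sum_divide_distrib[symmetric] divide_right_mono)
  qed
  also have "\<dots> = K" using card_Z by simp
  finally show ?thesis .
qed

text \<open>
  The variance bound on the cube applied to \<open>f = exp (u / 2 * avg_time)\<close>. One flip moves the square
  root of one weight by at most \<open>\<eta> = 2 A / sqrt N\<close>, hence the weight \<open>x\<close> itself by about
  \<open>\<eta> sqrt x\<close>; together with \<open>avg_time_diff\<close> the squared effect on \<open>f\<close> is of order
  \<open>u\<^sup>2 \<eta>\<^sup>2 x * influence * f\<^sup>2\<close>. Summed over the \<open>N\<close> signs of each edge and over the edges this is of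
  order \<open>u\<^sup>2 K f\<^sup>2\<close> by \<open>sum_weight_influence_le\<close>. The ratio of the squared first moment to the second
  moment is at most the expected influence, by the Cauchy-Schwarz inequality. The condition on \<open>N\<close> absorbs the
  error terms of order \<open>\<eta>\<^sup>2\<close>, one for each edge.
\<close>

theorem cube_exp_variance_bound:
  fixes U :: "real \<Rightarrow> real" and A u :: real
  defines "x \<equiv> \<lambda>N \<omega> e. U (signsum N \<omega> e)"
  assumes A: "0 \<le> A" and U: "\<And>s. 0 \<le> U s" and lip: "\<And>s t. \<bar>sqrt (U s) - sqrt (U t)\<bar> \<le> A * \<bar>s - t\<bar>"
    and N: "0 < N" "4 * A\<^sup>2 * card E \<le> N" and k: "0 < k" and \<kappa>: "0 \<le> \<kappa>"
    and infl: "\<And>e. e \<in> E \<Longrightarrow> 2 * cube_avg (E \<times> {..<N}) (\<lambda>\<omega>. influence e (x N \<omega>)) \<le> \<kappa>\<^sup>2"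
    and u: "\<bar>u\<bar> \<le> 1"
  shows "cube_avg (E \<times> {..<N}) (\<lambda>\<omega>. exp (u * avg_time (x N \<omega>)))
      - (cube_avg (E \<times> {..<N}) (\<lambda>\<omega>. exp (u / 2 * avg_time (x N \<omega>))))\<^sup>2
    \<le> (3 ^ k * \<kappa> + 1 / k) * (A\<^sup>2 * exp (4 * A * (sqrt (U 0) + A)) * (4 * K + 1)) * u\<^sup>2
      * cube_avg (E \<times> {..<N}) (\<lambda>\<omega>. exp (u * avg_time (x N \<omega>)))"
proof -
  define Q where "Q = E \<times> {..<N}"
  define X where "X = x N"
  define R where "R = 4 * A * (sqrt (U 0) + A)"
  define \<eta> where "\<eta> = 2 * A / sqrt (real N)"
  define f where "f \<omega> = exp (u / 2 * avg_time (X \<omega>))" for \<omega>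
  define a where "a e \<omega> = influence e (X \<omega>)" for e \<omega>
  define g where "g e \<omega> = a e \<omega> * (4 * X \<omega> e + \<eta>\<^sup>2) * (f \<omega>)\<^sup>2" for e \<omega>
  define g1 where "g1 e \<omega> = a e \<omega> * (2 * sqrt (X \<omega> e) + \<eta>) * f \<omega>" for e \<omega>
  define b where "b j = exp R * u\<^sup>2 * \<eta>\<^sup>2 * cube_avg Q (g (fst j))" for j :: "'e \<times> nat"
  have finQ: "finite Q" using finite_E by (simp add: Q_def)
  have X0: "0 \<le> X \<omega> e" for \<omega> e by (simp add: X_def x_def U)
  have \<eta>0: "0 \<le> \<eta>" using A by (simp add: \<eta>_def)
  have sN: "0 < sqrt (real N)" using N by simp
  have \<eta>2: "\<eta>\<^sup>2 * real N = 4 * A\<^sup>2" using N by (simp add: \<eta>_def power_divide power_mult_distrib)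
  have f0: "0 < f \<omega>" for \<omega> by (simp add: f_def)
  have f2: "(f \<omega>)\<^sup>2 = exp (u * avg_time (X \<omega>))" for \<omega> by (simp add: f_def exp_double[symmetric])
  have a01: "0 \<le> a e \<omega>" "a e \<omega> \<le> 1" for e \<omega> by (auto simp: a_def influence_nonneg influence_le_1)
  have g0: "0 \<le> g e \<omega>" for e \<omega> using a01 X0 by (simp add: g_def)
  have step: "(f \<omega> - f (flip j \<omega>))\<^sup>2 \<le> exp R * u\<^sup>2 * \<eta>\<^sup>2 / 2 * (g (fst j) \<omega> + g (fst j) (flip j \<omega>))"
    "\<bar>f \<omega> - f (flip j \<omega>)\<bar> \<le> exp (R / 2) * \<bar>u\<bar> * \<eta> / 2 * (g1 (fst j) \<omega> + g1 (fst j) (flip j \<omega>))"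
    if j: "j \<in> Q" for j \<omega>
  proof -
    obtain e l where jel: "j = (e, l)" "e \<in> E" "l < N" using j by (auto simp: Q_def)
    define \<omega>' where "\<omega>' = flip j \<omega>"
    have flip1: "X \<omega>' = (X \<omega>)(e := X \<omega>' e)"
      by (rule ext) (simp add: X_def x_def \<omega>'_def jel signsum_flip_other)
    have flip2: "X \<omega> = (X \<omega>')(e := X \<omega> e)"
      by (rule ext) (simp add: X_def x_def \<omega>'_def jel signsum_flip_other)
    have sq: "\<bar>sqrt (X \<omega>' e) - sqrt (X \<omega> e)\<bar> \<le> \<eta>"
      using lip[of "signsum N \<omega>' e" "signsum N \<omega> e"] signsum_flip[OF jel(3), of e \<omega>]
      by (simp add: X_def x_def \<omega>'_def jel \<eta>_def mult.commute)
    define p p' where "p = sqrt (X \<omega> e)" and "p' = sqrt (X \<omega>' e)"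
    have p: "0 \<le> p" "0 \<le> p'" "p\<^sup>2 = X \<omega> e" "p'\<^sup>2 = X \<omega>' e" by (auto simp: p_def p'_def X0)
    have pp: "p' \<le> p + \<eta>" "p \<le> p' + \<eta>" using sq by (auto simp: p_def p'_def)
    define \<Delta> where "\<Delta> = \<bar>X \<omega>' e - X \<omega> e\<bar>"
    have \<Delta>_eq: "\<Delta> = \<bar>p' - p\<bar> * (p' + p)"
      using p by (simp add: \<Delta>_def p(3)[symmetric] p(4)[symmetric] power2_eq_square square_diff_square_factored abs_mult mult.commute)
    have \<Delta>1: "\<Delta> \<le> \<eta> * (2 * p + \<eta>)" "\<Delta> \<le> \<eta> * (2 * p' + \<eta>)"
      unfolding \<Delta>_eq using pp p sq \<eta>0 by (auto intro!: mult_mono simp: p_def p'_def)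
    \<comment> \<open>A sign sum is at most \<open>sqrt N\<close> in absolute value, so a flip moves a weight by a bounded amount although the weights are unbounded.\<close>
    have \<Delta>R: "\<Delta> \<le> R"
    proof -
      have bnd: "sqrt (X w e) \<le> sqrt (U 0) + A * sqrt (real N)" for w
      proof -
        have "\<bar>sqrt (X w e) - sqrt (U 0)\<bar> \<le> A * \<bar>signsum N w e\<bar>"
          using lip[of "signsum N w e" 0] by (simp add: X_def x_def)
        also have "\<dots> \<le> A * sqrt (real N)" using A signsum_abs_le by (intro mult_left_mono)
        finally show ?thesis by linarith
      qed
      have "\<Delta> \<le> \<eta> * (2 * (sqrt (U 0) + A * sqrt (real N)))"
        unfolding \<Delta>_eq using bnd[of \<omega>] bnd[of \<omega>'] sq p \<eta>0
        by (intro mult_mono) (auto simp: p_def p'_def)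
      also have "\<dots> = 4 * A * (sqrt (U 0) / sqrt (real N)) + 4 * A * A"
        using sN by (simp add: \<eta>_def field_simps)
      also have "\<dots> \<le> 4 * A * (sqrt (U 0) / 1) + 4 * A * A"
        using A U N by (intro add_mono mult_left_mono divide_left_mono) auto
      finally show ?thesis by (simp add: R_def algebra_simps)
    qed
    have \<Delta>0: "0 \<le> \<Delta>" by (simp add: \<Delta>_def)
    have dF: "\<bar>avg_time (X \<omega>) - avg_time (X \<omega>')\<bar> \<le> \<Delta> * max (a e \<omega>) (a e \<omega>')"
    proof -
      have "avg_time (X \<omega>') - avg_time (X \<omega>) \<le> \<Delta> * a e \<omega>"
        using avg_time_diff[of "X \<omega>" e "X \<omega>' e"] flip1 by (simp add: \<Delta>_def a_def)
      moreover have "avg_time (X \<omega>) - avg_time (X \<omega>') \<le> \<Delta> * a e \<omega>'"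
        using avg_time_diff[of "X \<omega>'" e "X \<omega> e"] flip2 by (simp add: \<Delta>_def a_def abs_minus_commute)
      moreover have "\<Delta> * a e \<omega> \<le> \<Delta> * max (a e \<omega>) (a e \<omega>')" "\<Delta> * a e \<omega>' \<le> \<Delta> * max (a e \<omega>) (a e \<omega>')"
        using \<Delta>0 by (auto intro!: mult_left_mono)
      ultimately show ?thesis by linarith
    qed
    define m where "m = max (a e \<omega>) (a e \<omega>')"
    have m01: "0 \<le> m" "m \<le> 1" using a01 by (auto simp: m_def max_def)
    have dFR: "\<bar>avg_time (X \<omega>) - avg_time (X \<omega>')\<bar> \<le> R"
      using dF \<Delta>R \<Delta>0 m01 mult_left_mono[of m 1 \<Delta>] by (simp add: m_def)
    have ratio: "exp y \<le> exp (R / 2) * exp z" if "\<bar>y - z\<bar> \<le> R / 2" for y z :: real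
    proof -
      have "y \<le> R / 2 + z" using that by linarith
      then show ?thesis by (simp add: exp_add[symmetric])
    qed
    have uu: "\<bar>u / 2 * y - u / 2 * z\<bar> = \<bar>u\<bar> / 2 * \<bar>y - z\<bar>" for y z
      unfolding right_diff_distrib[symmetric] by (simp add: abs_mult)
    have uR: "\<bar>u / 2 * avg_time (X \<omega>) - u / 2 * avg_time (X \<omega>')\<bar> \<le> R / 2"
    proof -
      have "\<bar>u / 2 * avg_time (X \<omega>) - u / 2 * avg_time (X \<omega>')\<bar> = \<bar>u\<bar> / 2 * \<bar>avg_time (X \<omega>) - avg_time (X \<omega>')\<bar>"
        by (rule uu)
      also have "\<dots> \<le> 1 / 2 * R" using u dFR by (intro mult_mono) auto
      finally show ?thesis by simp
    qed
    \<comment> \<open>The values of \<open>f\<close> before and after a flip are comparable, so either may be used in the bounds.\<close>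
    define M where "M = max (f \<omega>) (f \<omega>')"
    have M: "M \<le> exp (R / 2) * f \<omega>" "M \<le> exp (R / 2) * f \<omega>'" "0 \<le> M"
    proof -
      have R0: "1 \<le> exp (R / 2)" using \<Delta>0 \<Delta>R by simp
      have 1: "f \<omega> \<le> exp (R / 2) * f \<omega>'" using ratio uR by (auto simp: f_def)
      have 2: "f \<omega>' \<le> exp (R / 2) * f \<omega>" using ratio uR by (auto simp: f_def abs_minus_commute)
      have 3: "f \<omega> \<le> exp (R / 2) * f \<omega>" "f \<omega>' \<le> exp (R / 2) * f \<omega>'"
        using mult_right_mono[OF R0, of "f \<omega>"] mult_right_mono[OF R0, of "f \<omega>'"] f0[of \<omega>] f0[of \<omega>'] by simp_all
      show "M \<le> exp (R / 2) * f \<omega>" "M \<le> exp (R / 2) * f \<omega>'" "0 \<le> M"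
        using 1 2 3 f0[of \<omega>] by (auto simp: M_def)
    qed
    have dexp: "\<bar>exp y - exp z\<bar> \<le> \<bar>y - z\<bar> * max (exp y) (exp z)" for y z :: real
    proof -
      have *: "exp y - exp z \<le> (y - z) * exp y" for y z :: real
      proof -
        have "exp y * (1 + (z - y)) \<le> exp y * exp (z - y)"
          by (intro mult_left_mono exp_ge_add_one_self) simp
        then show ?thesis by (simp add: exp_add[symmetric] algebra_simps)
      qed
      show ?thesis
      proof (cases "z \<le> y")
        case True
        then show ?thesis using *[of y z] by (simp add: max_def)
      next
        case False
        then show ?thesis using *[of z y] by (simp add: max_def abs_minus_commute)
      qed
    qed
    have df: "\<bar>f \<omega> - f \<omega>'\<bar> \<le> \<bar>u\<bar> / 2 * (\<Delta> * m) * M"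
    proof -
      have "\<bar>f \<omega> - f \<omega>'\<bar> \<le> \<bar>u / 2 * avg_time (X \<omega>) - u / 2 * avg_time (X \<omega>')\<bar> * M"
        unfolding f_def M_def by (rule dexp)
      also have "\<bar>u / 2 * avg_time (X \<omega>) - u / 2 * avg_time (X \<omega>')\<bar> = \<bar>u\<bar> / 2 * \<bar>avg_time (X \<omega>) - avg_time (X \<omega>')\<bar>"
        by (rule uu)
      also have "\<dots> * M \<le> \<bar>u\<bar> / 2 * (\<Delta> * m) * M"
        using dF M(3) by (intro mult_right_mono mult_left_mono) (auto simp: m_def)
      finally show ?thesis .
    qed
    have mcase: "m = a e \<omega> \<or> m = a e \<omega>'" by (auto simp: m_def max_def)
    have mM1: "\<Delta> * m * M \<le> exp (R / 2) * \<eta> * (g1 e \<omega> + g1 e \<omega>')"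
    proof -
      have g10: "0 \<le> g1 e \<omega>" "0 \<le> g1 e \<omega>'" using a01 X0 f0[THEN less_imp_le] \<eta>0 by (auto simp: g1_def)
      have "\<Delta> * a e \<omega> * M \<le> (\<eta> * (2 * p + \<eta>)) * a e \<omega> * (exp (R / 2) * f \<omega>)"
        using \<Delta>1 M a01 \<Delta>0 \<eta>0 p by (intro mult_mono) auto
      moreover have "\<Delta> * a e \<omega>' * M \<le> (\<eta> * (2 * p' + \<eta>)) * a e \<omega>' * (exp (R / 2) * f \<omega>')"
        using \<Delta>1 M a01 \<Delta>0 \<eta>0 p by (intro mult_mono) auto
      moreover have "(\<eta> * (2 * p + \<eta>)) * a e \<omega> * (exp (R / 2) * f \<omega>) = exp (R / 2) * \<eta> * g1 e \<omega>"
        "(\<eta> * (2 * p' + \<eta>)) * a e \<omega>' * (exp (R / 2) * f \<omega>') = exp (R / 2) * \<eta> * g1 e \<omega>'"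
        by (simp_all add: g1_def p_def p'_def)
      moreover have "exp (R / 2) * \<eta> * g1 e \<omega> \<le> exp (R / 2) * \<eta> * (g1 e \<omega> + g1 e \<omega>')"
        "exp (R / 2) * \<eta> * g1 e \<omega>' \<le> exp (R / 2) * \<eta> * (g1 e \<omega> + g1 e \<omega>')"
        using g10 \<eta>0 by (auto intro!: mult_left_mono)
      ultimately have "\<Delta> * a e \<omega> * M \<le> exp (R / 2) * \<eta> * (g1 e \<omega> + g1 e \<omega>')"
        "\<Delta> * a e \<omega>' * M \<le> exp (R / 2) * \<eta> * (g1 e \<omega> + g1 e \<omega>')" by linarith+
      then show ?thesis using mcase by metis
    qed
    have sq_le: "(2 * q + \<eta>)\<^sup>2 \<le> 2 * (4 * q\<^sup>2 + \<eta>\<^sup>2)" for q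
    proof -
      have "0 \<le> (2 * q - \<eta>)\<^sup>2" by simp
      then show ?thesis by (simp add: power2_eq_square algebra_simps)
    qed
    have mM2: "(\<Delta> * m * M)\<^sup>2 \<le> exp R * \<eta>\<^sup>2 * 2 * (g e \<omega> + g e \<omega>')"
    proof -
      have main: "(\<Delta> * a e w * M)\<^sup>2 \<le> exp R * \<eta>\<^sup>2 * 2 * g e w"
        if q: "\<Delta> \<le> \<eta> * (2 * q + \<eta>)" "0 \<le> q" "q\<^sup>2 = X w e" "M \<le> exp (R / 2) * f w" for w q
      proof -
        have "(\<Delta> * a e w * M)\<^sup>2 = \<Delta>\<^sup>2 * (a e w)\<^sup>2 * M\<^sup>2" by (simp add: power_mult_distrib)
        also have "\<dots> \<le> (\<eta> * (2 * q + \<eta>))\<^sup>2 * a e w * (exp (R / 2) * f w)\<^sup>2"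
        proof (intro mult_mono power_mono q M \<Delta>0)
          show "(a e w)\<^sup>2 \<le> a e w" using a01[of e w] mult_left_le[of "a e w" "a e w"] by (simp add: power2_eq_square)
        qed (use a01 in auto)
        also have "\<dots> = exp R * \<eta>\<^sup>2 * ((2 * q + \<eta>)\<^sup>2 * a e w * (f w)\<^sup>2)"
          by (simp add: power_mult_distrib exp_double[symmetric])
        also have "\<dots> \<le> exp R * \<eta>\<^sup>2 * ((2 * (4 * q\<^sup>2 + \<eta>\<^sup>2)) * a e w * (f w)\<^sup>2)"
          using sq_le a01 by (intro mult_left_mono mult_right_mono) auto
        also have "\<dots> = exp R * \<eta>\<^sup>2 * 2 * g e w" by (simp add: g_def q(3))
        finally show ?thesis .
      qed
      have "(\<Delta> * a e \<omega> * M)\<^sup>2 \<le> exp R * \<eta>\<^sup>2 * 2 * g e \<omega>"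
        by (rule main[OF \<Delta>1(1) p(1) p(3) M(1)])
      moreover have "(\<Delta> * a e \<omega>' * M)\<^sup>2 \<le> exp R * \<eta>\<^sup>2 * 2 * g e \<omega>'"
        by (rule main[OF \<Delta>1(2) p(2) p(4) M(2)])
      moreover have "exp R * \<eta>\<^sup>2 * 2 * g e \<omega> \<le> exp R * \<eta>\<^sup>2 * 2 * (g e \<omega> + g e \<omega>')"
        "exp R * \<eta>\<^sup>2 * 2 * g e \<omega>' \<le> exp R * \<eta>\<^sup>2 * 2 * (g e \<omega> + g e \<omega>')"
        using g0 by (auto intro!: mult_left_mono)
      ultimately have "(\<Delta> * a e \<omega> * M)\<^sup>2 \<le> exp R * \<eta>\<^sup>2 * 2 * (g e \<omega> + g e \<omega>')"
        "(\<Delta> * a e \<omega>' * M)\<^sup>2 \<le> exp R * \<eta>\<^sup>2 * 2 * (g e \<omega> + g e \<omega>')" by linarith+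
      then show ?thesis using mcase by metis
    qed
    have "(f \<omega> - f \<omega>')\<^sup>2 \<le> (\<bar>u\<bar> / 2 * (\<Delta> * m) * M)\<^sup>2"
      using power_mono[OF df, of 2] by simp
    also have "\<dots> = u\<^sup>2 / 4 * (\<Delta> * m * M)\<^sup>2" by (simp add: power_mult_distrib power_divide mult.assoc)
    also have "\<dots> \<le> u\<^sup>2 / 4 * (exp R * \<eta>\<^sup>2 * 2 * (g e \<omega> + g e \<omega>'))"
      by (intro mult_left_mono mM2) auto
    finally show "(f \<omega> - f (flip j \<omega>))\<^sup>2 \<le> exp R * u\<^sup>2 * \<eta>\<^sup>2 / 2 * (g (fst j) \<omega> + g (fst j) (flip j \<omega>))"
      by (simp add: jel \<omega>'_def algebra_simps)
    have "\<bar>f \<omega> - f \<omega>'\<bar> \<le> \<bar>u\<bar> / 2 * (\<Delta> * m * M)" using df by (simp add: mult.assoc)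
    also have "\<dots> \<le> \<bar>u\<bar> / 2 * (exp (R / 2) * \<eta> * (g1 e \<omega> + g1 e \<omega>'))"
      by (intro mult_left_mono mM1) auto
    finally show "\<bar>f \<omega> - f (flip j \<omega>)\<bar> \<le> exp (R / 2) * \<bar>u\<bar> * \<eta> / 2 * (g1 (fst j) \<omega> + g1 (fst j) (flip j \<omega>))"
      by (simp add: jel \<omega>'_def algebra_simps)
  qed
  have main: "4 * (cube_avg Q (\<lambda>\<omega>. (f \<omega>)\<^sup>2) - (cube_avg Q f)\<^sup>2) \<le> (3 ^ k * \<kappa> + 1 / k) * (\<Sum>j\<in>Q. b j)"
  proof (rule cube_variance_bound[OF finQ k \<kappa>])
    fix j assume j: "j \<in> Q"
    have "cube_avg Q (\<lambda>\<omega>. (f \<omega> - f (flip j \<omega>))\<^sup>2)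
      \<le> cube_avg Q (\<lambda>\<omega>. exp R * u\<^sup>2 * \<eta>\<^sup>2 / 2 * (g (fst j) \<omega> + g (fst j) (flip j \<omega>)))"
      by (intro cube_avg_mono step(1) j)
    also have "\<dots> = b j"
      by (simp only: cube_avg_cmult cube_avg_add cube_avg_flip[OF j]) (simp add: b_def)
    finally show "cube_avg Q (\<lambda>\<omega>. (f \<omega> - f (flip j \<omega>))\<^sup>2) \<le> b j" .
    have "cube_avg Q (\<lambda>\<omega>. \<bar>f \<omega> - f (flip j \<omega>)\<bar>)
      \<le> cube_avg Q (\<lambda>\<omega>. exp (R / 2) * \<bar>u\<bar> * \<eta> / 2 * (g1 (fst j) \<omega> + g1 (fst j) (flip j \<omega>)))"
      by (intro cube_avg_mono step(2) j)
    also have "\<dots> = exp (R / 2) * \<bar>u\<bar> * \<eta> * cube_avg Q (g1 (fst j))"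
      by (simp only: cube_avg_cmult cube_avg_add cube_avg_flip[OF j]) simp
    finally have "(cube_avg Q (\<lambda>\<omega>. \<bar>f \<omega> - f (flip j \<omega>)\<bar>))\<^sup>2 \<le> (exp (R / 2) * \<bar>u\<bar> * \<eta> * cube_avg Q (g1 (fst j)))\<^sup>2"
      by (intro power_mono cube_avg_nonneg) auto
    also have "\<dots> = exp R * u\<^sup>2 * \<eta>\<^sup>2 * (cube_avg Q (g1 (fst j)))\<^sup>2"
      by (simp add: power_mult_distrib exp_double[symmetric])
    also have "\<dots> \<le> exp R * u\<^sup>2 * \<eta>\<^sup>2 * (\<kappa>\<^sup>2 * cube_avg Q (g (fst j)))"
    proof (rule mult_left_mono)
      define e where "e = fst j"
      have eE: "e \<in> E" using j by (auto simp: Q_def e_def)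
      have "(cube_avg Q (g1 e))\<^sup>2 = (cube_avg Q (\<lambda>\<omega>. sqrt (a e \<omega>) * (sqrt (a e \<omega>) * (2 * sqrt (X \<omega> e) + \<eta>) * f \<omega>)))\<^sup>2"
        using a01 by (intro arg_cong[where f="\<lambda>t. t\<^sup>2"] cube_avg_cong) (simp add: g1_def mult.assoc[symmetric])
      also have "\<dots> \<le> cube_avg Q (\<lambda>\<omega>. (sqrt (a e \<omega>))\<^sup>2) * cube_avg Q (\<lambda>\<omega>. (sqrt (a e \<omega>) * (2 * sqrt (X \<omega> e) + \<eta>) * f \<omega>)\<^sup>2)"
        by (rule cube_avg_Cauchy_Schwarz)
      also have "\<dots> \<le> cube_avg Q (a e) * cube_avg Q (\<lambda>\<omega>. 2 * g e \<omega>)"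
      proof (intro mult_mono cube_avg_nonneg cube_avg_mono)
        fix \<omega>
        show "(sqrt (a e \<omega>))\<^sup>2 \<le> a e \<omega>" using a01 by simp
        have "0 \<le> (2 * sqrt (X \<omega> e) - \<eta>)\<^sup>2" by simp
        then have "(2 * sqrt (X \<omega> e) + \<eta>)\<^sup>2 \<le> 2 * (4 * X \<omega> e + \<eta>\<^sup>2)"
          using X0[of \<omega> e] by (simp add: power2_eq_square algebra_simps)
        then have "a e \<omega> * (2 * sqrt (X \<omega> e) + \<eta>)\<^sup>2 * (f \<omega>)\<^sup>2 \<le> a e \<omega> * (2 * (4 * X \<omega> e + \<eta>\<^sup>2)) * (f \<omega>)\<^sup>2"
          using a01 by (intro mult_right_mono mult_left_mono) auto
        moreover have "(sqrt (a e \<omega>) * (2 * sqrt (X \<omega> e) + \<eta>) * f \<omega>)\<^sup>2 = a e \<omega> * (2 * sqrt (X \<omega> e) + \<eta>)\<^sup>2 * (f \<omega>)\<^sup>2"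
          by (simp only: power_mult_distrib real_sqrt_pow2[OF a01(1)])
        moreover have "a e \<omega> * (2 * (4 * X \<omega> e + \<eta>\<^sup>2)) * (f \<omega>)\<^sup>2 = 2 * g e \<omega>"
          unfolding g_def by (simp only: mult_ac)
        ultimately show "(sqrt (a e \<omega>) * (2 * sqrt (X \<omega> e) + \<eta>) * f \<omega>)\<^sup>2 \<le> 2 * g e \<omega>"
          by linarith
      qed (use a01 in auto)
      also have "\<dots> = (2 * cube_avg Q (a e)) * cube_avg Q (g e)" by (simp add: cube_avg_cmult)
      also have "\<dots> \<le> \<kappa>\<^sup>2 * cube_avg Q (g e)"
        using infl[OF eE] g0 by (intro mult_right_mono cube_avg_nonneg) (auto simp: Q_def a_def[abs_def] X_def)
      finally show "(cube_avg Q (g1 (fst j)))\<^sup>2 \<le> \<kappa>\<^sup>2 * cube_avg Q (g (fst j))" by (simp add: e_def)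
    qed auto
    finally show "(cube_avg Q (\<lambda>\<omega>. \<bar>f \<omega> - f (flip j \<omega>)\<bar>))\<^sup>2 \<le> \<kappa>\<^sup>2 * b j"
      by (simp add: b_def algebra_simps)
  qed
  have "(\<Sum>j\<in>Q. b j) = (\<Sum>e\<in>E. \<Sum>l<N. b (e, l))"
    unfolding Q_def by (simp add: sum.cartesian_product split_def)
  also have "\<dots> = exp R * u\<^sup>2 * (\<eta>\<^sup>2 * N) * (\<Sum>e\<in>E. cube_avg Q (g e))"
    by (simp add: b_def sum_distrib_left algebra_simps)
  also have "(\<Sum>e\<in>E. cube_avg Q (g e)) = cube_avg Q (\<lambda>\<omega>. \<Sum>e\<in>E. g e \<omega>)"
    by (rule cube_avg_sum[symmetric])
  also have "exp R * u\<^sup>2 * (\<eta>\<^sup>2 * N) * \<dots> \<le> exp R * u\<^sup>2 * (\<eta>\<^sup>2 * N) * cube_avg Q (\<lambda>\<omega>. (4 * K + 1) * (f \<omega>)\<^sup>2)"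
  proof (intro mult_left_mono cube_avg_mono)
    fix \<omega>
    have "(\<Sum>e\<in>E. g e \<omega>) = (4 * (\<Sum>e\<in>E. X \<omega> e * a e \<omega>) + \<eta>\<^sup>2 * (\<Sum>e\<in>E. a e \<omega>)) * (f \<omega>)\<^sup>2"
      by (simp add: g_def sum_distrib_left sum_distrib_right sum.distrib[symmetric] algebra_simps)
    also have "\<dots> \<le> (4 * K + 1) * (f \<omega>)\<^sup>2"
    proof (intro mult_right_mono add_mono mult_left_mono)
      show "(\<Sum>e\<in>E. X \<omega> e * a e \<omega>) \<le> K" unfolding a_def by (rule sum_weight_influence_le)
      have "\<eta>\<^sup>2 * (\<Sum>e\<in>E. a e \<omega>) \<le> \<eta>\<^sup>2 * (\<Sum>e\<in>E. 1)" using a01 by (intro mult_left_mono sum_mono) auto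
      also have "\<dots> = 4 * A\<^sup>2 * card E / N" using \<eta>2 N by (simp add: field_simps)
      also have "\<dots> \<le> 1" using N by simp
      finally show "\<eta>\<^sup>2 * (\<Sum>e\<in>E. a e \<omega>) \<le> 1" .
    qed auto
    finally show "(\<Sum>e\<in>E. g e \<omega>) \<le> (4 * K + 1) * (f \<omega>)\<^sup>2" .
  qed auto
  also have "\<dots> = 4 * (A\<^sup>2 * exp R * (4 * K + 1) * u\<^sup>2 * cube_avg Q (\<lambda>\<omega>. (f \<omega>)\<^sup>2))"
    by (simp add: cube_avg_cmult \<eta>2)
  \<comment> \<open>The factor \<open>N\<close> of signs per edge cancels against \<open>\<eta>\<^sup>2 = 4 A\<^sup>2 / N\<close>.\<close>
  finally have sumb: "(\<Sum>j\<in>Q. b j) \<le> 4 * (A\<^sup>2 * exp R * (4 * K + 1) * u\<^sup>2 * cube_avg Q (\<lambda>\<omega>. (f \<omega>)\<^sup>2))" .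
  have "4 * (cube_avg Q (\<lambda>\<omega>. (f \<omega>)\<^sup>2) - (cube_avg Q f)\<^sup>2)
      \<le> (3 ^ k * \<kappa> + 1 / k) * (4 * (A\<^sup>2 * exp R * (4 * K + 1) * u\<^sup>2 * cube_avg Q (\<lambda>\<omega>. (f \<omega>)\<^sup>2)))"
    using \<kappa> by (intro order_trans[OF main] mult_left_mono sumb) auto
  then have "4 * (cube_avg Q (\<lambda>\<omega>. (f \<omega>)\<^sup>2) - (cube_avg Q f)\<^sup>2)
      \<le> 4 * ((3 ^ k * \<kappa> + 1 / k) * (A\<^sup>2 * exp R * (4 * K + 1) * u\<^sup>2 * cube_avg Q (\<lambda>\<omega>. (f \<omega>)\<^sup>2)))"
    by (simp only: mult.left_commute[of _ 4])
  then have "cube_avg Q (\<lambda>\<omega>. (f \<omega>)\<^sup>2) - (cube_avg Q f)\<^sup>2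
      \<le> (3 ^ k * \<kappa> + 1 / k) * (A\<^sup>2 * exp R * (4 * K + 1)) * u\<^sup>2 * cube_avg Q (\<lambda>\<omega>. (f \<omega>)\<^sup>2)"
    unfolding mult.assoc by (rule mult_left_le_imp_le) simp
  moreover have "f = (\<lambda>\<omega>. exp (u / 2 * avg_time (X \<omega>)))" by (rule ext) (simp only: f_def)
  ultimately show ?thesis
    unfolding f2 by (simp only: Q_def X_def R_def)
qed

end


section \<open>Normalised sums of signs\<close>

lemma cube_avg_Un:
  assumes "finite Q" "finite R" "Q \<inter> R = {}"
  shows "cube_avg (Q \<union> R) f = cube_avg Q (\<lambda>A. cube_avg R (\<lambda>B. f (A \<union> B)))"
  using assms(2,1,3)
proof (induction R arbitrary: f)
  case empty
  then show ?case by simp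
next
  case (insert j R)
  have "cube_avg (Q \<union> insert j R) f = (cube_avg (Q \<union> R) f + cube_avg (Q \<union> R) (\<lambda>A. f (insert j A))) / 2"
    using insert by (simp add: cube_avg_insert)
  also have "\<dots> = (cube_avg Q (\<lambda>A. cube_avg R (\<lambda>B. f (A \<union> B))) + cube_avg Q (\<lambda>A. cube_avg R (\<lambda>B. f (insert j (A \<union> B))))) / 2"
    using insert by simp
  also have "\<dots> = cube_avg Q (\<lambda>A. (1/2) * (cube_avg R (\<lambda>B. f (A \<union> B)) + cube_avg R (\<lambda>B. f (insert j (A \<union> B)))))"
    by (simp only: cube_avg_cmult cube_avg_add)
  also have "\<dots> = cube_avg Q (\<lambda>A. cube_avg (insert j R) (\<lambda>B. f (A \<union> B)))"
    using insert by (intro cube_avg_cong) (simp add: cube_avg_insert)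
  finally show ?case .
qed

lemma cube_avg_marginal:
  assumes "finite Q" "Q' \<subseteq> Q" "\<And>A B. A \<inter> Q' = B \<inter> Q' \<Longrightarrow> f A = f B"
  shows "cube_avg Q f = cube_avg Q' f"
proof -
  have fin: "finite Q'" "finite (Q - Q')" using assms finite_subset by auto
  have "cube_avg Q f = cube_avg (Q' \<union> (Q - Q')) f" using assms(2) by (simp add: Un_absorb1)
  also have "\<dots> = cube_avg Q' (\<lambda>A. cube_avg (Q - Q') (\<lambda>B. f (A \<union> B)))"
    using fin by (intro cube_avg_Un) auto
  also have "\<dots> = cube_avg Q' (\<lambda>A. cube_avg (Q - Q') (\<lambda>B. f A))"
    by (intro cube_avg_cong assms(3)) auto
  also have "\<dots> = cube_avg Q' f" using fin by (simp add: cube_avg_const)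
  finally show ?thesis .
qed

lemma cube_avg_reindex:
  assumes "inj_on h Q"
  shows "cube_avg (h ` Q) f = cube_avg Q (\<lambda>A. f (h ` A))"
proof -
  have "bij_betw (image h) (Pow Q) (Pow (h ` Q))"
    using assms by (intro bij_betw_Pow) (auto simp: bij_betw_def)
  then have "(\<Sum>A\<in>Pow (h ` Q). f A) = (\<Sum>A\<in>Pow Q. f (h ` A))"
    by (rule sum.reindex_bij_betw[symmetric])
  then show ?thesis using assms by (simp add: cube_avg_def card_image)
qed

text \<open>
  The law does not depend on the index, so it is realised on a single block of signs, indexed by the unit type.
\<close>

definition signsum_law :: "nat \<Rightarrow> real measure" where
  "signsum_law N = distr (measure_pmf (pmf_of_set (Pow ({()} \<times> {..<N})))) borel (\<lambda>\<omega>. signsum N \<omega> ())"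

lemma signsum_law_real_distribution: "real_distribution (signsum_law N)"
  by (simp add: real_distribution_def real_distribution_axioms_def signsum_law_def
      prob_space.prob_space_distr[OF prob_space_measure_pmf])

lemma integral_signsum_law:
  fixes g :: "real \<Rightarrow> 'b::{banach, second_countable_topology}"
  assumes "g \<in> borel_measurable borel"
  shows "(LINT x|signsum_law N. g x) = (\<Sum>\<omega>\<in>Pow ({()} \<times> {..<N}). g (signsum N \<omega> ())) /\<^sub>R 2 ^ N"
proof -
  have fin: "finite (Pow ({()} \<times> {..<N}))" "Pow ({()} \<times> {..<N}) \<noteq> {}" by auto
  have "(LINT x|signsum_law N. g x) = (LINT \<omega>|measure_pmf (pmf_of_set (Pow ({()} \<times> {..<N}))). g (signsum N \<omega> ()))"
    unfolding signsum_law_def using assms by (intro integral_distr) auto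
  also have "\<dots> = (\<Sum>\<omega>\<in>Pow ({()} \<times> {..<N}). pmf (pmf_of_set (Pow ({()} \<times> {..<N}))) \<omega> *\<^sub>R g (signsum N \<omega> ()))"
    by (intro integral_measure_pmf) (auto simp: set_pmf_of_set[OF fin(2,1)])
  also have "\<dots> = (\<Sum>\<omega>\<in>Pow ({()} \<times> {..<N}). g (signsum N \<omega> ()) /\<^sub>R 2 ^ N)"
    by (intro sum.cong refl) (simp add: pmf_of_set[OF fin(2,1)] card_Pow indicator_def card_cartesian_product inverse_eq_divide)
  finally show ?thesis by (simp add: scaleR_sum_right)
qed

lemma sum_iexp_signs:
  fixes \<theta> :: real
  shows "(\<Sum>\<omega>\<in>Pow ({()} \<times> {..<n}). iexp (\<theta> * (\<Sum>l<n. if ((), l) \<in> \<omega> then 1 else - 1)))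
    = (2 * complex_of_real (cos \<theta>)) ^ n"
proof (induction n)
  case 0
  then show ?case by simp
next
  case (Suc n)
  let ?s = "\<lambda>n \<omega>. (\<Sum>l<n. if ((), l) \<in> \<omega> then 1 else - 1 :: real)"
  have ins: "{()} \<times> {..<Suc n} = insert ((), n) ({()} \<times> {..<n})" by auto
  have c: "iexp (- \<theta>) + iexp \<theta> = 2 * complex_of_real (cos \<theta>)"
    unfolding cis_conv_exp[symmetric] by (simp add: complex_eq_iff)
  have e1: "?s (Suc n) \<omega> = ?s n \<omega> - 1" if "\<omega> \<in> Pow ({()} \<times> {..<n})" for \<omega>
    using that by auto
  have e2: "?s (Suc n) (insert ((), n) \<omega>) = ?s n \<omega> + 1" if "\<omega> \<in> Pow ({()} \<times> {..<n})" for \<omega>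
  proof -
    have "?s n (insert ((), n) \<omega>) = ?s n \<omega>" by (intro sum.cong) auto
    then show ?thesis by simp
  qed
  have "(\<Sum>\<omega>\<in>Pow ({()} \<times> {..<Suc n}). iexp (\<theta> * ?s (Suc n) \<omega>))
    = (\<Sum>\<omega>\<in>Pow ({()} \<times> {..<n}). iexp (\<theta> * ?s (Suc n) \<omega>)) + (\<Sum>\<omega>\<in>Pow ({()} \<times> {..<n}). iexp (\<theta> * ?s (Suc n) (insert ((), n) \<omega>)))"
    unfolding ins by (rule sum_Pow_insert) auto
  also have "\<dots> = (\<Sum>\<omega>\<in>Pow ({()} \<times> {..<n}). iexp (\<theta> * ?s n \<omega>) * (iexp (- \<theta>) + iexp \<theta>))"
    unfolding sum.distrib[symmetric]
  proof (intro sum.cong refl)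
    fix \<omega> :: "(unit \<times> nat) set" assume w: "\<omega> \<in> Pow ({()} \<times> {..<n})"
    have "iexp (\<theta> * ?s (Suc n) \<omega>) = iexp (\<theta> * ?s n \<omega>) * iexp (- \<theta>)"
      unfolding e1[OF w] exp_add[symmetric] by (simp add: algebra_simps)
    moreover have "iexp (\<theta> * ?s (Suc n) (insert ((), n) \<omega>)) = iexp (\<theta> * ?s n \<omega>) * iexp \<theta>"
      unfolding e2[OF w] exp_add[symmetric] by (simp add: algebra_simps)
    ultimately show "iexp (\<theta> * ?s (Suc n) \<omega>) + iexp (\<theta> * ?s (Suc n) (insert ((), n) \<omega>))
        = iexp (\<theta> * ?s n \<omega>) * (iexp (- \<theta>) + iexp \<theta>)"
      by (simp only: distrib_left)
  qed
  also have "\<dots> = (2 * complex_of_real (cos \<theta>)) ^ Suc n"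
    unfolding sum_distrib_right[symmetric] Suc.IH c by simp
  finally show ?case .
qed

lemma char_signsum_law: "char (signsum_law N) t = complex_of_real (cos (t / sqrt (real N)) ^ N)"
proof -
  have "char (signsum_law N) t = (\<Sum>\<omega>\<in>Pow ({()} \<times> {..<N}). iexp (t * signsum N \<omega> ())) /\<^sub>R 2 ^ N"
    unfolding char_def by (rule integral_signsum_law) simp
  also have "(\<Sum>\<omega>\<in>Pow ({()} \<times> {..<N}). iexp (t * signsum N \<omega> ()))
    = (\<Sum>\<omega>\<in>Pow ({()} \<times> {..<N}). iexp (t / sqrt (real N) * (\<Sum>l<N. if ((), l) \<in> \<omega> then 1 else - 1)))"
    by (simp add: signsum_def)
  also have "\<dots> = (2 * complex_of_real (cos (t / sqrt (real N)))) ^ N" by (rule sum_iexp_signs)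
  also have "\<dots> /\<^sub>R 2 ^ N = complex_of_real (cos (t / sqrt (real N)) ^ N)"
    by (simp add: power_mult_distrib scaleR_conv_of_real)
  finally show ?thesis .
qed

lemma cos_power_limit: "(\<lambda>n. cos (t / sqrt (real n)) ^ n) \<longlonglongrightarrow> exp (- (t\<^sup>2) / 2)"
proof -
  have pos: "(\<lambda>n. cos (t / sqrt (real n)) ^ n) \<longlonglongrightarrow> exp (- (t\<^sup>2) / 2)" if "t > 0" for t :: real
    using that by real_asymp (simp add: power2_eq_square)
  consider "t > 0" | "t = 0" | "- t > 0" by linarith
  then show ?thesis
  proof cases
    case 3
    then show ?thesis using pos[OF 3] by simp
  qed (use pos in auto)
qed

text \<open>
  The characteristic function of the normalised sum is \<open>cos (t / sqrt N) ^ N\<close>, which tends to that of the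
  Gaussian law; Levy's continuity theorem does the rest.
\<close>

lemma signsum_law_weak_conv: "weak_conv_m signsum_law std_normal_distribution"
proof (rule levy_continuity)
  show "(\<lambda>n. char (signsum_law n) t) \<longlonglongrightarrow> char std_normal_distribution t" for t
    unfolding char_signsum_law char_std_normal_distribution by (intro tendsto_of_real cos_power_limit)
qed (auto intro: signsum_law_real_distribution real_dist_normal_dist)


section \<open>From coin flips to product measures\<close>

lemma signsum_image_Pair: "signsum N ((\<lambda>(u, l). (e, l)) ` \<omega>) e = signsum N \<omega> ()"
proof -
  have "(e, l) \<in> (\<lambda>(u, l). (e, l)) ` \<omega> \<longleftrightarrow> ((), l) \<in> \<omega>" for l
    by (force simp: image_iff)
  then show ?thesis by (simp add: signsum_def)
qed

lemma cube_avg_signsum_eq_integral: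
  assumes "g \<in> borel_measurable borel"
  shows "cube_avg ({e} \<times> {..<N}) (\<lambda>\<omega>. g (signsum N \<omega> e)) = (LINT x|signsum_law N. g x)"
proof -
  have "{e} \<times> {..<N} = (\<lambda>(u, l). (e, l)) ` ({()} \<times> {..<N})" by force
  moreover have "inj_on (\<lambda>(u::unit, l::nat). (e, l)) ({()} \<times> {..<N})" by (auto simp: inj_on_def)
  ultimately have "cube_avg ({e} \<times> {..<N}) (\<lambda>\<omega>. g (signsum N \<omega> e)) = cube_avg ({()} \<times> {..<N}) (\<lambda>\<omega>. g (signsum N \<omega> ()))"
    by (simp add: cube_avg_reindex signsum_image_Pair)
  then show ?thesis
    using assms by (simp add: integral_signsum_law cube_avg_def divide_inverse_commute card_cartesian_product)
qed

lemma signsum_cong: "(\<And>l. l < N \<Longrightarrow> (e, l) \<in> \<omega> \<longleftrightarrow> (e, l) \<in> \<omega>') \<Longrightarrow> signsum N \<omega> e = signsum N \<omega>' e"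
  unfolding signsum_def by (intro arg_cong2[where f="(/)"] sum.cong) auto

text \<open>
  The normalised sums that belong to different indices are independent. Conditioning on one index after the other
  transfers an average over the cube to a product integral, where each factor may be realised by any random
  variable with the right law; Skorohod's representation will supply it.
\<close>

lemma cube_avg_signsum_product:
  fixes \<Phi> :: "('e \<Rightarrow> real) \<Rightarrow> real" and Y :: "real \<Rightarrow> real"
  assumes \<Omega>: "prob_space \<Omega>" and Y [measurable]: "Y \<in> borel_measurable \<Omega>" and law: "distr \<Omega> borel Y = signsum_law N"
    and "finite E"
    and "\<Phi> \<in> borel_measurable (PiM E (\<lambda>_. borel))" "\<And>x. \<bar>\<Phi> x\<bar> \<le> B"
    and "\<And>x y. (\<And>e. e \<in> E \<Longrightarrow> x e = y e) \<Longrightarrow> \<Phi> x = \<Phi> y"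
  shows "cube_avg (E \<times> {..<N}) (\<lambda>\<omega>. \<Phi> (signsum N \<omega>)) = (LINT u|PiM E (\<lambda>_. \<Omega>). \<Phi> (\<lambda>e. Y (u e)))"
  using assms(4-7)
proof (induction E arbitrary: \<Phi> rule: finite_induct)
  case empty
  have 1: "\<Phi> (\<lambda>e. Y (u e)) = \<Phi> (signsum N {})" for u by (rule empty.prems(3)) simp
  interpret prob_space "PiM {} (\<lambda>_. \<Omega>)" by (intro prob_space_PiM \<Omega>)
  show ?case by (simp add: 1 prob_space)
next
  case (insert e E)
  interpret P: product_prob_space "\<lambda>_. \<Omega>" "insert e E" by (rule product_prob_spaceI) (rule \<Omega>)
  interpret O: prob_space \<Omega> by (rule \<Omega>)
  note [measurable] = insert.prems(1)
  define \<Phi>' where "\<Phi>' x = cube_avg ({e} \<times> {..<N}) (\<lambda>\<omega>. \<Phi> (x(e := signsum N \<omega> e)))" for x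
  have upd [measurable]: "(\<lambda>x. \<Phi> (x(e := c))) \<in> borel_measurable (PiM E (\<lambda>_. borel))" for c
    by (rule measurable_compose[OF _ insert.prems(1)]) (rule measurable_fun_upd[where J=E], auto)
  have upd2 [measurable]: "(\<lambda>c. \<Phi> (x(e := c))) \<in> borel_measurable borel" for x
  proof -
    have "(\<lambda>c. \<Phi> ((restrict x E)(e := c))) \<in> borel_measurable borel"
      by (rule measurable_compose[OF _ insert.prems(1)])
        (rule measurable_fun_upd[where J=E], auto simp: space_PiM)
    moreover have "\<Phi> ((restrict x E)(e := c)) = \<Phi> (x(e := c))" for c
      by (rule insert.prems(3)) auto
    ultimately show ?thesis by simp
  qed
  have inner: "\<Phi>' x = (LINT y|\<Omega>. \<Phi> (x(e := Y y)))" for x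
  proof -
    have "\<Phi>' x = (LINT y|signsum_law N. \<Phi> (x(e := y)))"
      unfolding \<Phi>'_def by (rule cube_avg_signsum_eq_integral[OF upd2])
    also have "\<dots> = (LINT y|\<Omega>. \<Phi> (x(e := Y y)))"
      unfolding law[symmetric] by (rule integral_distr[OF Y upd2])
    finally show ?thesis .
  qed
  have "cube_avg (insert e E \<times> {..<N}) (\<lambda>\<omega>. \<Phi> (signsum N \<omega>))
    = cube_avg (E \<times> {..<N} \<union> {e} \<times> {..<N}) (\<lambda>\<omega>. \<Phi> (signsum N \<omega>))"
    by (rule arg_cong2[where f=cube_avg]) auto
  also have "\<dots> = cube_avg (E \<times> {..<N}) (\<lambda>A. cube_avg ({e} \<times> {..<N}) (\<lambda>B. \<Phi> (signsum N (A \<union> B))))"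
    using insert.hyps by (intro cube_avg_Un) auto
  also have "\<dots> = cube_avg (E \<times> {..<N}) (\<lambda>A. \<Phi>' (signsum N A))"
    unfolding \<Phi>'_def
  proof (intro cube_avg_cong insert.prems(3))
    fix A B e' assume A: "A \<subseteq> E \<times> {..<N}" and B: "B \<subseteq> {e} \<times> {..<N}" and e': "e' \<in> insert e E"
    show "signsum N (A \<union> B) e' = ((signsum N A)(e := signsum N B e)) e'"
    proof (cases "e' = e")
      case True
      then have "signsum N (A \<union> B) e = signsum N B e"
        using A insert.hyps(2) by (intro signsum_cong) auto
      then show ?thesis using True by simp
    next
      case False
      then have "signsum N (A \<union> B) e' = signsum N A e'"
        using B by (intro signsum_cong) auto
      then show ?thesis using False by simp
    qed
  qed
  also have "\<dots> = (LINT u|PiM E (\<lambda>_. \<Omega>). \<Phi>' (\<lambda>e. Y (u e)))"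
  proof (rule insert.IH)
    show "\<Phi>' \<in> borel_measurable (PiM E (\<lambda>_. borel))"
      unfolding \<Phi>'_def cube_avg_def by measurable
    show "\<bar>\<Phi>' x\<bar> \<le> B" for x
    proof -
      have "\<Phi>' x \<le> cube_avg ({e} \<times> {..<N}) (\<lambda>_. B)" unfolding \<Phi>'_def
        using insert.prems(2) by (intro cube_avg_mono) (meson abs_le_D1)
      moreover have "cube_avg ({e} \<times> {..<N}) (\<lambda>_. - B) \<le> \<Phi>' x" unfolding \<Phi>'_def
        using insert.prems(2) by (intro cube_avg_mono) (meson abs_le_iff minus_le_iff)
      ultimately show ?thesis by (simp add: cube_avg_const)
    qed
    show "\<Phi>' x = \<Phi>' y" if "\<And>e. e \<in> E \<Longrightarrow> x e = y e" for x y
      unfolding \<Phi>'_def using that by (intro cube_avg_cong insert.prems(3)) auto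
  qed
  also have "\<dots> = (LINT u|PiM E (\<lambda>_. \<Omega>). LINT y|\<Omega>. \<Phi> (\<lambda>e'. Y ((u(e := y)) e')))"
    by (simp only: inner) (rule Bochner_Integration.integral_cong refl, rule refl,
        rule Bochner_Integration.integral_cong, rule refl, rule insert.prems(3), simp)
  also have "\<dots> = (LINT u|PiM (insert e E) (\<lambda>_. \<Omega>). \<Phi> (\<lambda>e. Y (u e)))"
  proof (rule P.product_integral_insert[symmetric])
    have pI: "prob_space (PiM (insert e E) (\<lambda>_. \<Omega>))" by (intro prob_space_PiM \<Omega>)
    have m1: "(\<lambda>u. \<lambda>e'\<in>insert e E. Y (u e')) \<in> PiM (insert e E) (\<lambda>_. \<Omega>) \<rightarrow>\<^sub>M PiM (insert e E) (\<lambda>_. borel)"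
      by measurable
    have "(\<lambda>u. \<Phi> (\<lambda>e'\<in>insert e E. Y (u e'))) \<in> borel_measurable (PiM (insert e E) (\<lambda>_. \<Omega>))"
      by (rule measurable_compose[OF m1 insert.prems(1)])
    moreover have "\<Phi> (\<lambda>e'\<in>insert e E. Y (u e')) = \<Phi> (\<lambda>e'. Y (u e'))" for u
      by (rule insert.prems(3)) simp
    ultimately have "(\<lambda>u. \<Phi> (\<lambda>e'. Y (u e'))) \<in> borel_measurable (PiM (insert e E) (\<lambda>_. \<Omega>))" by simp
    then show "integrable (PiM (insert e E) (\<lambda>_. \<Omega>)) (\<lambda>u. \<Phi> (\<lambda>e'. Y (u e')))"
      using insert.prems(2) by (intro finite_measure.integrable_const_bound[OF prob_space.axioms(1)[OF pI], where B=B]) auto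
  qed (use insert.hyps in auto)
  finally show ?case .
qed

text \<open>
  A central limit theorem for functions of finitely many independent coordinates. Skorohod's theorem realises the
  laws of the sign sums by variables that converge pointwise, in every coordinate simultaneously, so that
  dominated convergence applies.
\<close>

theorem cube_avg_limit:
  fixes \<nu> :: "real measure" and U :: "real \<Rightarrow> real" and \<Phi> :: "('e \<Rightarrow> real) \<Rightarrow> real"
  assumes \<nu>: "prob_space \<nu>" and id [measurable]: "(\<lambda>x. x) \<in> borel_measurable \<nu>"
    and law: "distr std_normal_distribution borel U = distr \<nu> borel (\<lambda>x. x)"
    and U: "\<And>s. isCont U s" "\<And>s. 0 \<le> U s"
    and E: "finite E" "E \<subseteq> I"
    and meas: "\<Phi> \<in> borel_measurable (PiM E (\<lambda>_. borel))"
    and bdd: "\<And>x. (\<And>e. 0 \<le> x e) \<Longrightarrow> \<bar>\<Phi> x\<bar> \<le> B"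
    and dep: "\<And>x y. (\<And>e. e \<in> E \<Longrightarrow> x e = y e) \<Longrightarrow> \<Phi> x = \<Phi> y"
    and cont: "\<And>X x. (\<And>e. (\<lambda>n. X n e) \<longlonglongrightarrow> x e) \<Longrightarrow> (\<And>n e. 0 \<le> X n e) \<Longrightarrow> (\<lambda>n. \<Phi> (X n)) \<longlonglongrightarrow> \<Phi> x"
  shows "(\<lambda>N. cube_avg (E \<times> {..<N}) (\<lambda>\<omega>. \<Phi> (\<lambda>e. U (signsum N \<omega> e)))) \<longlonglongrightarrow> (LINT x|PiM I (\<lambda>_. \<nu>). \<Phi> x)"
proof -
  obtain \<Omega> :: "real measure" and Yn :: "nat \<Rightarrow> real \<Rightarrow> real" and Y :: "real \<Rightarrow> real" where
    \<Omega>: "prob_space \<Omega>" and Yn': "\<forall>n. Yn n \<in> borel_measurable \<Omega>" "\<forall>n. distr \<Omega> borel (Yn n) = signsum_law n"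
    and Y': "Y \<in> measurable \<Omega> lborel" and Y2: "distr \<Omega> borel Y = std_normal_distribution"
    and lim': "\<forall>x\<in>space \<Omega>. (\<lambda>n. Yn n x) \<longlonglongrightarrow> Y x"
    using Skorohod[OF signsum_law_real_distribution real_dist_normal_dist signsum_law_weak_conv]
    by (elim exE conjE)
  have Yn: "Yn n \<in> borel_measurable \<Omega>" "distr \<Omega> borel (Yn n) = signsum_law n" for n using Yn' by auto
  have Y: "Y \<in> borel_measurable \<Omega>" "distr \<Omega> borel Y = std_normal_distribution" using Y' Y2 by auto
  have lim: "(\<lambda>n. Yn n x) \<longlonglongrightarrow> Y x" if "x \<in> space \<Omega>" for x using lim' that by blast
  note [measurable] = Yn(1) Y(1)
  have Um [measurable]: "U \<in> borel_measurable borel"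
    using U(1) by (intro borel_measurable_continuous_onI) (simp add: continuous_at_imp_continuous_on)
  define \<Psi> where "\<Psi> x = \<Phi> (\<lambda>e. U (x e))" for x
  have comp: "(\<lambda>u. \<Phi> (\<lambda>e. f (u e))) \<in> borel_measurable (PiM E (\<lambda>_. M))"
    if [measurable]: "f \<in> borel_measurable M" for f and M :: "real measure"
  proof -
    have m1: "(\<lambda>u. \<lambda>e'\<in>E. f (u e')) \<in> PiM E (\<lambda>_. M) \<rightarrow>\<^sub>M PiM E (\<lambda>_. borel)"
      by measurable
    have "(\<lambda>u. \<Phi> (\<lambda>e'\<in>E. f (u e'))) \<in> borel_measurable (PiM E (\<lambda>_. M))"
      by (rule measurable_compose[OF m1 meas])
    moreover have "\<Phi> (\<lambda>e'\<in>E. f (u e')) = \<Phi> (\<lambda>e'. f (u e'))" for u by (rule dep) simp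
    ultimately show ?thesis by simp
  qed
  interpret PE: prob_space "PiM E (\<lambda>_. \<Omega>)" by (intro prob_space_PiM \<Omega>)
  interpret nu: prob_space \<nu> by (rule \<nu>)
  have cube: "cube_avg (E \<times> {..<N}) (\<lambda>\<omega>. \<Phi> (\<lambda>e. U (signsum N \<omega> e)))
      = (LINT u|PiM E (\<lambda>_. \<Omega>). \<Phi> (\<lambda>e. U (Yn N (u e))))" for N
  proof -
    have "cube_avg (E \<times> {..<N}) (\<lambda>\<omega>. \<Psi> (signsum N \<omega>)) = (LINT u|PiM E (\<lambda>_. \<Omega>). \<Psi> (\<lambda>e. Yn N (u e)))"
    proof (rule cube_avg_signsum_product[OF \<Omega> Yn(1) Yn(2) E(1)])
      show "\<Psi> \<in> borel_measurable (PiM E (\<lambda>_. borel))" unfolding \<Psi>_def by (rule comp) simp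
      show "\<bar>\<Psi> x\<bar> \<le> B" for x unfolding \<Psi>_def by (rule bdd) (rule U)
      show "\<Psi> x = \<Psi> y" if "\<And>e. e \<in> E \<Longrightarrow> x e = y e" for x y
        unfolding \<Psi>_def using that by (intro dep) auto
    qed
    then show ?thesis by (simp add: \<Psi>_def)
  qed
  have "(\<lambda>N. LINT u|PiM E (\<lambda>_. \<Omega>). \<Phi> (\<lambda>e. U (Yn N (u e)))) \<longlonglongrightarrow> (LINT u|PiM E (\<lambda>_. \<Omega>). \<Phi> (\<lambda>e. U (Y (u e))))"
  proof (rule integral_dominated_convergence[where w="\<lambda>_. B"])
    show "(\<lambda>u. \<Phi> (\<lambda>e. U (Y (u e)))) \<in> borel_measurable (PiM E (\<lambda>_. \<Omega>))"
      by (rule comp) measurable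
    show "(\<lambda>u. \<Phi> (\<lambda>e. U (Yn n (u e)))) \<in> borel_measurable (PiM E (\<lambda>_. \<Omega>))" for n
      by (rule comp) measurable
    show "AE u in PiM E (\<lambda>_. \<Omega>). (\<lambda>n. \<Phi> (\<lambda>e. U (Yn n (u e)))) \<longlonglongrightarrow> \<Phi> (\<lambda>e. U (Y (u e)))"
    proof (rule AE_I2)
      fix u assume u: "u \<in> space (PiM E (\<lambda>_. \<Omega>))"
      define u' where "u' e = (if e \<in> E then u e else (SOME w. w \<in> space \<Omega>))" for e
      have "space \<Omega> \<noteq> {}" using \<Omega> by (rule prob_space.not_empty)
      then have u': "u' e \<in> space \<Omega>" for e
        using u by (auto simp: u'_def space_PiM PiE_iff some_in_eq)
      have "(\<lambda>n. \<Phi> (\<lambda>e. U (Yn n (u' e)))) \<longlonglongrightarrow> \<Phi> (\<lambda>e. U (Y (u' e)))"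
        by (intro cont isCont_tendsto_compose[OF U(1)] lim u' U(2))
      moreover have "\<Phi> (\<lambda>e. U (f (u' e))) = \<Phi> (\<lambda>e. U (f (u e)))" for f
        by (rule dep) (simp add: u'_def)
      ultimately show "(\<lambda>n. \<Phi> (\<lambda>e. U (Yn n (u e)))) \<longlonglongrightarrow> \<Phi> (\<lambda>e. U (Y (u e)))" by simp
    qed
    show "AE u in PiM E (\<lambda>_. \<Omega>). norm (\<Phi> (\<lambda>e. U (Yn n (u e)))) \<le> B" for n
      using bdd U(2) by (intro AE_I2) simp
  qed simp
  moreover have "(LINT u|PiM E (\<lambda>_. \<Omega>). \<Phi> (\<lambda>e. U (Y (u e)))) = (LINT x|PiM I (\<lambda>_. \<nu>). \<Phi> x)"
  proof -
    let ?M = "distr \<nu> borel (\<lambda>x. x)"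
    have pM: "prob_space ?M" by (rule nu.prob_space_distr) simp
    have lawU: "distr \<Omega> borel (\<lambda>w. U (Y w)) = ?M"
    proof -
      have "distr \<Omega> borel (\<lambda>w. U (Y w)) = distr (distr \<Omega> borel Y) borel U"
        by (subst distr_distr) (auto simp: comp_def)
      then show ?thesis by (simp add: Y(2) law)
    qed
    have restr: "\<Phi> (compose E f u) = \<Phi> (\<lambda>e. f (u e))" for f and u :: "'e \<Rightarrow> real"
      by (rule dep) (simp add: compose_def)
    have A: "(LINT u|PiM E (\<lambda>_. M). \<Phi> (\<lambda>e. f (u e))) = (LINT x|PiM E (\<lambda>_. distr M borel f). \<Phi> x)"
      if M: "prob_space M" and f [measurable]: "f \<in> borel_measurable M" for M :: "real measure" and f
    proof -
      have eq: "distr (PiM E (\<lambda>_. M)) (PiM E (\<lambda>_. borel)) (compose E f) = PiM E (\<lambda>_. distr M borel f)"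
      proof -
        have "distr (PiM E (\<lambda>_. M)) (PiM E (\<lambda>_. distr M borel f)) (compose E f) = PiM E (\<lambda>_. distr M (distr M borel f) f)"
          using E(1) M f by (intro distr_PiM_finite_prob_space') (auto intro: prob_space.prob_space_distr)
        moreover have "sets (PiM E (\<lambda>_. distr M borel f)) = sets (PiM E (\<lambda>_. borel))"
          by (rule sets_PiM_cong) auto
        moreover have "distr M (distr M borel f) f = distr M borel f"
          by (rule distr_cong) auto
        ultimately show ?thesis
          using distr_cong[OF refl, of "PiM E (\<lambda>_. distr M borel f)" "PiM E (\<lambda>_. borel)" "PiM E (\<lambda>_. M)" "compose E f" "compose E f"]
          by simp
      qed
      have "compose E f = (\<lambda>u. \<lambda>e\<in>E. f (u e))" by (simp add: fun_eq_iff compose_def)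
      then have cm: "compose E f \<in> PiM E (\<lambda>_. M) \<rightarrow>\<^sub>M PiM E (\<lambda>_. borel)" by simp measurable
      have "(LINT x|PiM E (\<lambda>_. distr M borel f). \<Phi> x) = (LINT u|PiM E (\<lambda>_. M). \<Phi> (compose E f u))"
        unfolding eq[symmetric] by (rule integral_distr[OF cm meas])
      then show ?thesis by (simp add: restr)
    qed
    interpret PI: product_prob_space "\<lambda>_. \<nu>" I by (rule product_prob_spaceI) (rule \<nu>)
    have B: "(LINT x|PiM I (\<lambda>_. \<nu>). \<Phi> x) = (LINT x|PiM E (\<lambda>_. \<nu>). \<Phi> x)"
    proof -
      have "(LINT x|distr (PiM I (\<lambda>_. \<nu>)) (PiM E (\<lambda>_. \<nu>)) (\<lambda>x. restrict x E). \<Phi> x)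
          = (LINT x|PiM I (\<lambda>_. \<nu>). \<Phi> (restrict x E))"
        by (rule integral_distr[OF measurable_restrict_subset[OF E(2)] comp[OF id]])
      then have "(LINT x|PiM E (\<lambda>_. \<nu>). \<Phi> x) = (LINT x|PiM I (\<lambda>_. \<nu>). \<Phi> (restrict x E))"
        by (simp only: PI.distr_PiM_restrict_finite[OF E])
      moreover have "\<Phi> (restrict x E) = \<Phi> x" for x by (rule dep) simp
      ultimately show ?thesis by simp
    qed
    have "(LINT u|PiM E (\<lambda>_. \<Omega>). \<Phi> (\<lambda>e. U (Y (u e)))) = (LINT x|PiM E (\<lambda>_. ?M). \<Phi> x)"
      using A[OF \<Omega>, of "\<lambda>w. U (Y w)"] by (simp add: lawU)
    also have "\<dots> = (LINT u|PiM E (\<lambda>_. \<nu>). \<Phi> (\<lambda>e. u e))"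
      using A[OF \<nu> id] by simp
    finally show ?thesis using B by simp
  qed
  ultimately show ?thesis by (simp add: cube)
qed


section \<open>From variances of exponentials to Laplace transforms\<close>

text \<open>
  Each step of the recursion costs a factor \<open>1 / (1 - D \<mu>\<^sup>2) \<le> exp (2 D \<mu>\<^sup>2)\<close>, and passing from \<open>\<mu>\<close> to
  \<open>\<mu> / 2\<close> with a square halves the exponent; the total cost is the geometric series
  \<open>2 D \<mu>\<^sup>2 (1 + 1/2 + 1/4 + ...)\<close>. The remaining factor \<open>L (\<mu> / 2 ^ k) ^ (2 ^ k)\<close> tends to \<open>1\<close> by the
  quadratic bound near \<open>0\<close>.
\<close>

lemma halving_iteration:
  fixes L :: "real \<Rightarrow> real"
  assumes nonneg: "\<And>\<mu>. 0 \<le> L \<mu>" and D: "0 \<le> D" "D * R\<^sup>2 \<le> 1 / 2"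
    and step: "\<And>\<mu>. \<bar>\<mu>\<bar> \<le> R \<Longrightarrow> (1 - D * \<mu>\<^sup>2) * L \<mu> \<le> (L (\<mu> / 2))\<^sup>2"
    and small: "\<And>\<mu>. \<bar>\<mu>\<bar> * B \<le> 1 \<Longrightarrow> L \<mu> \<le> exp (\<mu>\<^sup>2 * B\<^sup>2)"
    and \<mu>: "\<bar>\<mu>\<bar> \<le> R"
  shows "L \<mu> \<le> exp (4 * D * \<mu>\<^sup>2)"
proof -
  have one: "L \<mu> \<le> exp (2 * D * \<mu>\<^sup>2) * (L (\<mu> / 2))\<^sup>2" if "\<bar>\<mu>\<bar> \<le> R" for \<mu>
  proof -
    define y where "y = D * \<mu>\<^sup>2"
    have "\<mu>\<^sup>2 \<le> R\<^sup>2" using that by (simp add: abs_le_square_iff[symmetric])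
    then have "D * \<mu>\<^sup>2 \<le> D * R\<^sup>2" using D by (intro mult_left_mono)
    then have "y \<le> 1 / 2" using D by (simp add: y_def)
    have y0: "0 \<le> y" using D by (simp add: y_def)
    have "0 \<le> y * (1 - 2 * y)" using y0 \<open>y \<le> 1/2\<close> by simp
    then have "1 \<le> (1 + 2 * y) * (1 - y)" by (simp add: algebra_simps)
    also have "\<dots> \<le> exp (2 * y) * (1 - y)"
      using \<open>y \<le> 1/2\<close> y0 by (intro mult_right_mono exp_ge_add_one_self_aux) auto
    finally have "1 * L \<mu> \<le> exp (2 * y) * (1 - y) * L \<mu>" by (intro mult_right_mono nonneg)
    also have "\<dots> = exp (2 * y) * ((1 - y) * L \<mu>)" by simp
    also have "\<dots> \<le> exp (2 * y) * (L (\<mu> / 2))\<^sup>2"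
      using step[OF that] by (intro mult_left_mono) (auto simp: y_def)
    finally show ?thesis by (simp add: y_def mult.assoc)
  qed
  have iter: "L \<mu> \<le> exp (4 * D * \<mu>\<^sup>2 * (1 - (1/2) ^ k)) * L (\<mu> / 2 ^ k) ^ (2 ^ k)" if "\<bar>\<mu>\<bar> \<le> R" for \<mu> k
    using that
  proof (induction k arbitrary: \<mu>)
    case 0
    then show ?case by simp
  next
    case (Suc k)
    have half: "\<bar>\<mu> / 2\<bar> \<le> R" using Suc.prems by auto
    let ?M = "L (\<mu> / 2 ^ Suc k)"
    have "L \<mu> \<le> exp (2 * D * \<mu>\<^sup>2) * (L (\<mu> / 2))\<^sup>2" by (rule one[OF Suc.prems])
    also have "\<dots> \<le> exp (2 * D * \<mu>\<^sup>2) * (exp (4 * D * (\<mu>/2)\<^sup>2 * (1 - (1/2) ^ k)) * L ((\<mu> / 2) / 2 ^ k) ^ (2 ^ k))\<^sup>2"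
      by (intro mult_left_mono power_mono Suc.IH half nonneg) auto
    also have "\<dots> = exp (2 * D * \<mu>\<^sup>2 + 2 * (4 * D * (\<mu>/2)\<^sup>2 * (1 - (1/2) ^ k))) * ?M ^ (2 ^ Suc k)"
    proof -
      have "exp w * (exp z * N)\<^sup>2 = exp (w + 2 * z) * N\<^sup>2" for w z N :: real
        by (simp add: power_mult_distrib exp_add exp_double)
      then show ?thesis by (simp add: power_mult[symmetric] mult.commute[of _ 2])
    qed
    also have "2 * D * \<mu>\<^sup>2 + 2 * (4 * D * (\<mu>/2)\<^sup>2 * (1 - (1/2) ^ k)) = 4 * D * \<mu>\<^sup>2 * (1 - (1/2) ^ Suc k)"
      by (simp add: power2_eq_square field_simps)
    finally show ?case .
  qed
  have lim: "(\<lambda>k. exp (4 * D * \<mu>\<^sup>2 * (1 - (1/2) ^ k)) * exp (\<mu>\<^sup>2 * B\<^sup>2 * (1/2) ^ k))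
      \<longlonglongrightarrow> exp (4 * D * \<mu>\<^sup>2 * (1 - 0)) * exp (\<mu>\<^sup>2 * B\<^sup>2 * 0)"
    by (intro tendsto_intros LIMSEQ_realpow_zero) auto
  have "(\<lambda>k. \<bar>\<mu>\<bar> * B * (1/2) ^ k) \<longlonglongrightarrow> \<bar>\<mu>\<bar> * B * 0"
    by (intro tendsto_intros LIMSEQ_realpow_zero) auto
  then have "\<forall>\<^sub>F k in sequentially. \<bar>\<mu>\<bar> * B * (1/2) ^ k < 1"
    by (rule order_tendstoD) simp
  then have "\<forall>\<^sub>F k in sequentially. L \<mu> \<le> exp (4 * D * \<mu>\<^sup>2 * (1 - (1/2) ^ k)) * exp (\<mu>\<^sup>2 * B\<^sup>2 * (1/2) ^ k)"
  proof eventually_elim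
    case (elim k)
    have "L (\<mu> / 2 ^ k) \<le> exp ((\<mu> / 2 ^ k)\<^sup>2 * B\<^sup>2)"
      using elim by (intro small) (simp add: field_simps)
    then have "L (\<mu> / 2 ^ k) ^ (2 ^ k) \<le> exp ((\<mu> / 2 ^ k)\<^sup>2 * B\<^sup>2) ^ (2 ^ k)"
      by (intro power_mono nonneg)
    also have "\<dots> = exp (\<mu>\<^sup>2 * B\<^sup>2 * (1/2) ^ k)"
      by (simp add: exp_of_nat_mult[symmetric] power2_eq_square field_simps)
    finally have "exp (4 * D * \<mu>\<^sup>2 * (1 - (1/2) ^ k)) * L (\<mu> / 2 ^ k) ^ (2 ^ k)
        \<le> exp (4 * D * \<mu>\<^sup>2 * (1 - (1/2) ^ k)) * exp (\<mu>\<^sup>2 * B\<^sup>2 * (1/2) ^ k)"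
      by (intro mult_left_mono) auto
    then show ?case using iter[OF \<mu>, of k] by linarith
  qed
  then show ?thesis
    using tendsto_lowerbound[OF lim] by simp
qed

text \<open>
  The assumption says that the variance of \<open>exp (\<mu> F / 2)\<close> is at most \<open>D \<mu>\<^sup>2\<close> times its second moment. It is
  invariant under adding constants to \<open>F\<close>, and after centring \<open>F\<close> its Laplace transform is
  \<open>1 + O(\<mu>\<^sup>2)\<close> near \<open>0\<close>, as \<open>halving_iteration\<close> requires.
\<close>

lemma (in prob_space) laplace_bound:
  fixes F :: "'a \<Rightarrow> real"
  assumes [measurable]: "F \<in> borel_measurable M"
    and bdd: "\<And>x. x \<in> space M \<Longrightarrow> \<bar>F x\<bar> \<le> B"
    and D: "0 \<le> D" "D * R\<^sup>2 \<le> 1 / 2"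
    and var: "\<And>\<mu>. \<bar>\<mu>\<bar> \<le> R \<Longrightarrow>
       expectation (\<lambda>x. exp (\<mu> * F x)) - (expectation (\<lambda>x. exp (\<mu> / 2 * F x)))\<^sup>2
         \<le> D * \<mu>\<^sup>2 * expectation (\<lambda>x. exp (\<mu> * F x))"
    and \<mu>: "\<bar>\<mu>\<bar> \<le> R"
  shows "expectation (\<lambda>x. exp (\<mu> * (F x - expectation F))) \<le> exp (4 * D * \<mu>\<^sup>2)"
proof -
  define e where "e = expectation F"
  have B0: "0 \<le> B" 
  proof -
    obtain x where "x \<in> space M" using not_empty by auto
    then show ?thesis using bdd[of x] by linarith
  qed
  have intF: "integrable M F"
    by (rule integrable_const_bound[of _ B]) (use bdd in auto)
  have intexp: "integrable M (\<lambda>x. exp (\<mu> * F x))" for \<mu>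
  proof (rule integrable_const_bound[of _ "exp (\<bar>\<mu>\<bar> * B)"])
    show "AE x in M. norm (exp (\<mu> * F x)) \<le> exp (\<bar>\<mu>\<bar> * B)"
    proof (rule AE_I2)
      fix x assume "x \<in> space M"
      then have "\<mu> * F x \<le> \<bar>\<mu>\<bar> * B"
        using abs_ge_self[of "\<mu> * F x"] mult_left_mono[OF bdd[of x], of "\<bar>\<mu>\<bar>"] by (simp add: abs_mult)
      then show "norm (exp (\<mu> * F x)) \<le> exp (\<bar>\<mu>\<bar> * B)" by simp
    qed
  qed simp
  have e: "\<bar>e\<bar> \<le> B"
  proof -
    have "\<bar>e\<bar> \<le> expectation (\<lambda>x. \<bar>F x\<bar>)" unfolding e_def by (rule integral_abs_bound)
    also have "\<dots> \<le> expectation (\<lambda>x. B)" using intF bdd by (intro integral_mono_AE) auto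
    finally show ?thesis by (simp add: prob_space)
  qed
  define L where "L \<mu> = expectation (\<lambda>x. exp (\<mu> * (F x - e)))" for \<mu>
  have L_eq: "L \<mu> = exp (- \<mu> * e) * expectation (\<lambda>x. exp (\<mu> * F x))" for \<mu>
    unfolding L_def by (subst integral_mult_right_zero[symmetric])
      (simp add: exp_add[symmetric] algebra_simps)
  have "L \<mu> \<le> exp (4 * D * \<mu>\<^sup>2)"
  proof (rule halving_iteration[where B="2 * B", OF _ D _ _ \<mu>])
    show "0 \<le> L \<mu>" for \<mu> unfolding L_def by simp
    show "(1 - D * \<mu>\<^sup>2) * L \<mu> \<le> (L (\<mu> / 2))\<^sup>2" if "\<bar>\<mu>\<bar> \<le> R" for \<mu>
    proof -
      have "(1 - D * \<mu>\<^sup>2) * L \<mu> = exp (- \<mu> * e) * ((1 - D * \<mu>\<^sup>2) * expectation (\<lambda>x. exp (\<mu> * F x)))"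
        by (simp add: L_eq)
      also have "\<dots> \<le> exp (- \<mu> * e) * (expectation (\<lambda>x. exp (\<mu> / 2 * F x)))\<^sup>2"
        using var[OF that] by (intro mult_left_mono) (auto simp: algebra_simps)
      also have "\<dots> = (L (\<mu> / 2))\<^sup>2"
        by (simp add: L_eq power_mult_distrib exp_double[symmetric])
      finally show ?thesis .
    qed
    show "L \<mu> \<le> exp (\<mu>\<^sup>2 * (2 * B)\<^sup>2)" if "\<bar>\<mu>\<bar> * (2 * B) \<le> 1" for \<mu>
    proof -
      have pw: "exp (\<mu> * (F x - e)) \<le> 1 + \<mu> * (F x - e) + \<mu>\<^sup>2 * (2 * B)\<^sup>2" if x: "x \<in> space M" for x
      proof -
        define y where "y = \<mu> * (F x - e)"
        have "\<bar>F x - e\<bar> \<le> 2 * B" using bdd[OF x] e by linarith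
        then have yb: "\<bar>y\<bar> \<le> \<bar>\<mu>\<bar> * (2 * B)" by (simp add: y_def abs_mult mult_left_mono)
        then have "\<bar>y\<bar> \<le> 1" using \<open>\<bar>\<mu>\<bar> * (2 * B) \<le> 1\<close> by linarith
        then have "exp y \<le> 1 + y + y\<^sup>2"
        proof (cases "0 \<le> y")
          case True
          then show ?thesis using exp_bound[of y] \<open>\<bar>y\<bar> \<le> 1\<close> by simp
        next
          case False
          define w where "w = - y"
          have w: "0 \<le> w" "w \<le> 1" using False \<open>\<bar>y\<bar> \<le> 1\<close> by (auto simp: w_def)
          have "1 \<le> (1 + w) * (1 - w + w\<^sup>2)" 
            using w by (simp add: algebra_simps power2_eq_square)
          also have "\<dots> \<le> exp w * (1 - w + w\<^sup>2)"
            using w by (intro mult_right_mono exp_ge_add_one_self_aux) auto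
          finally have "exp (-w) * 1 \<le> exp (-w) * (exp w * (1 - w + w\<^sup>2))"
            by (intro mult_left_mono) auto
          also have "\<dots> = 1 - w + w\<^sup>2" by (simp add: mult.assoc[symmetric] exp_add[symmetric])
          finally show ?thesis by (simp add: w_def)
        qed
        moreover have "y\<^sup>2 \<le> \<mu>\<^sup>2 * (2 * B)\<^sup>2"
        proof -
          have "\<bar>y\<bar>\<^sup>2 \<le> (\<bar>\<mu>\<bar> * (2 * B))\<^sup>2" by (intro power_mono yb) auto
          then show ?thesis by (simp add: power_mult_distrib)
        qed
        ultimately show ?thesis by (simp add: y_def)
      qed
      have iy: "integrable M (\<lambda>x. exp (\<mu> * (F x - e)))"
        using integrable_mult_right[OF intexp[of \<mu>], of "exp (- \<mu> * e)"]
        by (simp add: exp_add[symmetric] algebra_simps)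
      have "L \<mu> \<le> expectation (\<lambda>x. 1 + \<mu> * (F x - e) + \<mu>\<^sup>2 * (2 * B)\<^sup>2)"
        unfolding L_def using iy intF pw by (intro integral_mono_AE) auto
      also have "\<dots> = 1 + \<mu>\<^sup>2 * (2 * B)\<^sup>2"
        using intF by (simp add: prob_space e_def)
      also have "\<dots> \<le> exp (\<mu>\<^sup>2 * (2 * B)\<^sup>2)" by (rule exp_ge_add_one_self_aux) simp
      finally show ?thesis .
    qed
  qed
  then show ?thesis by (simp add: L_def e_def)
qed


section \<open>Nearly gamma measures as images of the Gaussian law\<close>

lemma measure_density_eq_integral:
  fixes f :: "real \<Rightarrow> real"
  assumes "f \<in> borel_measurable borel" "\<And>x. 0 \<le> f x" "integrable lborel f" "A \<in> sets borel"
  shows "measure (density lborel (\<lambda>x. ennreal (f x))) A = (LINT x:A|lborel. f x)"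
proof -
  have "emeasure (density lborel (\<lambda>x. ennreal (f x))) A = (\<integral>\<^sup>+x. ennreal (f x) * indicator A x \<partial>lborel)"
    using assms by (subst emeasure_density) auto
  also have "\<dots> = (\<integral>\<^sup>+x. ennreal (indicator A x * f x) \<partial>lborel)"
    by (intro nn_integral_cong) (auto simp: indicator_def)
  also have "\<dots> = ennreal (\<integral>x. indicator A x * f x \<partial>lborel)"
    using assms integrable_mult_indicator[of A lborel f] by (intro nn_integral_eq_integral) auto
  finally show ?thesis
    using assms by (simp add: measure_def set_lebesgue_integral_def)
qed

lemma cdf_density_DERIV:
  fixes f :: "real \<Rightarrow> real"
  assumes [measurable]: "f \<in> borel_measurable borel" and nn: "\<And>x. 0 \<le> f x" and int: "integrable lborel f"
    and "real_distribution (density lborel (\<lambda>x. ennreal (f x)))"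
    and cont: "continuous_on {c..d} f" and t: "c < t" "t < d"
  shows "DERIV (cdf (density lborel (\<lambda>x. ennreal (f x)))) t :> f t"
proof -
  interpret real_distribution "density lborel (\<lambda>x. ennreal (f x))" by fact
  let ?M = "density lborel (\<lambda>x. ennreal (f x))"
  have eq: "cdf ?M x = cdf ?M c + integral {c..x} f" if "c \<le> x" "x \<le> d" for x
  proof (cases "c = x")
    case False
    then have "c < x" using that by simp
    have "cdf ?M x - cdf ?M c = measure ?M {c<..x}"
      using \<open>c < x\<close> by (rule cdf_diff_eq)
    also have "\<dots> = (LINT u:{c<..x}|lborel. f u)"
      by (intro measure_density_eq_integral nn int) auto
    also have "\<dots> = (LINT u:{c..x}|lborel. f u)"
      unfolding set_lebesgue_integral_def
    proof (rule integral_cong_AE)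
      show "AE u in lborel. indicator {c<..x} u *\<^sub>R f u = indicator {c..x} u *\<^sub>R f u"
        using AE_lborel_singleton[of c] by eventually_elim (auto simp: indicator_def)
    qed auto
    also have "\<dots> = integral {c..x} f"
    proof (intro set_borel_integral_eq_integral)
      show "set_integrable lborel {c..x} f"
        unfolding set_integrable_def by (intro integrable_mult_indicator int) simp
    qed
    finally show ?thesis by simp
  qed simp
  have "((\<lambda>x. cdf ?M c + integral {c..x} f) has_real_derivative 0 + f t) (at t within {c..d})"
    using t by (intro DERIV_add DERIV_const integral_has_real_derivative cont) auto
  then have "(cdf ?M has_real_derivative 0 + f t) (at t within {c..d})"
  proof (rule has_field_derivative_transform_within[where d=1, OF _ zero_less_one])
    show "cdf ?M c + integral {c..x} f = cdf ?M x" if "x \<in> {c..d}" for x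
      using that by (intro eq[symmetric]) auto
  qed (use t in auto)
  moreover have "at t within {c..d} = at t" using t by (intro at_within_interior) (auto simp: interior_atLeastAtMost_real)
  ultimately show ?thesis by simp
qed

lemma normal_cdf_eq_cdf: "normal_cdf = cdf std_normal_distribution"
proof
  fix x show "normal_cdf x = cdf std_normal_distribution x"
    unfolding normal_cdf_def cdf_def by (subst measure_density_eq_integral) auto
qed

lemma normal_cdf_DERIV: "DERIV normal_cdf x :> std_normal_density x"
  unfolding normal_cdf_eq_cdf
proof (rule cdf_density_DERIV[where c="x - 1" and d="x + 1"])
  show "continuous_on {x - 1..x + 1} std_normal_density"
    unfolding std_normal_density_def by (intro continuous_intros) auto
qed (auto intro: real_dist_normal_dist)

lemma normal_cdf_strict_mono: "x < y \<Longrightarrow> normal_cdf x < normal_cdf y"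
  by (rule DERIV_pos_imp_increasing) (auto intro!: exI normal_cdf_DERIV normal_density_pos)

lemma inj_normal_cdf: "inj normal_cdf"
  by (metis injI linorder_neqE_linordered_idom normal_cdf_strict_mono order_less_irrefl)

lemma normal_cdf_less_iff: "normal_cdf x < normal_cdf y \<longleftrightarrow> x < y"
  by (metis linorder_neqE_linordered_idom normal_cdf_strict_mono order_less_asym)

lemma normal_cdf_isCont: "isCont normal_cdf x"
  using normal_cdf_DERIV DERIV_isCont by blast

lemma normal_cdf_gt_0: "0 < normal_cdf x"
  and normal_cdf_lt_1: "normal_cdf x < 1"
proof -
  interpret real_distribution std_normal_distribution by (rule real_dist_normal_dist)
  have "0 \<le> normal_cdf (x - 1)" "normal_cdf (x + 1) \<le> 1"
    unfolding normal_cdf_eq_cdf by (auto simp: cdf_nonneg cdf_bounded_prob)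
  moreover have "normal_cdf (x - 1) < normal_cdf x" "normal_cdf x < normal_cdf (x + 1)"
    by (auto intro: normal_cdf_strict_mono)
  ultimately show "0 < normal_cdf x" "normal_cdf x < 1" by linarith+
qed

lemma cdf_surj:
  assumes "real_distribution M" "\<And>x. isCont (cdf M) x" "0 < p" "p < 1"
  shows "\<exists>x. cdf M x = p"
proof -
  interpret real_distribution M by fact
  have "\<forall>\<^sub>F x in at_bot. cdf M x < p" using cdf_lim_at_bot assms by (intro order_tendstoD)
  then obtain a where a: "cdf M a < p" by (metis eventually_at_bot_linorder order_refl)
  have "\<forall>\<^sub>F x in at_top. p < cdf M x" using cdf_lim_at_top_prob assms by (intro order_tendstoD)
  then obtain b where b: "p < cdf M b" by (metis eventually_at_top_linorder order_refl)
  have "a \<le> b" using a b cdf_nondecreasing[of b a] by linarith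
  then show ?thesis using IVT[of "cdf M" a p b] a b assms by auto
qed

definition normal_quantile :: "real \<Rightarrow> real" where "normal_quantile = the_inv normal_cdf"

lemma normal_quantile_cdf [simp]: "normal_quantile (normal_cdf x) = x"
  unfolding normal_quantile_def by (rule the_inv_f_f[OF inj_normal_cdf])

lemma normal_cdf_quantile:
  assumes "0 < p" "p < 1"
  shows "normal_cdf (normal_quantile p) = p"
proof -
  obtain x where "normal_cdf x = p"
    using cdf_surj[OF real_dist_normal_dist _ assms] normal_cdf_isCont
    by (auto simp: normal_cdf_eq_cdf)
  then show ?thesis by auto
qed

lemma normal_quantile_DERIV:
  assumes "0 < p" "p < 1"
  shows "DERIV normal_quantile p :> inverse (std_normal_density (normal_quantile p))"
proof (rule DERIV_inverse_function[where f=normal_cdf and a=0 and b=1])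
  have "isCont normal_quantile (normal_cdf (normal_quantile p))"
    by (rule isCont_inverse_function[where d=1]) (auto intro: normal_cdf_isCont)
  then show "isCont normal_quantile p" using assms by (simp add: normal_cdf_quantile)
  show "std_normal_density (normal_quantile p) \<noteq> 0" by (rule less_imp_neq[symmetric, OF normal_density_pos]) (rule zero_less_one)
qed (use assms in \<open>auto intro: normal_cdf_DERIV normal_cdf_quantile\<close>)

text \<open>
  The transport map is \<open>U = H\<^sup>-\<^sup>1 \<circ> G\<close>, where \<open>H\<close> is the distribution function of \<open>\<nu>\<close> and \<open>G\<close> that of
  the Gaussian law. Its derivative at \<open>s\<close> is \<open>\<psi> (U s)\<close>, so the defining inequality
  \<open>\<psi> y \<le> A sqrt y\<close> says exactly that the derivative of \<open>sqrt \<circ> U\<close> is at most \<open>A / 2\<close>. The proof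
  works with the inverse map \<open>y \<mapsto> G\<^sup>-\<^sup>1 (H y)\<close>, which is differentiable in the interior of the support.
\<close>

lemma nearly_gamma_transport:
  assumes "nearly_gamma \<nu>"
  obtains U :: "real \<Rightarrow> real" and A :: real
  where "0 < A" "\<And>s. 0 \<le> U s" "\<And>s t. \<bar>sqrt (U s) - sqrt (U t)\<bar> \<le> A * \<bar>s - t\<bar>"
    "U \<in> borel_measurable borel" "distr std_normal_distribution borel U = distr \<nu> borel (\<lambda>x. x)"
proof -
  have P: "prob_space \<nu>" using assms by (simp add: nearly_gamma_def)
  from assms have "\<exists>h :: real \<Rightarrow> real. h \<in> borel_measurable (restrict_space lborel {0..}) \<and>
      (\<forall>t\<ge>0. 0 \<le> h t) \<and> \<nu> = density (restrict_space lborel {0..}) (\<lambda>t. ennreal (h t)) \<and>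
      is_interval {t. 0 \<le> t \<and> 0 < h t} \<and> continuous_on {t. 0 \<le> t \<and> 0 < h t} h \<and>
      (\<exists>A>0. \<forall>y\<in>{t. 0 \<le> t \<and> 0 < h t}. nearly_gamma_psi h y \<le> A * sqrt y)"
    unfolding nearly_gamma_def Let_def by (rule conjunct2)
  then obtain h :: "real \<Rightarrow> real" and A where
    hm: "h \<in> borel_measurable (restrict_space lborel {0..})" and
    hnn': "\<forall>t\<ge>0. 0 \<le> h t" and
    nu: "\<nu> = density (restrict_space lborel {0..}) (\<lambda>t. ennreal (h t))" and
    intv: "is_interval {t. 0 \<le> t \<and> 0 < h t}" and
    cont: "continuous_on {t. 0 \<le> t \<and> 0 < h t} h" and
    A: "0 < A" and psi': "\<forall>y\<in>{t. 0 \<le> t \<and> 0 < h t}. nearly_gamma_psi h y \<le> A * sqrt y"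
    by (elim exE conjE)
  have hnn: "0 \<le> h t" if "0 \<le> t" for t using hnn' that by simp
  have psi: "nearly_gamma_psi h y \<le> A * sqrt y" if "0 \<le> y" "0 < h y" for y
    using psi' that by simp
  define I where "I = {t. 0 \<le> t \<and> 0 < h t}"
  define h0 where "h0 x = (if 0 \<le> x then h x else 0)" for x
  have h0m [measurable]: "h0 \<in> borel_measurable borel"
  proof -
    have "(\<lambda>x. indicator {0..} x *\<^sub>R h x) \<in> borel_measurable lborel"
      using hm by (subst (asm) borel_measurable_restrict_space_iff) auto
    moreover have "h0 = (\<lambda>x. indicator {0..} x *\<^sub>R h x)" by (auto simp: h0_def indicator_def)
    ultimately show ?thesis by simp
  qed
  have h0nn: "0 \<le> h0 x" for x using hnn by (simp add: h0_def)
  let ?M = "density lborel (\<lambda>x. ennreal (h0 x))"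
  interpret nu: prob_space \<nu> by fact
  have sets_nu: "sets \<nu> = sets (restrict_space borel {0..})"
    by (simp add: nu sets_restrict_space)
  have space_nu: "space \<nu> = {0..}" by (simp add: nu space_restrict_space)
  have meas_id: "(\<lambda>x. x) \<in> borel_measurable \<nu>"
    using measurable_restrict_space1[of "\<lambda>x. x" borel borel "{0..}"] measurable_cong_sets[OF sets_nu refl] by auto
  have distr_nu: "distr \<nu> borel (\<lambda>x. x) = ?M"
  proof (rule measure_eqI)
    fix X assume "X \<in> sets (distr \<nu> borel (\<lambda>x. x))"
    then have X[measurable]: "X \<in> sets borel" by simp
    have "emeasure (distr \<nu> borel (\<lambda>x. x)) X = emeasure \<nu> (X \<inter> {0..})"
      using meas_id by (simp add: emeasure_distr space_nu)
    also have "\<dots> = (\<integral>\<^sup>+x. ennreal (h x) * indicator (X \<inter> {0..}) x \<partial>restrict_space lborel {0..})"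
      unfolding nu using hm by (subst emeasure_density) (auto simp: sets_restrict_space_iff)
    also have "\<dots> = (\<integral>\<^sup>+x. ennreal (h x) * indicator (X \<inter> {0..}) x * indicator {0..} x \<partial>lborel)"
      by (subst nn_integral_restrict_space) auto
    also have "\<dots> = (\<integral>\<^sup>+x. ennreal (h0 x) * indicator X x \<partial>lborel)"
      by (intro nn_integral_cong) (auto simp: h0_def indicator_def)
    also have "\<dots> = emeasure ?M X" by (subst emeasure_density) auto
    finally show "emeasure (distr \<nu> borel (\<lambda>x. x)) X = emeasure ?M X" .
  qed simp
  have "prob_space ?M" unfolding distr_nu[symmetric] by (rule nu.prob_space_distr[OF meas_id])
  then have RD: "real_distribution ?M" by (simp add: real_distribution_def real_distribution_axioms_def)
  interpret M: real_distribution ?M by (rule RD)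
  have int: "integrable lborel h0"
  proof (rule integrableI_nonneg)
    have "(\<integral>\<^sup>+x. ennreal (h0 x) \<partial>lborel) = emeasure ?M UNIV"
      by (subst emeasure_density) auto
    then show "(\<integral>\<^sup>+x. ennreal (h0 x) \<partial>lborel) < \<infinity>"
      using M.emeasure_space_1 by simp
  qed (auto simp: h0nn)
  define H where "H = cdf ?M"
  have Hint: "H y = (LINT u:{0..y}|lborel. h u)" if "0 \<le> y" for y
  proof -
    have "H y = (LINT u:{..y}|lborel. h0 u)"
      unfolding H_def cdf_def by (intro measure_density_eq_integral h0nn int) auto
    also have "\<dots> = (LINT u:{0..y}|lborel. h u)"
      unfolding set_lebesgue_integral_def by (intro Bochner_Integration.integral_cong) (auto simp: indicator_def h0_def)
    finally show ?thesis .
  qed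
  have HI: "H x = (LINT u:{..x}|lborel. h0 u)" for x
    unfolding H_def cdf_def by (intro measure_density_eq_integral h0nn int) auto
  have h0I: "h0 x = 0" if "x \<notin> I" for x
    using that hnn[of x] by (auto simp: I_def h0_def)
  have Hcont: "isCont H x" for x
    unfolding H_def 
  proof (subst M.isCont_cdf)
    have "emeasure ?M {x} = (\<integral>\<^sup>+u. ennreal (h0 u) * indicator {x} u \<partial>lborel)"
      by (subst emeasure_density) auto
    also have "\<dots> = 0" by (subst nn_integral_0_iff_AE) (use AE_lborel_singleton[of x] in \<open>auto elim!: eventually_mono\<close>)
    finally show "measure ?M {x} = 0" by (simp add: measure_def)
  qed
  have Hmono: "H x \<le> H y" if "x \<le> y" for x y unfolding H_def by (rule M.cdf_nondecreasing[OF that])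
  have Hsurj: "\<exists>y. H y = p" if "0 < p" "p < 1" for p
    unfolding H_def using cdf_surj[OF RD _ that] Hcont by (simp add: H_def)
  have H0: "H y = 0" if "\<And>i. i \<in> I \<Longrightarrow> y \<le> i" for y
  proof -
    have "(LINT u:{..y}|lborel. h0 u) = (LINT (u::real)|lborel. 0)" unfolding set_lebesgue_integral_def
    proof (rule integral_cong_AE)
      show "AE u in lborel. indicator {..y} u *\<^sub>R h0 u = 0"
        using AE_lborel_singleton[of y]
      proof eventually_elim
        case (elim u)
        then show ?case using that[of u] h0I[of u] by (cases "u \<in> I") (auto simp: indicator_def)
      qed
    qed auto
    then show ?thesis by (simp add: HI)
  qed
  have H1: "H y = 1" if "\<And>i. i \<in> I \<Longrightarrow> i \<le> y" for y
  proof -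
    have "(LINT u:{..y}|lborel. h0 u) = (LINT u:UNIV|lborel. h0 u)" unfolding set_lebesgue_integral_def
    proof (intro Bochner_Integration.integral_cong refl)
      fix u show "indicator {..y} u *\<^sub>R h0 u = indicator UNIV u *\<^sub>R h0 u"
        using that[of u] h0I[of u] by (cases "u \<in> I") (auto simp: indicator_def)
    qed
    also have "\<dots> = measure ?M UNIV" by (intro measure_density_eq_integral[symmetric] h0nn int) auto
    also have "\<dots> = 1" using M.prob_space by simp
    finally show ?thesis by (simp add: HI)
  qed
  have inside: "\<exists>c d. c \<in> I \<and> d \<in> I \<and> c < y \<and> y < d" if "0 < H y" "H y < 1" for y
  proof -
    have "\<exists>c\<in>I. \<not> y \<le> c" using H0[of y] that by auto
    moreover have "\<exists>d\<in>I. \<not> d \<le> y" using H1[of y] that by auto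
    ultimately show ?thesis by (auto simp: not_le)
  qed
  have nearI: "x \<in> I" if "c \<in> I" "d \<in> I" "c \<le> x" "x \<le> d" for c d x
    using intv that unfolding I_def[symmetric] is_interval_1 by blast
  have HD: "DERIV H y :> h y" if "c \<in> I" "d \<in> I" "c < y" "y < d" for c d y
  proof -
    have sub: "x \<in> I" if "x \<in> {c..d}" for x
      using that by (intro nearI[OF \<open>c \<in> I\<close> \<open>d \<in> I\<close>]) simp_all
    have eq: "h x = h0 x" if "x \<in> {c..d}" for x
      using sub[OF that] by (simp add: h0_def I_def)
    have "continuous_on {c..d} h"
      using cont sub unfolding I_def[symmetric] by (meson continuous_on_subset subsetI)
    then have "continuous_on {c..d} h0"
      by (rule continuous_on_eq) (rule eq)
    from cdf_density_DERIV[OF h0m h0nn int RD this that(3,4)]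
    have "DERIV H y :> h0 y" unfolding H_def .
    moreover have "h0 y = h y" using that(3,4) by (intro eq[symmetric]) simp
    ultimately show ?thesis by (rule DERIV_cong)
  qed
  have Hstrict: "H x < H y" if hy: "0 < H y" "H y < 1" "x < y" for x y
  proof -
    obtain c d where cd: "c \<in> I" "d \<in> I" "c < y" "y < d" using inside[OF hy(1,2)] by blast
    define q where "q = max c x"
    have q: "c \<le> q" "x \<le> q" "q < y" using cd(3) hy(3) by (auto simp: q_def)
    define e where "e = (q + y) / 2"
    have qe: "q < e" "e < y" using q(3) by (simp_all add: e_def)
    have e: "c < e" "x < e" "e < y" using q qe by linarith+
    have "H e < H y"
    proof (rule DERIV_pos_imp_increasing[where f=H])
      fix z assume z: "e \<le> z" "z \<le> y"
      then have cz: "c < z" and zd: "z < d" using e cd by linarith+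
      then have "z \<in> I" by (intro nearI[OF cd(1,2)]) simp_all
      then have "0 < h z" by (simp add: I_def)
      with HD[OF cd(1,2) cz zd] show "\<exists>D. DERIV H z :> D \<and> D > 0" by (intro exI conjI)
    qed (rule e(3))
    moreover have "H x \<le> H e" by (rule Hmono[OF less_imp_le[OF e(2)]])
    ultimately show ?thesis by simp
  qed
  define U where "U s = (SOME y. H y = normal_cdf s)" for s
  have HU: "H (U s) = normal_cdf s" for s
    unfolding U_def using Hsurj[OF normal_cdf_gt_0 normal_cdf_lt_1] by (rule someI_ex)
  have HU01: "0 < H (U s)" "H (U s) < 1" for s unfolding HU by (rule normal_cdf_gt_0, rule normal_cdf_lt_1)
  have Unn: "0 \<le> U s" for s
  proof -
    obtain c where "c \<in> I" "c < U s" using inside[OF HU01] by blast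
    then show ?thesis by (auto simp: I_def)
  qed
  have Uless: "U s < U t" if "s < t" for s t
    using Hmono[of "U t" "U s"] normal_cdf_strict_mono[OF that] HU[of s] HU[of t]
    by (cases "U t \<le> U s") auto
  have key: "\<bar>sqrt (U s) - sqrt (U t)\<bar> \<le> A / 2 * (t - s)" if "s < t" for s t
  proof -
    \<comment> \<open>The derivative of \<open>2 sqrt y\<close> is \<open>1 / sqrt y \<le> A / \<psi> y\<close>, and \<open>1 / \<psi>\<close> is the derivative of \<open>normal_quantile \<circ> H\<close>.\<close>
    define R where "R y = A * normal_quantile (H y) - 2 * sqrt y" for y
    have "R (U s) \<le> R (U t)"
    proof (rule DERIV_nonneg_imp_nondecreasing[where f=R])
      show "U s \<le> U t" using Uless[OF that] by simp
      fix y assume y: "U s \<le> y" "y \<le> U t"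
      have Hy: "0 < H y" "H y < 1"
        using Hmono[OF y(1)] Hmono[OF y(2)] HU01 by (meson less_le_trans le_less_trans)+
      obtain c d where cd: "c \<in> I" "d \<in> I" "c < y" "y < d" using inside[OF Hy] by blast
      have yI: "y \<in> I" using nearI[OF cd(1,2)] cd by auto
      have y0: "0 < y" using cd by (auto simp: I_def)
      let ?q = "std_normal_density (normal_quantile (H y))"
      have q0: "0 < ?q" by (simp add: normal_density_pos)
      have d: "DERIV R y :> A * (inverse ?q * h y) - 2 * (inverse (sqrt y) / 2)"
        unfolding R_def
        by (intro DERIV_diff DERIV_cmult DERIV_chain2[OF normal_quantile_DERIV[OF Hy] HD[OF cd]]
            DERIV_real_sqrt y0)
      have "?q / h y \<le> A * sqrt y"
        using psi[of y] yI Hint[of y] Hy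
        by (auto simp: I_def nearly_gamma_psi_def gauss_profile_def normal_quantile_def)
      then have "?q \<le> A * sqrt y * h y" using yI by (simp add: I_def field_simps)
      then have "inverse (sqrt y) \<le> A * (inverse ?q * h y)"
        using q0 y0 by (simp add: field_simps)
      then have "0 \<le> A * (inverse ?q * h y) - 2 * (inverse (sqrt y) / 2)" by linarith
      with d show "\<exists>D. DERIV R y :> D \<and> D \<ge> 0" by (intro exI conjI)
    qed
    then have "2 * (sqrt (U t) - sqrt (U s)) \<le> A * (t - s)" by (simp add: R_def HU algebra_simps)
    moreover have "sqrt (U s) \<le> sqrt (U t)" using Uless[OF that] by simp
    ultimately show ?thesis by simp
  qed
  have lip: "\<bar>sqrt (U s) - sqrt (U t)\<bar> \<le> A / 2 * \<bar>s - t\<bar>" for s t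
  proof (cases s t rule: linorder_cases)
    case less
    then show ?thesis using key[OF less] by simp
  next
    case greater
    then show ?thesis using key[OF greater] by (simp add: abs_minus_commute[of "sqrt (U s)"])
  qed simp
  have "U s \<le> U t" if "s \<le> t" for s t using Uless[of s t] that by (cases "s = t") auto
  then have "mono U" by (rule monoI)
  then have Um [measurable]: "U \<in> borel_measurable borel" by (rule borel_measurable_mono)
  interpret N: real_distribution std_normal_distribution by (rule real_dist_normal_dist)
  have "distr std_normal_distribution borel U = ?M"
  proof (rule cdf_unique)
    show "real_distribution (distr std_normal_distribution borel U)"
      by (simp add: real_distribution_def real_distribution_axioms_def N.prob_space_distr)
    show "real_distribution ?M" by (rule RD)
    show "cdf (distr std_normal_distribution borel U) = cdf ?M"
    proof
      fix y
      have eq: "cdf (distr std_normal_distribution borel U) y = measure std_normal_distribution {s. U s \<le> y}"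
        unfolding cdf_def by (subst measure_distr) (auto simp: vimage_def)
      have iff: "U s \<le> y \<longleftrightarrow> normal_cdf s \<le> H y" for s
        using Hmono[of "U s" y] Hstrict[OF HU01, of y s] HU[of s]
        by (cases "U s \<le> y") auto
      have Hb: "0 \<le> H y" "H y \<le> 1" unfolding H_def by (auto simp: M.cdf_nonneg M.cdf_bounded_prob)
      consider "H y = 0" | "H y = 1" | "0 < H y" "H y < 1" using Hb by linarith
      then have "measure std_normal_distribution {s. normal_cdf s \<le> H y} = H y"
      proof cases
        case 1
        then have "{s. normal_cdf s \<le> H y} = {}" using normal_cdf_gt_0 by (auto simp: not_le)
        then show ?thesis using 1 by simp
      next
        case 2
        then have "{s. normal_cdf s \<le> H y} = UNIV" using normal_cdf_lt_1 by (auto simp: less_imp_le)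
        then show ?thesis using 2 N.prob_space by simp
      next
        case 3
        define q where "q = normal_quantile (H y)"
        have q: "normal_cdf q = H y" unfolding q_def using 3 by (rule normal_cdf_quantile)
        have "normal_cdf s \<le> H y \<longleftrightarrow> s \<le> q" for s
          using normal_cdf_less_iff[of q s] unfolding q[symmetric] by linarith
        then have "{s. normal_cdf s \<le> H y} = {..q}" by auto
        then have "measure std_normal_distribution {s. normal_cdf s \<le> H y} = normal_cdf q"
          by (simp add: normal_cdf_eq_cdf cdf_def)
        then show ?thesis by (simp add: q)
      qed
      then show "cdf (distr std_normal_distribution borel U) y = cdf ?M y"
        by (simp add: eq iff H_def)
    qed
  qed
  then show ?thesis
    using that[of "A/2" U] A Unn lip Um distr_nu by simp
qed


section \<open>Paths and passage times on the lattice\<close>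

definition path_time :: "((int ^ 'd::finite) set \<Rightarrow> real) \<Rightarrow> (int ^ 'd) list \<Rightarrow> real" where
  "path_time x p = sum_list (map x (path_edges p))"

lemma passage_time_alt: "passage_time x u v = (INF p \<in> {p. lattice_path u p v}. path_time x p)"
  by (simp add: passage_time_def path_time_def)

lemma l1_norm_nonneg: "0 \<le> l1_norm v"
  by (simp add: l1_norm_def sum_nonneg)

lemma l1_norm_0 [simp]: "l1_norm 0 = 0"
  by (simp add: l1_norm_def)

lemma l1_norm_eq_0_iff: "l1_norm v = 0 \<longleftrightarrow> v = 0"
  by (auto simp: l1_norm_def sum_nonneg_eq_0_iff vec_eq_iff)

lemma l1_norm_minus_commute: "l1_norm (u - v) = l1_norm (v - u)"
  by (simp add: l1_norm_def abs_minus_commute)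

lemma l1_norm_triangle: "l1_norm (u - w) \<le> l1_norm (u - v) + l1_norm (v - w)"
  unfolding l1_norm_def sum.distrib[symmetric] by (intro sum_mono) auto

lemma lattice_adj_commute: "lattice_adj u v \<longleftrightarrow> lattice_adj v u"
  by (simp add: lattice_adj_def l1_norm_minus_commute)

lemma lattice_adj_shift [simp]: "lattice_adj (z + u) (z + v) \<longleftrightarrow> lattice_adj u v"
  by (simp add: lattice_adj_def)

lemma path_edges_Nil [simp]: "path_edges [] = []"
  and path_edges_single [simp]: "path_edges [a] = []"
  and path_edges_Cons [simp]: "path_edges (a # b # p) = {a, b} # path_edges (b # p)"
  by (simp_all add: path_edges_def)

lemma length_path_edges: "length (path_edges p) = length p - 1"
  by (simp add: path_edges_def)

lemma path_edges_append: "path_edges (p @ a # q) = path_edges (p @ [a]) @ path_edges (a # q)"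
proof (induction p)
  case (Cons b p)
  then show ?case by (cases p) auto
qed simp

lemma path_edges_map: "path_edges (map f p) = map (image f) (path_edges p)"
proof (induction p)
  case (Cons b p)
  then show ?case by (cases p) auto
qed simp

lemma path_edges_rev: "path_edges (rev p) = rev (path_edges p)"
proof (induction p)
  case (Cons b p)
  show ?case
  proof (cases p)
    case (Cons c q)
    have "path_edges (rev (b # p)) = path_edges (rev q @ c # [b])" by (simp add: Cons)
    also have "\<dots> = path_edges (rev q @ [c]) @ path_edges [c, b]" by (rule path_edges_append)
    also have "rev q @ [c] = rev p" by (simp add: Cons)
    finally show ?thesis using Cons.IH by (simp add: Cons insert_commute)
  qed simp
qed simp

lemma path_edges_subset: "e \<in> set (path_edges p) \<Longrightarrow> e \<subseteq> set p"
proof (induction p)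
  case (Cons b p)
  then show ?case by (cases p) auto
qed simp

lemma distinct_path_edges: "distinct p \<Longrightarrow> distinct (path_edges p)"
proof (induction p)
  case (Cons b p)
  show ?case
  proof (cases p)
    case (Cons c q)
    have "{b, c} \<notin> set (path_edges p)"
      using path_edges_subset[of "{b, c}" p] Cons.prems by auto
    then show ?thesis using Cons.IH Cons.prems by (simp add: Cons)
  qed simp
qed simp

lemma lattice_path_Cons:
  "lattice_path u (a # b # p) v \<longleftrightarrow> a = u \<and> lattice_adj a b \<and> lattice_path b (b # p) v"
  by (auto simp: lattice_path_def)

lemma lattice_path_single [simp]: "lattice_path u [a] v \<longleftrightarrow> a = u \<and> a = v"
  by (auto simp: lattice_path_def)

lemma lattice_path_edges: "lattice_path u p v \<Longrightarrow> e \<in> set (path_edges p) \<Longrightarrow> e \<in> lattice_edges"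
proof (induction p arbitrary: u)
  case (Cons a p)
  then show ?case
    by (cases p) (auto simp: lattice_path_Cons lattice_edges_def)
qed simp

lemma lattice_path_append:
  "lattice_path u (p @ a # q) v \<longleftrightarrow> lattice_path u (p @ [a]) a \<and> lattice_path a (a # q) v"
proof -
  have "successively lattice_adj (p @ a # q) \<longleftrightarrow>
      successively lattice_adj (p @ [a]) \<and> successively lattice_adj (a # q)"
    by (auto simp: successively_append_iff)
  then show ?thesis by (auto simp: lattice_path_def hd_append)
qed

lemma lattice_path_shift: "lattice_path (z + u) (map ((+) z) p) (z + v) \<longleftrightarrow> lattice_path u p v"
  by (cases "p = []") (simp_all add: lattice_path_def hd_map last_map successively_map)

lemma lattice_path_rev: "lattice_path u p v \<Longrightarrow> lattice_path v (rev p) u"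
  by (auto simp: lattice_path_def hd_rev last_rev lattice_adj_commute)

lemma path_time_append: "path_time x (p @ a # q) = path_time x (p @ [a]) + path_time x (a # q)"
  by (simp add: path_time_def path_edges_append[of p a q])

lemma path_time_single [simp]: "path_time x [a] = 0"
  by (simp add: path_time_def)

lemma path_time_rev: "path_time x (rev p) = path_time x p"
  by (simp add: path_time_def path_edges_rev rev_map[symmetric] sum_list_rev)

lemma path_time_nonneg:
  assumes "lattice_path u p v" "\<And>e. e \<in> lattice_edges \<Longrightarrow> 0 \<le> x e"
  shows "0 \<le> path_time x p"
  unfolding path_time_def using lattice_path_edges[OF assms(1)] assms(2)
  by (intro sum_list_nonneg) auto

lemma path_time_distinct: "distinct p \<Longrightarrow> path_time x p = (\<Sum>e\<in>set (path_edges p). x e)"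
  unfolding path_time_def by (rule sum_list_distinct_conv_sum_set[OF distinct_path_edges])

definition shift_weights :: "int ^ 'd::finite \<Rightarrow> ((int ^ 'd) set \<Rightarrow> real) \<Rightarrow> (int ^ 'd) set \<Rightarrow> real" where
  "shift_weights z x e = x ((+) z ` e)"

lemma path_time_shift: "path_time x (map ((+) z) p) = path_time (shift_weights z x) p"
proof -
  have "shift_weights z x = (\<lambda>e. x ((+) z ` e))" by (rule ext) (simp add: shift_weights_def)
  then show ?thesis by (simp add: path_time_def path_edges_map comp_def)
qed

lemma shift_lattice_edges: "e \<in> lattice_edges \<Longrightarrow> (+) z ` e \<in> lattice_edges"
proof -
  assume "e \<in> lattice_edges"
  then obtain u v where e: "e = {u, v}" "lattice_adj u v" by (auto simp: lattice_edges_def)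
  then have "(+) z ` e = {z + u, z + v}" "lattice_adj (z + u) (z + v)" by auto
  then show ?thesis unfolding lattice_edges_def by blast
qed

lemma inj_shift_edges: "inj_on ((`) ((+) (z :: int ^ 'd::finite))) S"
  by (rule inj_onI) (simp add: inj_image_eq_iff)

text \<open>
  Cutting out a loop removes edges and hence does not increase the passage time, for all nonnegative weights at once.
\<close>

lemma loop_erasure:
  assumes "lattice_path u p v"
  shows "\<exists>q. lattice_path u q v \<and> distinct q \<and> length q \<le> length p \<and>
    (\<forall>x. (\<forall>e\<in>lattice_edges. 0 \<le> x e) \<longrightarrow> path_time x q \<le> path_time x p)"
  using assms
proof (induction "length p" arbitrary: p rule: less_induct)
  case less
  show ?case
  proof (cases "distinct p")
    case True
    then show ?thesis using less.prems by blast
  next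
    case False
    then obtain xs ys zs y where p: "p = xs @ [y] @ ys @ [y] @ zs"
      using not_distinct_decomp by blast
    have p1: "lattice_path u (xs @ [y]) y" and p2: "lattice_path y ((y # ys) @ y # zs) v"
      using less.prems lattice_path_append[of u xs y "ys @ y # zs" v] by (auto simp: p)
    have p3: "lattice_path y ((y # ys) @ [y]) y" and p4: "lattice_path y (y # zs) v"
      using p2 lattice_path_append[of y "y # ys" y zs v] by auto
    have p5: "lattice_path u (xs @ y # zs) v"
      using p1 p4 lattice_path_append[of u xs y zs v] by simp
    \<comment> \<open>The loop at \<open>y\<close> is removed.\<close>
    have shorter: "length (xs @ y # zs) < length p" by (simp add: p)
    obtain q where q: "lattice_path u q v" "distinct q" "length q \<le> length (xs @ y # zs)"
      "\<forall>x. (\<forall>e\<in>lattice_edges. 0 \<le> x e) \<longrightarrow> path_time x q \<le> path_time x (xs @ y # zs)"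
      using less.hyps[OF shorter p5] by blast
    have "path_time x q \<le> path_time x p" if x: "\<forall>e\<in>lattice_edges. 0 \<le> x e" for x
    proof -
      have "path_time x p = path_time x (xs @ [y]) + path_time x ((y # ys) @ y # zs)"
        using path_time_append[of x xs y "ys @ y # zs"] by (simp add: p)
      also have "path_time x ((y # ys) @ y # zs) = path_time x ((y # ys) @ [y]) + path_time x (y # zs)"
        by (rule path_time_append)
      finally have "path_time x (xs @ [y]) + path_time x (y # zs) \<le> path_time x p"
        using path_time_nonneg[OF p3, of x] x by simp
      then have "path_time x (xs @ y # zs) \<le> path_time x p"
        using path_time_append[of x xs y zs] by simp
      then show ?thesis using q(4) x by (meson order_trans)
    qed
    then show ?thesis using q(1-3) shorter by (intro exI[of _ q]) auto
  qed
qed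

lemma l1_norm_less_length: "lattice_path u p v \<Longrightarrow> l1_norm (v - u) < int (length p)"
proof (induction p arbitrary: u)
  case Nil
  then show ?case by (simp add: lattice_path_def)
next
  case (Cons a p)
  show ?case
  proof (cases p)
    case Nil
    then show ?thesis using Cons.prems by auto
  next
    case (Cons b q)
    then have ab: "a = u" "lattice_adj u b" "lattice_path b p v"
      using Cons.prems by (auto simp: lattice_path_Cons)
    have "l1_norm (v - u) \<le> l1_norm (v - b) + l1_norm (b - u)" by (rule l1_norm_triangle)
    moreover have "l1_norm (b - u) = 1"
      using ab(2) by (simp add: lattice_adj_def l1_norm_minus_commute)
    moreover have "l1_norm (v - b) < int (length p)" by (rule Cons.IH[OF ab(3)])
    ultimately show ?thesis by simp
  qed
qed

lemma shortest_path_exists: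
  "l1_norm (v - u) = int n \<Longrightarrow> \<exists>p. lattice_path u p v \<and> length p = Suc n"
proof (induction n arbitrary: u)
  case 0
  then have "v = u" by (simp add: l1_norm_eq_0_iff)
  then show ?case by (intro exI[of _ "[u]"]) simp
next
  case (Suc n)
  then have "v - u \<noteq> 0" by (metis l1_norm_0 of_nat_eq_0_iff nat.distinct(1))
  then obtain i where i: "(v - u) $ i \<noteq> 0" by (auto simp: vec_eq_iff)
  define s where "s = axis i (sgn ((v - u) $ i))"
  have s1: "l1_norm s = 1"
  proof -
    have "l1_norm s = (\<Sum>j\<in>UNIV. if j = i then 1 else 0)"
      unfolding l1_norm_def s_def using i by (intro sum.cong) (auto simp: axis_def abs_sgn_eq)
    then show ?thesis by simp
  qed
  have "l1_norm (v - u) - l1_norm (v - (u + s)) = (\<Sum>j\<in>UNIV. \<bar>(v - u) $ j\<bar> - \<bar>(v - (u + s)) $ j\<bar>)"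
    by (simp add: l1_norm_def sum_subtractf)
  also have "\<dots> = (\<Sum>j\<in>UNIV. if j = i then 1 else 0)"
    using i by (intro sum.cong) (auto simp: s_def axis_def sgn_if)
  finally have "l1_norm (v - (u + s)) = int n" using Suc.prems by simp
  then obtain p where p: "lattice_path (u + s) p v" "length p = Suc n" using Suc.IH by blast
  have adj: "lattice_adj u (u + s)" using s1 l1_norm_minus_commute[of u "u + s"] by (simp add: lattice_adj_def)
  obtain q where q: "p = (u + s) # q" using p(1) by (cases p) (auto simp: lattice_path_def)
  have "lattice_path u (u # p) v" using p(1) adj by (simp add: q lattice_path_Cons)
  then show ?case using p(2) by (intro exI[of _ "u # p"]) simp
qed

text \<open>
  A loop-erased path of minimal number of edges; its edges are distinct, so its passage time is a sum of
  independent weights.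
\<close>

definition shortest_path :: "int ^ 'd::finite \<Rightarrow> int ^ 'd \<Rightarrow> (int ^ 'd) list" where
  "shortest_path u v = (SOME p. lattice_path u p v \<and> distinct p \<and> int (length p) = l1_norm (v - u) + 1)"

lemma shortest_path:
  shows "lattice_path u (shortest_path u v) v" "distinct (shortest_path u v)"
    "int (length (shortest_path u v)) = l1_norm (v - u) + 1"
proof -
  have "\<exists>p. lattice_path u p v \<and> distinct p \<and> int (length p) = l1_norm (v - u) + 1"
  proof -
    obtain p where p: "lattice_path u p v" "length p = Suc (nat (l1_norm (v - u)))"
      using shortest_path_exists[of v u "nat (l1_norm (v - u))"] l1_norm_nonneg[of "v - u"] by auto
    obtain q where q: "lattice_path u q v" "distinct q" "length q \<le> length p"
      using loop_erasure[OF p(1)] by blast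
    have "l1_norm (v - u) < int (length q)" by (rule l1_norm_less_length[OF q(1)])
    then have "int (length q) = l1_norm (v - u) + 1"
      using q(3) p(2) l1_norm_nonneg[of "v - u"] by linarith
    then show ?thesis using q by blast
  qed
  from someI_ex[OF this] show "lattice_path u (shortest_path u v) v" "distinct (shortest_path u v)"
    "int (length (shortest_path u v)) = l1_norm (v - u) + 1"
    unfolding shortest_path_def by blast+
qed

lemma finite_vec_box:
  assumes "finite S"
  shows "finite {x :: 'a ^ 'd::finite. \<forall>i. x $ i \<in> S}"
    "card {x :: 'a ^ 'd::finite. \<forall>i. x $ i \<in> S} = card S ^ CARD('d)"
proof -
  have eq: "{x :: 'a ^ 'd. \<forall>i. x $ i \<in> S} = vec_lambda ` (UNIV \<rightarrow>\<^sub>E S)"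
  proof (intro equalityI subsetI)
    fix x :: "'a ^ 'd" assume "x \<in> {x. \<forall>i. x $ i \<in> S}"
    then have "vec_nth x \<in> UNIV \<rightarrow>\<^sub>E S" by (auto simp: PiE_def)
    then show "x \<in> vec_lambda ` (UNIV \<rightarrow>\<^sub>E S)" by (intro image_eqI[of _ _ "vec_nth x"]) auto
  qed auto
  have inj: "inj_on vec_lambda (UNIV \<rightarrow>\<^sub>E S)"
    by (intro inj_onI) (metis vec_lambda_inverse UNIV_I)
  show "finite {x :: 'a ^ 'd. \<forall>i. x $ i \<in> S}"
    unfolding eq using assms by (intro finite_imageI finite_PiE) auto
  show "card {x :: 'a ^ 'd. \<forall>i. x $ i \<in> S} = card S ^ CARD('d)"
    unfolding eq using assms by (simp add: card_image[OF inj] card_PiE)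
qed

definition unit_steps :: "(int ^ 'd::finite) set" where
  "unit_steps = {s. l1_norm s = 1}"

lemma finite_unit_steps: "finite (unit_steps :: (int ^ 'd::finite) set)"
proof (rule finite_subset)
  show "finite {s :: int ^ 'd. \<forall>i. s $ i \<in> {-1..1}}" by (rule finite_vec_box) simp
  show "(unit_steps :: (int ^ 'd) set) \<subseteq> {s. \<forall>i. s $ i \<in> {-1..1}}"
  proof (intro subsetI CollectI allI)
    fix s :: "int ^ 'd" and i assume "s \<in> unit_steps"
    moreover have "\<bar>s $ i\<bar> \<le> l1_norm s"
      unfolding l1_norm_def by (rule member_le_sum) auto
    ultimately show "s $ i \<in> {-1..1}" by (auto simp: unit_steps_def)
  qed
qed

definition walks :: "int ^ 'd::finite \<Rightarrow> nat \<Rightarrow> (int ^ 'd) list set" where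
  "walks u k = {p. length p = Suc k \<and> hd p = u \<and> successively lattice_adj p}"

text \<open>
  The recursion behind the count of walks: the first step is one of the unit steps.
\<close>

lemma walks_Suc: "walks u (Suc k) = (\<Union>s\<in>unit_steps. (#) u ` walks (u + s) k)"
proof (intro equalityI subsetI)
  fix p assume p: "p \<in> walks u (Suc k)"
  then obtain w q where q: "p = u # w # q"
    by (auto simp: walks_def length_Suc_conv)
  then have adj: "lattice_adj u w" and wq: "w # q \<in> walks w k" using p by (auto simp: walks_def)
  have "w - u \<in> unit_steps" using adj l1_norm_minus_commute[of u w] by (simp add: unit_steps_def lattice_adj_def)
  moreover have "w # q \<in> walks (u + (w - u)) k" using wq by simp
  ultimately show "p \<in> (\<Union>s\<in>unit_steps. (#) u ` walks (u + s) k)" using q by blast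
next
  fix p assume "p \<in> (\<Union>s\<in>unit_steps. (#) u ` walks (u + s) k)"
  then obtain s q where s: "s \<in> unit_steps" and q: "q \<in> walks (u + s) k" "p = u # q" by blast
  have "lattice_adj u (u + s)" using s l1_norm_minus_commute[of u "u + s"]
    by (simp add: lattice_adj_def unit_steps_def)
  then show "p \<in> walks u (Suc k)" using q by (cases q) (auto simp: walks_def)
qed

lemma card_walks_le:
  fixes u :: "int ^ 'd::finite"
  shows "finite (walks u k) \<and> card (walks u k) \<le> card (unit_steps :: (int ^ 'd) set) ^ k"
proof (induction k arbitrary: u)
  case 0
  have "walks u 0 = {[u]}" by (auto simp: walks_def length_Suc_conv)
  then show ?case by simp
next
  case (Suc k)
  have "card (walks u (Suc k)) \<le> (\<Sum>s\<in>unit_steps. card ((#) u ` walks (u + s) k))"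
    unfolding walks_Suc by (rule card_UN_le[OF finite_unit_steps])
  also have "\<dots> \<le> (\<Sum>s\<in>(unit_steps :: (int ^ 'd) set). card (unit_steps :: (int ^ 'd) set) ^ k)"
    using Suc.IH by (intro sum_mono order_trans[OF card_image_le]) auto
  also have "\<dots> = card (unit_steps :: (int ^ 'd) set) ^ Suc k" by simp
  finally show ?case
    using Suc.IH finite_unit_steps by (auto simp: walks_Suc)
qed

lemma lattice_path_in_walks: "lattice_path u p v \<Longrightarrow> p \<in> walks u (length p - 1)"
  by (auto simp: lattice_path_def walks_def)

lemma walks_lattice_path: "p \<in> walks u k \<Longrightarrow> lattice_path u p (last p)"
  by (auto simp: lattice_path_def walks_def)

text \<open>
  Only finitely many paths are kept, so that an optimal one exists and everything depends on finitely many
  weights. The cutoff is the number of vertices and not a region of space: replacing a piece of a path by a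
  shortest one then never leaves the class.
\<close>

definition short_paths :: "nat \<Rightarrow> int ^ 'd::finite \<Rightarrow> (int ^ 'd) list set" where
  "short_paths L v = {p. lattice_path 0 p v \<and> distinct p \<and> length p \<le> L}"

lemma finite_short_paths: "finite (short_paths L v)"
proof (rule finite_subset)
  show "short_paths L v \<subseteq> (\<Union>k\<le>L. walks 0 k)"
    using lattice_path_in_walks by (force simp: short_paths_def)
  show "finite (\<Union>k\<le>L. walks (0 :: int ^ 'a) k)" using card_walks_le by blast
qed

lemma short_paths_nonempty: "l1_norm v < int L \<Longrightarrow> shortest_path 0 v \<in> short_paths L v"
  using shortest_path[of 0 v] by (simp add: short_paths_def)

definition short_time :: "nat \<Rightarrow> int ^ 'd::finite \<Rightarrow> ((int ^ 'd) set \<Rightarrow> real) \<Rightarrow> real" where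
  "short_time L v x = Min (path_time x ` short_paths L v)"

definition short_geodesic :: "nat \<Rightarrow> int ^ 'd::finite \<Rightarrow> ((int ^ 'd) set \<Rightarrow> real) \<Rightarrow> (int ^ 'd) list" where
  "short_geodesic L v x = (SOME p. p \<in> short_paths L v \<and> path_time x p = short_time L v x)"

lemma short_geodesic:
  assumes "l1_norm v < int L"
  shows "short_geodesic L v x \<in> short_paths L v" "path_time x (short_geodesic L v x) = short_time L v x"
proof -
  have "short_time L v x \<in> path_time x ` short_paths L v"
    unfolding short_time_def using finite_short_paths short_paths_nonempty[OF assms] by (intro Min_in) auto
  then have "\<exists>p. p \<in> short_paths L v \<and> path_time x p = short_time L v x" by force
  from someI_ex[OF this] show "short_geodesic L v x \<in> short_paths L v"
    "path_time x (short_geodesic L v x) = short_time L v x"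
    unfolding short_geodesic_def by blast+
qed

lemma short_time_le: "p \<in> short_paths L v \<Longrightarrow> short_time L v x \<le> path_time x p"
  unfolding short_time_def using finite_short_paths by (intro Min_le) auto

lemma passage_time_le:
  assumes "lattice_path u p v" "\<And>e. e \<in> lattice_edges \<Longrightarrow> 0 \<le> x e"
  shows "passage_time x u v \<le> path_time x p"
  unfolding passage_time_alt using assms path_time_nonneg[of u _ v x]
  by (intro cINF_lower bdd_belowI2[where m=0]) auto

lemma passage_time_greatest:
  assumes "\<And>p. lattice_path u p v \<Longrightarrow> c \<le> path_time x p"
  shows "c \<le> passage_time x u v"
  unfolding passage_time_alt using assms shortest_path(1)[of u v] by (intro cINF_greatest) auto

lemma passage_time_nonneg:
  assumes "\<And>e. e \<in> lattice_edges \<Longrightarrow> 0 \<le> x e"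
  shows "0 \<le> passage_time x u v"
  by (rule passage_time_greatest) (rule path_time_nonneg[OF _ assms])

lemma passage_time_detour:
  assumes x: "\<And>e. e \<in> lattice_edges \<Longrightarrow> 0 \<le> x e"
    and p: "lattice_path u p u'" and q: "lattice_path v' q v"
  shows "passage_time x u v \<le> path_time x p + passage_time x u' v' + path_time x q"
proof -
  have "passage_time x u v - path_time x p - path_time x q \<le> passage_time x u' v'"
  proof (rule passage_time_greatest)
    fix r assume r: "lattice_path u' r v'"
    obtain p' where p': "p = p' @ [u']" using p by (metis lattice_path_def append_butlast_last_id)
    obtain r' where r': "r = u' # r'" using r by (cases r) (auto simp: lattice_path_def)
    obtain r2 where r2: "r = r2 @ [v']" using r by (metis lattice_path_def append_butlast_last_id)
    obtain q' where q': "q = v' # q'" using q by (cases q) (auto simp: lattice_path_def)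
    have 1: "lattice_path u (p' @ r) v'" using p r lattice_path_append[of u p' u' r' v'] by (simp add: p' r')
    have t1: "path_time x (p' @ r) = path_time x p + path_time x r"
      using path_time_append[of x p' u' r'] by (simp add: p' r')
    have 2: "lattice_path u ((p' @ r2) @ v' # q') v"
      using 1 q lattice_path_append[of u "p' @ r2" v' q' v] by (simp add: r2 q')
    have t2: "path_time x ((p' @ r2) @ v' # q') = path_time x (p' @ r) + path_time x q"
      using path_time_append[of x "p' @ r2" v' q'] by (simp add: r2 q')
    show "passage_time x u v - path_time x p - path_time x q \<le> path_time x r"
      using passage_time_le[OF 2, of x] x t1 t2 by simp
  qed
  then show ?thesis by simp
qed

lemma passage_time_shift:
  "passage_time (shift_weights z x) u v = passage_time x (z + u) (z + v)"
proof -
  have "{p. lattice_path (z + u) p (z + v)} = map ((+) z) ` {p. lattice_path u p v}"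
  proof (intro equalityI subsetI)
    fix p assume p: "p \<in> {p. lattice_path (z + u) p (z + v)}"
    have "p = map ((+) z) (map ((+) (- z)) p)" by (simp add: comp_def)
    moreover have "lattice_path u (map ((+) (- z)) p) v"
      using p lattice_path_shift[of "- z" "z + u" p "z + v"] by simp
    ultimately show "p \<in> map ((+) z) ` {p. lattice_path u p v}" by blast
  qed (auto simp: lattice_path_shift)
  then show ?thesis by (simp add: passage_time_alt image_comp comp_def path_time_shift)
qed

text \<open>
  The path from \<open>0\<close> to \<open>v\<close> may be led through \<open>z\<close> and \<open>z + v\<close>, and conversely.
\<close>

lemma passage_time_shift_diff:
  assumes x: "\<And>e. e \<in> lattice_edges \<Longrightarrow> 0 \<le> x e"
  shows "\<bar>passage_time x 0 v - passage_time (shift_weights z x) 0 v\<bar>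
    \<le> path_time x (shortest_path 0 z) + path_time x (shortest_path v (z + v))"
proof -
  note s = shortest_path(1)
  have "passage_time x 0 v \<le> path_time x (shortest_path 0 z) + passage_time x z (z + v)
      + path_time x (rev (shortest_path v (z + v)))"
    by (intro passage_time_detour x s lattice_path_rev)
  moreover have "passage_time x z (z + v) \<le> path_time x (rev (shortest_path 0 z)) + passage_time x 0 v
      + path_time x (shortest_path v (z + v))"
    by (intro passage_time_detour x s lattice_path_rev)
  ultimately show ?thesis
    using passage_time_shift[of z x 0 v] by (simp add: path_time_rev)
qed

text \<open>
  A nearly optimal path, made loop-free, is admissible as soon as the cutoff exceeds its length.
\<close>

lemma short_time_tendsto:
  assumes x: "\<And>e. e \<in> lattice_edges \<Longrightarrow> 0 \<le> x e"
  shows "(\<lambda>L. short_time L v x) \<longlonglongrightarrow> passage_time x 0 v"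
proof (rule LIMSEQ_I)
  fix r :: real assume r: "0 < r"
  have "\<exists>p. lattice_path 0 p v \<and> path_time x p < passage_time x 0 v + r"
  proof (rule ccontr)
    assume "\<not> ?thesis"
    then have "passage_time x 0 v + r \<le> passage_time x 0 v"
      by (intro passage_time_greatest) (auto simp: not_less)
    then show False using r by simp
  qed
  then obtain p where p: "lattice_path 0 p v" "path_time x p < passage_time x 0 v + r" by blast
  obtain q where q: "lattice_path 0 q v" "distinct q" "path_time x q \<le> path_time x p"
    using loop_erasure[OF p(1)] x by blast
  have "norm (short_time L v x - passage_time x 0 v) < r" if L: "length q \<le> L" for L
  proof -
    have "q \<in> short_paths L v" using q L by (simp add: short_paths_def)
    then have up: "short_time L v x \<le> path_time x q" by (rule short_time_le)
    have "l1_norm v < int L" using l1_norm_less_length[OF q(1)] L by simp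
    note g = short_geodesic[OF this, of x]
    have "passage_time x 0 v \<le> short_time L v x"
      using passage_time_le[of 0 "short_geodesic L v x" v x] g x by (simp add: short_paths_def)
    then show ?thesis using up q(3) p(2) by simp
  qed
  then show "\<exists>no. \<forall>n\<ge>no. norm (short_time n v x - passage_time x 0 v) < r" by blast
qed

text \<open>
  A smooth substitute for the largest passage time of a direct connection between two points of \<open>R\<close>: its
  logarithm divided by \<open>\<delta>\<close> dominates this maximum.
\<close>

definition detour_sum :: "real \<Rightarrow> (int ^ 'd::finite) set \<Rightarrow> ((int ^ 'd) set \<Rightarrow> real) \<Rightarrow> real" where
  "detour_sum \<delta> R x = (\<Sum>a\<in>R. \<Sum>b\<in>R. exp (\<delta> * path_time x (shortest_path a b)))"

text \<open>
  An exponential weight on all self-avoiding walks from \<open>R\<close>. Its logarithm dominates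
  \<open>k - s * path_time x p\<close> for every such walk \<open>p\<close> with \<open>k\<close> edges, so no long walk can have a small passage time.
\<close>

definition walk_sum :: "real \<Rightarrow> nat \<Rightarrow> (int ^ 'd::finite) set \<Rightarrow> ((int ^ 'd) set \<Rightarrow> real) \<Rightarrow> real" where
  "walk_sum s L R x = (\<Sum>a\<in>R. \<Sum>k<L. \<Sum>p\<in>{p \<in> walks a k. distinct p}. exp (real k - s * path_time x p))"

lemma walk_sum_ge:
  assumes "finite R" "a \<in> R" "p \<in> walks a k" "distinct p" "k < L"
  shows "exp (real k - s * path_time x p) \<le> walk_sum s L R x"
proof -
  have fin: "finite {p \<in> walks a k. distinct p}" for a :: "int ^ 'a" and k using card_walks_le[of a k] by simp
  have "exp (real k - s * path_time x p) \<le> (\<Sum>p\<in>{p \<in> walks a k. distinct p}. exp (real k - s * path_time x p))"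
    using assms fin by (intro member_le_sum) auto
  also have "\<dots> \<le> (\<Sum>k<L. \<Sum>p\<in>{p \<in> walks a k. distinct p}. exp (real k - s * path_time x p))"
    using assms by (intro member_le_sum[of k "{..<L}" "\<lambda>k. \<Sum>p\<in>{p \<in> walks a k. distinct p}. exp (real k - s * path_time x p)"]) (auto intro!: sum_nonneg)
  also have "\<dots> \<le> walk_sum s L R x"
    unfolding walk_sum_def using assms
    by (intro member_le_sum[of a R "\<lambda>a. \<Sum>k<L. \<Sum>p\<in>{p \<in> walks a k. distinct p}. exp (real k - s * path_time x p)"]) (auto intro!: sum_nonneg)
  finally show ?thesis .
qed

lemma detour_sum_ge:
  assumes "finite R" "a \<in> R" "b \<in> R"
  shows "exp (\<delta> * path_time x (shortest_path a b)) \<le> detour_sum \<delta> R x"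
proof -
  have "exp (\<delta> * path_time x (shortest_path a b)) \<le> (\<Sum>b\<in>R. exp (\<delta> * path_time x (shortest_path a b)))"
    using assms by (intro member_le_sum) auto
  also have "\<dots> \<le> detour_sum \<delta> R x"
    unfolding detour_sum_def using assms
    by (intro member_le_sum[of a R "\<lambda>a. \<Sum>b\<in>R. exp (\<delta> * path_time x (shortest_path a b))"]) (auto intro!: sum_nonneg)
  finally show ?thesis .
qed

lemma detour_sum_ge_1:
  assumes "finite R" "R \<noteq> {}" "0 \<le> \<delta>" "\<And>e. e \<in> lattice_edges \<Longrightarrow> 0 \<le> x e"
  shows "1 \<le> detour_sum \<delta> R x"
proof -
  obtain a where a: "a \<in> R" using assms by auto
  have "0 \<le> path_time x (shortest_path a a)" using shortest_path(1) assms(4) by (rule path_time_nonneg)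
  then have "1 \<le> exp (\<delta> * path_time x (shortest_path a a))" using assms by simp
  then show ?thesis using detour_sum_ge[OF assms(1) a a, of \<delta> x] by linarith
qed

lemma walk_sum_ge_1:
  assumes "finite R" "R \<noteq> {}" "0 < L"
  shows "1 \<le> walk_sum s L R x"
proof -
  obtain a where a: "a \<in> R" using assms by auto
  have "exp (real 0 - s * path_time x [a]) \<le> walk_sum s L R x"
    by (rule walk_sum_ge[OF assms(1) a]) (use assms in \<open>auto simp: walks_def\<close>)
  then show ?thesis by simp
qed

text \<open>
  Cut the geodesic at its first and at its last visit to \<open>R\<close>. The piece in between contains all visits. Since the
  geodesic is optimal, this piece is at most as expensive as a shortest path between its end points, hence at
  most \<open>ln (detour_sum) / \<delta>\<close>; and its number of edges \<open>k\<close> satisfies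
  \<open>k \<le> s * (passage time) + ln (walk_sum)\<close>.
\<close>

lemma card_geodesic_inter_le:
  fixes v :: "int ^ 'd::finite"
  assumes L: "l1_norm v < int L" and R: "finite R" "R \<noteq> {}" and s: "0 \<le> s" "0 < \<delta>"
    and x: "\<And>e. e \<in> lattice_edges \<Longrightarrow> 0 \<le> x e"
  shows "real (card (set (short_geodesic L v x) \<inter> R)) \<le> 1 + s / \<delta> * ln (detour_sum \<delta> R x) + ln (walk_sum s L R x)"
proof -
  define p where "p = short_geodesic L v x"
  have p: "lattice_path 0 p v" "distinct p" "length p \<le> L" and popt: "\<And>q. q \<in> short_paths L v \<Longrightarrow> path_time x p \<le> path_time x q"
    using short_geodesic[OF L, of x] short_time_le[of _ L v x] by (auto simp: p_def short_paths_def)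
  have L0: "0 < L" using L l1_norm_nonneg[of v] by linarith
  have D1: "1 \<le> detour_sum \<delta> R x" using s x by (intro detour_sum_ge_1 R) auto
  have W1: "1 \<le> walk_sum s L R x" by (intro walk_sum_ge_1 R L0)
  show ?thesis
  proof (cases "\<exists>a\<in>set p. a \<in> R")
    case False
    then have "set p \<inter> R = {}" by auto
    then show ?thesis using D1 W1 s by (simp add: p_def)
  next
    case True
    obtain \<alpha> a p1 where a: "p = \<alpha> @ a # p1" "a \<in> R" "\<forall>y\<in>set \<alpha>. y \<notin> R"
      using split_list_first_prop[OF True] by blast
    have "\<exists>b\<in>set (a # p1). b \<in> R" using a by auto
    from split_list_last_prop[OF this] obtain \<rho> b \<beta> where b: "a # p1 = \<rho> @ b # \<beta>" "b \<in> R" "\<forall>y\<in>set \<beta>. y \<notin> R"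
      by blast
    define \<pi> where "\<pi> = \<rho> @ [b]"
    have path1: "lattice_path 0 (\<alpha> @ [a]) a" and path2: "lattice_path a (a # p1) v"
      using p(1) lattice_path_append[of 0 \<alpha> a p1 v] by (auto simp: a(1))
    have path\<pi>: "lattice_path a \<pi> b" and path3: "lattice_path b (b # \<beta>) v"
      using path2 lattice_path_append[of a \<rho> b \<beta> v] by (auto simp: b(1) \<pi>_def)
    have time_p: "path_time x p = path_time x (\<alpha> @ [a]) + (path_time x \<pi> + path_time x (b # \<beta>))"
      using path_time_append[of x \<alpha> a p1] path_time_append[of x \<rho> b \<beta>] by (simp add: a(1) b(1) \<pi>_def)
    have p_eq: "p = \<alpha> @ \<rho> @ b # \<beta>" by (simp add: a(1) b(1))
    have dist\<pi>: "distinct \<pi>" using p(2) by (simp add: p_eq \<pi>_def)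
    define \<gamma> where "\<gamma> = shortest_path a b"
    have \<gamma>: "lattice_path a \<gamma> b" unfolding \<gamma>_def by (rule shortest_path)
    \<comment> \<open>The shortcut has at most as many vertices as the piece that it replaces, so the new path is still short.\<close>
    have len\<gamma>: "length \<gamma> \<le> length \<pi>"
      using shortest_path(3)[of a b] l1_norm_less_length[OF path\<pi>] by (simp add: \<gamma>_def)
    obtain \<gamma>1 where \<gamma>1: "\<gamma> = a # \<gamma>1" using \<gamma> by (cases \<gamma>) (auto simp: lattice_path_def)
    obtain \<gamma>2 where \<gamma>2: "\<gamma> = \<gamma>2 @ [b]" using \<gamma> by (metis lattice_path_def append_butlast_last_id)
    have q1: "lattice_path 0 (\<alpha> @ \<gamma>) b" "path_time x (\<alpha> @ \<gamma>) = path_time x (\<alpha> @ [a]) + path_time x \<gamma>"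
      using path1 \<gamma> lattice_path_append[of 0 \<alpha> a \<gamma>1 b] path_time_append[of x \<alpha> a \<gamma>1] by (auto simp: \<gamma>1)
    have q2: "lattice_path 0 ((\<alpha> @ \<gamma>2) @ b # \<beta>) v"
      "path_time x ((\<alpha> @ \<gamma>2) @ b # \<beta>) = path_time x (\<alpha> @ \<gamma>) + path_time x (b # \<beta>)"
      using q1 path3 lattice_path_append[of 0 "\<alpha> @ \<gamma>2" b \<beta> v] path_time_append[of x "\<alpha> @ \<gamma>2" b \<beta>]
      by (auto simp: \<gamma>2)
    have len2: "length ((\<alpha> @ \<gamma>2) @ b # \<beta>) \<le> L" using len\<gamma> p(3) by (simp add: p_eq \<gamma>2 \<pi>_def)
    obtain q where q: "lattice_path 0 q v" "distinct q" "length q \<le> length ((\<alpha> @ \<gamma>2) @ b # \<beta>)"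
      "path_time x q \<le> path_time x ((\<alpha> @ \<gamma>2) @ b # \<beta>)"
      using loop_erasure[OF q2(1)] x by blast
    have "q \<in> short_paths L v" using q(1-3) len2 by (simp add: short_paths_def)
    then have "path_time x p \<le> path_time x ((\<alpha> @ \<gamma>2) @ b # \<beta>)" using popt[of q] q(4) by linarith
    then have t\<pi>: "path_time x \<pi> \<le> path_time x \<gamma>" using time_p q1(2) q2(2) by linarith
    define k where "k = length \<pi> - 1"
    have k: "length \<pi> = Suc k" by (simp add: k_def \<pi>_def)
    have kL: "k < L" using p(3) k by (simp add: p_eq \<pi>_def)
    have "exp (real k - s * path_time x \<pi>) \<le> walk_sum s L R x"
      using lattice_path_in_walks[OF path\<pi>] by (intro walk_sum_ge[OF R(1) a(2) _ dist\<pi> kL]) (simp add: k_def)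
    then have w: "real k - s * path_time x \<pi> \<le> ln (walk_sum s L R x)"
      using W1 by (simp add: ln_ge_iff)
    have "exp (\<delta> * path_time x \<gamma>) \<le> detour_sum \<delta> R x"
      unfolding \<gamma>_def by (intro detour_sum_ge R a(2) b(2))
    then have "\<delta> * path_time x \<gamma> \<le> ln (detour_sum \<delta> R x)" using D1 by (simp add: ln_ge_iff)
    then have g: "path_time x \<gamma> \<le> ln (detour_sum \<delta> R x) / \<delta>" using s by (simp add: field_simps)
    have "s * path_time x \<pi> \<le> s * (ln (detour_sum \<delta> R x) / \<delta>)"
      using t\<pi> g s by (intro mult_left_mono) auto
    then have klen: "real k \<le> s / \<delta> * ln (detour_sum \<delta> R x) + ln (walk_sum s L R x)" using w by simp
    have "set p \<inter> R \<subseteq> set \<pi>" using a(3) b(3) by (auto simp: p_eq \<pi>_def)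
    then have "card (set p \<inter> R) \<le> card (set \<pi>)" by (intro card_mono) auto
    also have "\<dots> \<le> Suc k" using card_length[of \<pi>] k by simp
    finally have "real (card (set p \<inter> R)) \<le> 1 + real k" by simp
    then show ?thesis using klen by (simp add: p_def)
  qed
qed


section \<open>Exponential moments of path times\<close>

lemma borel_measurable_Min_image:
  fixes f :: "'i \<Rightarrow> 'a \<Rightarrow> real"
  assumes "finite I" "I \<noteq> {}" "\<And>i. i \<in> I \<Longrightarrow> f i \<in> borel_measurable M"
  shows "(\<lambda>x. Min ((\<lambda>i. f i x) ` I)) \<in> borel_measurable M"
  using assms
proof (induction rule: finite_ne_induct)
  case (insert i I)
  then have "(\<lambda>x. min (f i x) (Min ((\<lambda>i. f i x) ` I))) \<in> borel_measurable M" by simp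
  moreover have "Min ((\<lambda>i. f i x) ` insert i I) = min (f i x) (Min ((\<lambda>i. f i x) ` I))" for x
    using insert by simp
  ultimately show ?case by simp
qed simp

lemma borel_measurable_path_time:
  assumes "distinct p" "\<And>e. e \<in> set (path_edges p) \<Longrightarrow> (\<lambda>x. x e) \<in> borel_measurable M"
  shows "(\<lambda>x. path_time x p) \<in> borel_measurable M"
  using assms by (simp add: path_time_distinct)

lemma borel_measurable_short_time:
  assumes "l1_norm v < int L"
    and "\<And>p e. p \<in> short_paths L v \<Longrightarrow> e \<in> set (path_edges p) \<Longrightarrow> (\<lambda>x. g x e) \<in> borel_measurable M"
  shows "(\<lambda>x. short_time L v (g x)) \<in> borel_measurable M"
  unfolding short_time_def
proof (rule borel_measurable_Min_image)
  fix p assume p: "p \<in> short_paths L v"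
  then have "distinct p" by (simp add: short_paths_def)
  then show "(\<lambda>x. path_time (g x) p) \<in> borel_measurable M"
    using assms(2)[OF p] by (simp add: path_time_distinct)
qed (use finite_short_paths short_paths_nonempty[OF assms(1)] in auto)

lemma tendsto_Min_image:
  fixes f :: "nat \<Rightarrow> 'i \<Rightarrow> real"
  assumes "finite I" "I \<noteq> {}" "\<And>i. i \<in> I \<Longrightarrow> (\<lambda>n. f n i) \<longlonglongrightarrow> l i"
  shows "(\<lambda>n. Min (f n ` I)) \<longlonglongrightarrow> Min (l ` I)"
  using assms
proof (induction rule: finite_ne_induct)
  case (insert i I)
  then have "(\<lambda>n. min (f n i) (Min (f n ` I))) \<longlonglongrightarrow> min (l i) (Min (l ` I))"
    by (intro tendsto_min) auto
  then show ?case using insert by simp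
qed simp

lemma path_time_tendsto:
  assumes "\<And>e. (\<lambda>n. X n e) \<longlonglongrightarrow> x e"
  shows "(\<lambda>n. path_time (X n) p) \<longlonglongrightarrow> path_time x p"
proof -
  have "(\<lambda>n. sum_list (map (X n) es)) \<longlonglongrightarrow> sum_list (map x es)" for es
    by (induction es) (auto intro!: tendsto_add assms)
  then show ?thesis by (simp add: path_time_def)
qed

lemma short_time_seq_continuous:
  assumes "l1_norm v < int L" "\<And>e. (\<lambda>n. X n e) \<longlonglongrightarrow> x e"
  shows "(\<lambda>n. short_time L v (X n)) \<longlonglongrightarrow> short_time L v x"
  unfolding short_time_def
  using finite_short_paths short_paths_nonempty[OF assms(1)]
  by (intro tendsto_Min_image path_time_tendsto assms(2)) auto

lemma path_time_cong: "(\<And>e. e \<in> set (path_edges p) \<Longrightarrow> x e = y e) \<Longrightarrow> path_time x p = path_time y p"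
  unfolding path_time_def by (intro arg_cong[where f=sum_list] map_cong) auto

lemma short_time_cong:
  assumes "\<And>p e. p \<in> short_paths L v \<Longrightarrow> e \<in> set (path_edges p) \<Longrightarrow> x e = y e"
  shows "short_time L v x = short_time L v y" "short_geodesic L v x = short_geodesic L v y"
proof -
  have eq: "path_time x p = path_time y p" if "p \<in> short_paths L v" for p
    using assms[OF that] by (rule path_time_cong)
  then show *: "short_time L v x = short_time L v y"
    unfolding short_time_def by (intro arg_cong[where f=Min] image_cong) auto
  have "(\<lambda>p. p \<in> short_paths L v \<and> path_time x p = short_time L v x)
      = (\<lambda>p. p \<in> short_paths L v \<and> path_time y p = short_time L v y)"
    using eq * by auto
  then show "short_geodesic L v x = short_geodesic L v y" by (simp add: short_geodesic_def)
qed

locale edge_weights = prob_space \<nu> for \<nu> :: "real measure" +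
  assumes space_nu: "space \<nu> = {0..}" and id_measurable: "(\<lambda>x. x) \<in> borel_measurable \<nu>"
    and no_atom: "AE y in \<nu>. y \<noteq> 0"
begin

lemma prob_space_edge_measure: "prob_space (edge_measure \<nu>)"
  unfolding edge_measure_def by (intro prob_space_PiM prob_space_axioms)

lemma weight_nonneg: "x \<in> space (edge_measure \<nu>) \<Longrightarrow> e \<in> lattice_edges \<Longrightarrow> 0 \<le> x e"
  by (auto simp: edge_measure_def space_PiM space_nu PiE_def Pi_def)

lemma weight_measurable: "e \<in> lattice_edges \<Longrightarrow> (\<lambda>x. x e) \<in> borel_measurable (edge_measure \<nu>)"
  unfolding edge_measure_def
  by (rule measurable_compose[where g="\<lambda>x. x", OF _ id_measurable]) (rule measurable_component_singleton)

lemma path_time_measurable: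
  assumes "lattice_path u p v" "distinct p"
  shows "(\<lambda>x. path_time x p) \<in> borel_measurable (edge_measure \<nu>)"
  using lattice_path_edges[OF assms(1)] assms(2)
  by (intro borel_measurable_path_time weight_measurable) auto

lemma shift_weight_measurable:
  "e \<in> lattice_edges \<Longrightarrow> (\<lambda>x. shift_weights z x e) \<in> borel_measurable (edge_measure \<nu>)"
  unfolding shift_weights_def by (intro weight_measurable shift_lattice_edges)

lemma shift_weight_nonneg:
  "x \<in> space (edge_measure \<nu>) \<Longrightarrow> e \<in> lattice_edges \<Longrightarrow> 0 \<le> shift_weights z x e"
  unfolding shift_weights_def by (intro weight_nonneg shift_lattice_edges)

lemma short_time_shift_measurable:
  assumes "l1_norm v < int L"
  shows "(\<lambda>x. short_time L v (shift_weights z x)) \<in> borel_measurable (edge_measure \<nu>)"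
  using assms lattice_path_edges
  by (intro borel_measurable_short_time shift_weight_measurable) (auto simp: short_paths_def)

lemma passage_time_measurable: "(\<lambda>x. passage_time (shift_weights z x) 0 v) \<in> borel_measurable (edge_measure \<nu>)"
proof (rule borel_measurable_LIMSEQ_real)
  show "(\<lambda>x. short_time (L + Suc (nat (l1_norm v))) v (shift_weights z x)) \<in> borel_measurable (edge_measure \<nu>)" for L
    by (rule short_time_shift_measurable) (use l1_norm_nonneg[of v] in linarith)
  show "(\<lambda>L. short_time (L + Suc (nat (l1_norm v))) v (shift_weights z x)) \<longlonglongrightarrow> passage_time (shift_weights z x) 0 v"
    if "x \<in> space (edge_measure \<nu>)" for x
    using that by (intro LIMSEQ_ignore_initial_segment short_time_tendsto shift_weight_nonneg)
qed

text \<open>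
  The edges of a loop-free path are distinct, so the exponential factorises into independent factors.
\<close>

lemma exp_path_time_integral:
  fixes p :: "(int ^ 'd::finite) list"
  assumes p: "lattice_path u p v" "distinct p" and int: "integrable \<nu> (\<lambda>y. exp (c * y))"
  shows "integrable (edge_measure \<nu>) (\<lambda>x. exp (c * path_time x p))"
    and "(LINT x|edge_measure \<nu>. exp (c * path_time x p)) = (LINT y|\<nu>. exp (c * y)) ^ (length p - 1)"
proof -
  define J where "J = set (path_edges p)"
  have J: "finite J" "J \<subseteq> lattice_edges" using lattice_path_edges[OF p(1)] by (auto simp: J_def)
  have cardJ: "card J = length p - 1"
    unfolding J_def by (simp add: distinct_card distinct_path_edges p(2) length_path_edges)
  interpret P: product_prob_space "\<lambda>_. \<nu>" lattice_edges
    by (rule product_prob_spaceI) (rule prob_space_axioms)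
  define f where "f x = (\<Prod>e\<in>J. exp (c * x e))" for x :: "(int ^ 'd) set \<Rightarrow> real"
  have f_eq: "exp (c * path_time x p) = f x" for x
    by (simp add: path_time_distinct[OF p(2)] J_def[symmetric] f_def exp_sum[OF J(1), symmetric] sum_distrib_left)
  have f_restrict: "f (restrict x J) = f x" for x unfolding f_def by (intro prod.cong) auto
  have r: "(\<lambda>x. restrict x J) \<in> PiM lattice_edges (\<lambda>_. \<nu>) \<rightarrow>\<^sub>M PiM J (\<lambda>_. \<nu>)"
    by (rule measurable_restrict_subset[OF J(2)])
  have intJ: "integrable (PiM J (\<lambda>_. \<nu>)) f" unfolding f_def
    by (rule P.product_integrable_prod[OF J(1)]) (rule int)
  have D: "distr (PiM lattice_edges (\<lambda>_. \<nu>)) (PiM J (\<lambda>_. \<nu>)) (\<lambda>x. restrict x J) = PiM J (\<lambda>_. \<nu>)"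
    by (rule P.distr_PiM_restrict_finite[OF J])
  have "integrable (PiM lattice_edges (\<lambda>_. \<nu>)) (\<lambda>x. f (restrict x J))"
    by (rule integrable_distr[OF r]) (simp only: D intJ)
  then show "integrable (edge_measure \<nu>) (\<lambda>x. exp (c * path_time x p))"
    by (simp add: edge_measure_def f_eq f_restrict)
  have "(LINT x|PiM J (\<lambda>_. \<nu>). f x) = (LINT x|PiM lattice_edges (\<lambda>_. \<nu>). f (restrict x J))"
    using integral_distr[OF r borel_measurable_integrable[OF intJ]] by (simp only: D)
  then have "(LINT x|edge_measure \<nu>. exp (c * path_time x p)) = (LINT x|PiM J (\<lambda>_. \<nu>). f x)"
    by (simp add: edge_measure_def f_eq f_restrict)
  also have "\<dots> = (\<Prod>e\<in>J. LINT y|\<nu>. exp (c * y))"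
    unfolding f_def by (rule P.product_integral_prod[OF J(1)]) (rule int)
  finally show "(LINT x|edge_measure \<nu>. exp (c * path_time x p)) = (LINT y|\<nu>. exp (c * y)) ^ (length p - 1)"
    by (simp add: cardJ)
qed

lemma exp_integral_ge_1:
  assumes "integrable \<nu> (\<lambda>y. exp (c * y))" "0 \<le> c"
  shows "1 \<le> (LINT y|\<nu>. exp (c * y))"
proof -
  have "(LINT y|\<nu>. 1) \<le> (LINT y|\<nu>. exp (c * y))"
    using assms by (intro integral_mono_AE AE_I2) (auto simp: space_nu)
  then show ?thesis by (simp add: prob_space)
qed

lemma exp_neg_integrable: "0 \<le> s \<Longrightarrow> integrable \<nu> (\<lambda>y. exp (- s * y))"
proof (rule integrable_const_bound[where B=1])
  show "(\<lambda>y. exp (- s * y)) \<in> borel_measurable \<nu>" using id_measurable by measurable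
qed (auto simp: space_nu)

text \<open>
  The weights are almost surely positive, so \<open>exp (- s y)\<close> tends to \<open>0\<close> as \<open>s\<close> grows. This beats the
  exponential number of walks.
\<close>

lemma small_laplace_transform:
  assumes "0 < \<epsilon>"
  shows "\<exists>s\<ge>0. (LINT y|\<nu>. exp (- s * y)) \<le> \<epsilon>"
proof -
  have "(\<lambda>n. LINT y|\<nu>. exp (- real n * y)) \<longlonglongrightarrow> (LINT y|\<nu>. 0)"
  proof (rule integral_dominated_convergence[where w="\<lambda>_. 1"])
    show "(\<lambda>y. exp (- real n * y)) \<in> borel_measurable \<nu>" for n using id_measurable by measurable
    show "AE y in \<nu>. (\<lambda>n. exp (- real n * y)) \<longlonglongrightarrow> 0"
      using no_atom AE_space
    proof eventually_elim
      case (elim y)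
      then have "0 < y" by (simp add: space_nu)
      then have "(\<lambda>n. exp (- y) ^ n) \<longlonglongrightarrow> 0" by (intro LIMSEQ_realpow_zero) auto
      then show ?case by (simp add: exp_of_nat_mult[symmetric])
    qed
  qed (auto simp: space_nu)
  then have "\<forall>\<^sub>F n in sequentially. (LINT y|\<nu>. exp (- real n * y)) < \<epsilon>"
    using assms by (intro order_tendstoD) auto
  then obtain n where "(LINT y|\<nu>. exp (- real n * y)) < \<epsilon>"
    by (meson eventually_happens sequentially_bot)
  then show ?thesis by (intro exI[of _ "real n"]) simp
qed

lemma detour_sum_integral:
  fixes R :: "(int ^ 'd::finite) set"
  assumes "finite R" "0 \<le> \<delta>" "integrable \<nu> (\<lambda>y. exp (\<delta> * y))"
    and r: "\<And>a b. a \<in> R \<Longrightarrow> b \<in> R \<Longrightarrow> l1_norm (b - a) \<le> int r"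
  shows "integrable (edge_measure \<nu>) (detour_sum \<delta> R)"
    and "(LINT x|edge_measure \<nu>. detour_sum \<delta> R x) \<le> (real (card R))\<^sup>2 * (LINT y|\<nu>. exp (\<delta> * y)) ^ r"
proof -
  note E = exp_path_time_integral[OF shortest_path(1,2) assms(3)]
  show "integrable (edge_measure \<nu>) (detour_sum \<delta> R)"
    unfolding detour_sum_def by (intro Bochner_Integration.integrable_sum E)
  have "(LINT x|edge_measure \<nu>. detour_sum \<delta> R x)
    = (\<Sum>a\<in>R. \<Sum>b\<in>R. (LINT y|\<nu>. exp (\<delta> * y)) ^ (length (shortest_path a b) - 1))"
    unfolding detour_sum_def by (subst Bochner_Integration.integral_sum; (intro Bochner_Integration.integrable_sum E)?)
      (subst Bochner_Integration.integral_sum; simp add: E)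
  also have "\<dots> \<le> (\<Sum>a\<in>R. \<Sum>b\<in>R. (LINT y|\<nu>. exp (\<delta> * y)) ^ r)"
  proof (intro sum_mono power_increasing)
    fix a b assume "a \<in> R" "b \<in> R"
    then show "length (shortest_path a b) - 1 \<le> r" using shortest_path(3)[of a b] r[of a b] by linarith
  qed (use exp_integral_ge_1[OF assms(3,2)] in auto)
  also have "\<dots> = (real (card R))\<^sup>2 * (LINT y|\<nu>. exp (\<delta> * y)) ^ r" by (simp add: power2_eq_square)
  finally show "(LINT x|edge_measure \<nu>. detour_sum \<delta> R x) \<le> (real (card R))\<^sup>2 * (LINT y|\<nu>. exp (\<delta> * y)) ^ r" .
qed

text \<open>
  There are at most \<open>n ^ k\<close> walks with \<open>k\<close> edges from a given vertex, where \<open>n\<close> is the number of unit steps, and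
  each contributes \<open>(exp 1 * E exp (- s y)) ^ k\<close> to the mean. The choice of \<open>s\<close> makes the sum over \<open>k\<close> a
  geometric series with ratio at most \<open>1 / 2\<close>.
\<close>

lemma walk_sum_integral:
  fixes R :: "(int ^ 'd::finite) set"
  assumes "finite R" "0 \<le> s"
    and s: "real (card (unit_steps :: (int ^ 'd) set)) * exp 1 * (LINT y|\<nu>. exp (- s * y)) \<le> 1 / 2"
  shows "integrable (edge_measure \<nu>) (walk_sum s L R)"
    and "(LINT x|edge_measure \<nu>. walk_sum s L R x) \<le> 2 * real (card R)"
proof -
  define \<rho> where "\<rho> = (LINT y|\<nu>. exp (- s * y))"
  define n where "n = real (card (unit_steps :: (int ^ 'd) set))"
  have \<rho>: "0 \<le> \<rho>" by (simp add: \<rho>_def)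
  have E: "integrable (edge_measure \<nu>) (\<lambda>x. exp (real k - s * path_time x p))"
    "(LINT x|edge_measure \<nu>. exp (real k - s * path_time x p)) = (exp 1 * \<rho>) ^ k"
    if "p \<in> {p \<in> walks a k. distinct p}" for p k and a :: "int ^ 'd"
  proof -
    have p: "lattice_path a p (last p)" "distinct p" "length p - 1 = k"
      using that walks_lattice_path by (auto simp: walks_def)
    note F = exp_path_time_integral[OF p(1,2) exp_neg_integrable[OF assms(2)]]
    have eq: "exp (real k - s * path_time x p) = exp 1 ^ k * exp (- s * path_time x p)" for x
      by (simp add: exp_of_nat_mult[symmetric] exp_add[symmetric])
    show "integrable (edge_measure \<nu>) (\<lambda>x. exp (real k - s * path_time x p))"
      unfolding eq by (intro integrable_mult_right F)
    show "(LINT x|edge_measure \<nu>. exp (real k - s * path_time x p)) = (exp 1 * \<rho>) ^ k"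
      unfolding eq by (simp only: integral_mult_right_zero F(2) p(3) \<rho>_def power_mult_distrib)
  qed
  have fin: "finite {p \<in> walks a k. distinct p}" for a :: "int ^ 'd" and k using card_walks_le[of a k] by simp
  show int: "integrable (edge_measure \<nu>) (walk_sum s L R)"
    unfolding walk_sum_def by (intro Bochner_Integration.integrable_sum E)
  have geo: "(\<Sum>k<L. (1/2 :: real) ^ k) \<le> 2"
    using sum_le_suminf[OF summable_geometric[of "1/2 :: real"], of "{..<L}"] suminf_geometric[of "1/2 :: real"]
    by simp
  have E1: "integrable (edge_measure \<nu>) (\<lambda>x. \<Sum>p\<in>{p \<in> walks a k. distinct p}. exp (real k - s * path_time x p))"
    for a :: "int ^ 'd" and k by (intro Bochner_Integration.integrable_sum E)
  have E2: "(LINT x|edge_measure \<nu>. (\<Sum>p\<in>{p \<in> walks a k. distinct p}. exp (real k - s * path_time x p)))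
      = real (card {p \<in> walks a k. distinct p}) * (exp 1 * \<rho>) ^ k" for a :: "int ^ 'd" and k
  proof -
    have "(LINT x|edge_measure \<nu>. (\<Sum>p\<in>{p \<in> walks a k. distinct p}. exp (real k - s * path_time x p)))
      = (\<Sum>p\<in>{p \<in> walks a k. distinct p}. LINT x|edge_measure \<nu>. exp (real k - s * path_time x p))"
      by (rule Bochner_Integration.integral_sum) (rule E(1))
    also have "\<dots> = (\<Sum>p\<in>{p \<in> walks a k. distinct p}. (exp 1 * \<rho>) ^ k)"
      by (intro sum.cong refl) (rule E(2))
    finally show ?thesis by simp
  qed
  have "(LINT x|edge_measure \<nu>. walk_sum s L R x)
    = (\<Sum>a\<in>R. LINT x|edge_measure \<nu>. (\<Sum>k<L. \<Sum>p\<in>{p \<in> walks a k. distinct p}. exp (real k - s * path_time x p)))"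
    unfolding walk_sum_def
    by (rule Bochner_Integration.integral_sum) (intro Bochner_Integration.integrable_sum E1)
  also have "\<dots> = (\<Sum>a\<in>R. \<Sum>k<L. LINT x|edge_measure \<nu>. (\<Sum>p\<in>{p \<in> walks a k. distinct p}. exp (real k - s * path_time x p)))"
    by (intro sum.cong refl Bochner_Integration.integral_sum E1)
  also have "\<dots> = (\<Sum>a\<in>R. \<Sum>k<L. real (card {p \<in> walks a k. distinct p}) * (exp 1 * \<rho>) ^ k)"
    by (simp only: E2)
  also have "\<dots> \<le> (\<Sum>a\<in>R. \<Sum>k<L. (1/2) ^ k)"
  proof (intro sum_mono)
    fix a :: "int ^ 'd" and k
    have "card {p \<in> walks a k. distinct p} \<le> card (walks a k)"
      using card_walks_le[of a k] by (intro card_mono) auto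
    then have "card {p \<in> walks a k. distinct p} \<le> card (unit_steps :: (int ^ 'd) set) ^ k"
      using card_walks_le[of a k] by linarith
    then have "real (card {p \<in> walks a k. distinct p}) \<le> n ^ k"
      unfolding n_def by (metis of_nat_le_iff of_nat_power)
    then have "real (card {p \<in> walks a k. distinct p}) * (exp 1 * \<rho>) ^ k \<le> n ^ k * (exp 1 * \<rho>) ^ k"
      using \<rho> by (intro mult_right_mono) auto
    also have "\<dots> = (n * exp 1 * \<rho>) ^ k" by (simp add: power_mult_distrib)
    also have "\<dots> \<le> (1/2) ^ k" using s \<rho> by (intro power_mono) (auto simp: n_def \<rho>_def)
    finally show "real (card {p \<in> walks a k. distinct p}) * (exp 1 * \<rho>) ^ k \<le> (1/2) ^ k" .
  qed
  also have "\<dots> \<le> (\<Sum>a\<in>R. 2)" by (intro sum_mono geo)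
  finally show "(LINT x|edge_measure \<nu>. walk_sum s L R x) \<le> 2 * real (card R)" by simp
qed

end

text \<open>
  Jensen's inequality for the logarithm, from the tangent line \<open>ln y \<le> ln c + y / c - 1\<close> at \<open>c\<close>.
\<close>

lemma (in prob_space) expectation_ln_le:
  fixes Y :: "'a \<Rightarrow> real"
  assumes int: "integrable M Y" and Y: "\<And>x. x \<in> space M \<Longrightarrow> 1 \<le> Y x" and c: "expectation Y \<le> c"
  shows "integrable M (\<lambda>x. ln (Y x))" "expectation (\<lambda>x. ln (Y x)) \<le> ln c"
proof -
  have "expectation (\<lambda>x. 1) \<le> expectation Y" using int Y by (intro integral_mono_AE AE_I2) auto
  then have c1: "1 \<le> c" using c by (simp add: prob_space)
  have [measurable]: "Y \<in> borel_measurable M" using int by simp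
  show i: "integrable M (\<lambda>x. ln (Y x))"
  proof (rule Bochner_Integration.integrable_bound[OF int])
    show "AE x in M. norm (ln (Y x)) \<le> norm (Y x)"
    proof (rule AE_I2)
      fix x assume "x \<in> space M"
      then have "1 \<le> Y x" by (rule Y)
      then show "norm (ln (Y x)) \<le> norm (Y x)" using ln_le_minus_one[of "Y x"] by simp
    qed
  qed measurable
  have "expectation (\<lambda>x. ln (Y x)) \<le> expectation (\<lambda>x. ln c + Y x / c - 1)"
  proof (intro integral_mono_AE AE_I2 i)
    fix x assume "x \<in> space M"
    then have "1 \<le> Y x" by (rule Y)
    then show "ln (Y x) \<le> ln c + Y x / c - 1"
      using ln_le_minus_one[of "Y x / c"] c1 by (simp add: ln_div)
  qed (use int in auto)
  also have "\<dots> = ln c + expectation Y / c - 1" using int by (simp add: prob_space)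
  also have "\<dots> \<le> ln c" using c c1 by (simp add: field_simps)
  finally show "expectation (\<lambda>x. ln (Y x)) \<le> ln c" .
qed


section \<open>The passage time averaged over translations\<close>

definition lattice_box :: "nat \<Rightarrow> (int ^ 'd::finite) set" where
  "lattice_box m = {z. \<forall>i. z $ i \<in> {0..<int m}}"

lemma finite_box: "finite (lattice_box m)"
  unfolding lattice_box_def by (rule finite_vec_box) simp

lemma card_box: "card (lattice_box m :: (int ^ 'd::finite) set) = m ^ CARD('d)"
  unfolding lattice_box_def by (subst finite_vec_box) simp_all

lemma zero_in_box: "0 < m \<Longrightarrow> 0 \<in> lattice_box m"
  by (simp add: lattice_box_def)

lemma l1_norm_box_diff:
  fixes z w :: "int ^ 'd::finite"
  assumes "z \<in> lattice_box m" "w \<in> lattice_box m"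
  shows "l1_norm (z - w) \<le> int (CARD('d) * m)"
proof -
  have "l1_norm (z - w) \<le> (\<Sum>i\<in>(UNIV :: 'd set). int m)"
    unfolding l1_norm_def
  proof (rule sum_mono)
    fix i
    have "z $ i \<in> {0..<int m}" "w $ i \<in> {0..<int m}" using assms by (auto simp: lattice_box_def)
    then show "\<bar>(z - w) $ i\<bar> \<le> int m" by auto
  qed
  then show ?thesis by simp
qed

definition path_support :: "nat \<Rightarrow> int ^ 'd::finite \<Rightarrow> (int ^ 'd) set set" where
  "path_support L v = (\<Union>p\<in>short_paths L v. set (path_edges p))"

lemma path_support: "finite (path_support L v)" "path_support L v \<subseteq> lattice_edges"
  using finite_short_paths lattice_path_edges by (auto simp: path_support_def short_paths_def)

definition box_support :: "nat \<Rightarrow> int ^ 'd::finite \<Rightarrow> nat \<Rightarrow> (int ^ 'd) set set" where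
  "box_support L v m = (\<Union>z\<in>lattice_box m. (\<lambda>e. (+) z ` e) ` path_support L v)"

lemma box_support: "finite (box_support L v m)" "box_support L v m \<subseteq> lattice_edges"
  using path_support[of L v] finite_box shift_lattice_edges by (auto simp: box_support_def)

text \<open>
  The geodesic from \<open>z\<close> to \<open>z + v\<close> is chosen as the translate of the geodesic from \<open>0\<close> to \<open>v\<close> in the
  shifted weights. Geodesics need not be unique, and this choice makes the selection commute with translations.
\<close>

definition box_opt where
  "box_opt L v z x = (\<lambda>e. (+) z ` e) ` set (path_edges (short_geodesic L v (shift_weights z x)))"

lemma box_opt_subset:
  assumes "l1_norm v < int L" "z \<in> lattice_box m"
  shows "box_opt L v z x \<subseteq> box_support L v m"
  using short_geodesic(1)[OF assms(1), of "shift_weights z x"] assms(2)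
  by (auto simp: box_opt_def box_support_def path_support_def)

lemma sum_box_opt: "(\<Sum>e\<in>box_opt L v z x. y e) = (\<Sum>e\<in>set (path_edges (short_geodesic L v (shift_weights z x))). shift_weights z y e)"
  unfolding box_opt_def shift_weights_def by (subst sum.reindex[OF inj_shift_edges]) simp

lemma optimal_sets_box:
  fixes v :: "int ^ 'd::finite"
  assumes L: "l1_norm v < int L" and E: "finite E" "box_support L v m \<subseteq> E" and "0 < m" "0 \<le> K"
  shows "optimal_sets E (lattice_box m) K (box_opt L v) (\<lambda>z x. short_time L v (shift_weights z x))"
proof
  show "finite E" "finite (lattice_box m :: (int ^ 'd) set)" "(lattice_box m :: (int ^ 'd) set) \<noteq> {}" "0 \<le> K"
    using assms finite_box zero_in_box by auto
  fix z :: "int ^ 'd" and x y assume z: "z \<in> lattice_box m"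
  note g = short_geodesic[OF L, of "shift_weights z x"]
  have dist: "distinct (short_geodesic L v (shift_weights z x))" using g(1) by (simp add: short_paths_def)
  show "box_opt L v z x \<subseteq> E" using box_opt_subset[OF L z] E(2) by blast
  show "short_time L v (shift_weights z x) = (\<Sum>e\<in>box_opt L v z x. x e)"
    unfolding sum_box_opt path_time_distinct[OF dist, symmetric] g(2) ..
  show "short_time L v (shift_weights z y) \<le> (\<Sum>e\<in>box_opt L v z x. y e)"
    unfolding sum_box_opt path_time_distinct[OF dist, symmetric] by (rule short_time_le[OF g(1)])
qed

text \<open>
  Translation invariance, read on a finite cube: both averages only involve the signs of finitely many edges, and
  the translation permutes blocks of signs.
\<close>

lemma cube_avg_shift:
  fixes z :: "int ^ 'd::finite" and E :: "(int ^ 'd) set set"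
  assumes E: "finite E" "S \<subseteq> E" "(\<lambda>e. (+) z ` e) ` S \<subseteq> E"
    and dep: "\<And>x y. (\<And>e. e \<in> S \<Longrightarrow> x e = y e) \<Longrightarrow> \<phi> x = \<phi> y"
  shows "cube_avg (E \<times> {..<N}) (\<lambda>\<omega>. \<phi> (shift_weights z (\<lambda>e. U (signsum N \<omega> e))))
    = cube_avg (E \<times> {..<N}) (\<lambda>\<omega>. \<phi> (\<lambda>e. U (signsum N \<omega> e)))"
proof -
  define h where "h = (\<lambda>(e :: (int ^ 'd) set, l :: nat). ((+) z ` e, l))"
  have fin: "finite (E \<times> {..<N})" using E(1) by simp
  have inj: "inj h" by (auto simp: inj_on_def h_def inj_image_eq_iff)
  have S: "S \<times> {..<N} \<subseteq> E \<times> {..<N}" "h ` (S \<times> {..<N}) \<subseteq> E \<times> {..<N}"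
    using E(2,3) by (auto simp: h_def)
  have "cube_avg (E \<times> {..<N}) (\<lambda>\<omega>. \<phi> (shift_weights z (\<lambda>e. U (signsum N \<omega> e))))
      = cube_avg (h ` (S \<times> {..<N})) (\<lambda>\<omega>. \<phi> (shift_weights z (\<lambda>e. U (signsum N \<omega> e))))"
  proof (rule cube_avg_marginal[OF fin S(2)])
    fix A B assume AB: "A \<inter> h ` (S \<times> {..<N}) = B \<inter> h ` (S \<times> {..<N})"
    show "\<phi> (shift_weights z (\<lambda>e. U (signsum N A e))) = \<phi> (shift_weights z (\<lambda>e. U (signsum N B e)))"
    proof (rule dep)
      fix e assume e: "e \<in> S"
      have "signsum N A ((+) z ` e) = signsum N B ((+) z ` e)"
      proof (rule signsum_cong)
        fix l assume "l < N"
        then have "((+) z ` e, l) \<in> h ` (S \<times> {..<N})" using e by (force simp: h_def)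
        then show "((+) z ` e, l) \<in> A \<longleftrightarrow> ((+) z ` e, l) \<in> B" using AB by blast
      qed
      then show "shift_weights z (\<lambda>e. U (signsum N A e)) e = shift_weights z (\<lambda>e. U (signsum N B e)) e"
        by (simp add: shift_weights_def)
    qed
  qed
  also have "\<dots> = cube_avg (S \<times> {..<N}) (\<lambda>\<omega>. \<phi> (shift_weights z (\<lambda>e. U (signsum N (h ` \<omega>) e))))"
    by (rule cube_avg_reindex) (rule inj_on_subset[OF inj subset_UNIV])
  also have "\<dots> = cube_avg (S \<times> {..<N}) (\<lambda>\<omega>. \<phi> (\<lambda>e. U (signsum N \<omega> e)))"
  proof -
    have "signsum N (h ` \<omega>) ((+) z ` e) = signsum N \<omega> e" for \<omega> e
    proof -
      have "((+) z ` e, l) \<in> h ` \<omega> \<longleftrightarrow> (e, l) \<in> \<omega>" for l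
        using inj_image_mem_iff[OF inj, of "(e, l)" \<omega>] by (simp add: h_def)
      then show ?thesis by (simp add: signsum_def)
    qed
    then show ?thesis by (simp add: shift_weights_def[abs_def])
  qed
  also have "\<dots> = cube_avg (E \<times> {..<N}) (\<lambda>\<omega>. \<phi> (\<lambda>e. U (signsum N \<omega> e)))"
  proof (rule cube_avg_marginal[OF fin S(1), symmetric])
    fix A B assume AB: "A \<inter> S \<times> {..<N} = B \<inter> S \<times> {..<N}"
    show "\<phi> (\<lambda>e. U (signsum N A e)) = \<phi> (\<lambda>e. U (signsum N B e))"
    proof (rule dep)
      fix e assume e: "e \<in> S"
      have "signsum N A e = signsum N B e" using AB e by (intro signsum_cong) blast
      then show "U (signsum N A e) = U (signsum N B e)" by simp
    qed
  qed
  finally show ?thesis .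
qed

text \<open>
  The bound of \<open>card_geodesic_inter_le\<close>, as a function of the weights. In contrast to the number of visits it is
  continuous, and this is what makes it accessible to \<open>cube_avg_limit\<close>.
\<close>

definition visit_bound where
  "visit_bound s \<delta> L R x = 1 + s / \<delta> * ln (detour_sum \<delta> R x) + ln (walk_sum s L R x)"

definition visit_support :: "nat \<Rightarrow> (int ^ 'd::finite) set \<Rightarrow> (int ^ 'd) set set" where
  "visit_support L R = (\<Union>a\<in>R. \<Union>b\<in>R. set (path_edges (shortest_path a b)))
    \<union> (\<Union>a\<in>R. \<Union>k<L. \<Union>p\<in>walks a k. set (path_edges p))"

lemma visit_supportI:
  "a \<in> R \<Longrightarrow> b \<in> R \<Longrightarrow> e \<in> set (path_edges (shortest_path a b)) \<Longrightarrow> e \<in> visit_support L R"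
  "p \<in> {p \<in> walks a k. distinct p} \<Longrightarrow> a \<in> R \<Longrightarrow> k \<in> {..<L} \<Longrightarrow> e \<in> set (path_edges p) \<Longrightarrow> e \<in> visit_support L R"
  unfolding visit_support_def by blast+

lemma visit_support:
  assumes "finite R"
  shows "finite (visit_support L R)" "visit_support L R \<subseteq> lattice_edges"
proof -
  show "finite (visit_support L R)"
    unfolding visit_support_def using assms card_walks_le by blast
  show "visit_support L R \<subseteq> lattice_edges"
    using lattice_path_edges[OF shortest_path(1)] lattice_path_edges[OF walks_lattice_path]
    by (auto simp: visit_support_def)
qed

lemma visit_bound_cong:
  assumes "\<And>e. e \<in> visit_support L R \<Longrightarrow> x e = y e"
  shows "visit_bound s \<delta> L R x = visit_bound s \<delta> L R y"
proof -
  have "detour_sum \<delta> R x = detour_sum \<delta> R y"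
    unfolding detour_sum_def
    by (intro sum.cong refl arg_cong[where f="\<lambda>t. exp (\<delta> * t)"] path_time_cong assms visit_supportI(1))
  moreover have "walk_sum s L R x = walk_sum s L R y"
    unfolding walk_sum_def
    by (intro sum.cong refl arg_cong[where f="\<lambda>t. exp (_ - s * t)"] path_time_cong assms)
      (rule visit_supportI(2), assumption+)
  ultimately show ?thesis by (simp add: visit_bound_def)
qed

lemma visit_bound_measurable:
  assumes "\<And>e. e \<in> visit_support L R \<Longrightarrow> (\<lambda>x. x e) \<in> borel_measurable M"
  shows "visit_bound s \<delta> L R \<in> borel_measurable M"
proof -
  have 1: "(\<lambda>x. path_time x (shortest_path a b)) \<in> borel_measurable M" if "a \<in> R" "b \<in> R" for a b
    by (intro borel_measurable_path_time shortest_path assms visit_supportI(1)[OF that])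
  have 2: "(\<lambda>x. path_time x p) \<in> borel_measurable M" if "p \<in> {p \<in> walks a k. distinct p}" "a \<in> R" "k \<in> {..<L}" for a k p
    using that(1) by (intro borel_measurable_path_time assms visit_supportI(2)[OF that]) auto
  have "detour_sum \<delta> R \<in> borel_measurable M"
    unfolding detour_sum_def[abs_def]
    by (intro borel_measurable_sum borel_measurable_exp[THEN measurable_compose[rotated]] borel_measurable_times borel_measurable_const 1)
  moreover have "walk_sum s L R \<in> borel_measurable M"
    unfolding walk_sum_def[abs_def]
    by (intro borel_measurable_sum borel_measurable_exp[THEN measurable_compose[rotated]] borel_measurable_diff
        borel_measurable_times borel_measurable_const 2)
  ultimately show ?thesis unfolding visit_bound_def[abs_def] by measurable
qed

lemma visit_bound_tendsto:
  assumes R: "finite R" "R \<noteq> {}" and L: "0 < L" and \<delta>: "0 \<le> \<delta>"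
    and X: "\<And>e. (\<lambda>n. X n e) \<longlonglongrightarrow> x e" "\<And>n e. 0 \<le> X n e"
  shows "(\<lambda>n. visit_bound s \<delta> L R (X n)) \<longlonglongrightarrow> visit_bound s \<delta> L R x"
proof -
  have x: "0 \<le> x e" for e using X by (intro LIMSEQ_le_const[OF X(1)]) auto
  have "(\<lambda>n. detour_sum \<delta> R (X n)) \<longlonglongrightarrow> detour_sum \<delta> R x"
    unfolding detour_sum_def by (intro tendsto_intros path_time_tendsto X)
  moreover have "(\<lambda>n. walk_sum s L R (X n)) \<longlonglongrightarrow> walk_sum s L R x"
    unfolding walk_sum_def by (intro tendsto_intros path_time_tendsto X)
  moreover have "detour_sum \<delta> R x \<noteq> 0" using detour_sum_ge_1[OF R \<delta>, of x] x by auto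
  moreover have "walk_sum s L R x \<noteq> 0" using walk_sum_ge_1[OF R L, of s x] by auto
  ultimately show ?thesis unfolding visit_bound_def by (intro tendsto_intros)
qed

text \<open>
  The averaged passage time, truncated at \<open>K\<close> and computed with short paths only.
\<close>

definition box_time :: "nat \<Rightarrow> real \<Rightarrow> nat \<Rightarrow> int ^ 'd::finite \<Rightarrow> ((int ^ 'd) set \<Rightarrow> real) \<Rightarrow> real" where
  "box_time m K L v x = (\<Sum>z\<in>lattice_box m. min K (short_time L v (shift_weights z x))) / card (lattice_box m :: (int ^ 'd) set)"

lemma short_time_nonneg:
  assumes "l1_norm v < int L" "\<And>e. e \<in> lattice_edges \<Longrightarrow> 0 \<le> x e"
  shows "0 \<le> short_time L v x"
proof -
  have "lattice_path 0 (short_geodesic L v x) v"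
    using short_geodesic(1)[OF assms(1), of x] by (simp add: short_paths_def)
  then show ?thesis using path_time_nonneg[of 0 _ v x] assms(2) short_geodesic(2)[OF assms(1), of x] by metis
qed

lemma avg_abs_le:
  assumes "finite Z" "Z \<noteq> {}" "\<And>z. z \<in> Z \<Longrightarrow> \<bar>f z\<bar> \<le> (K :: real)"
  shows "\<bar>(\<Sum>z\<in>Z. f z) / card Z\<bar> \<le> K"
proof -
  have "\<bar>\<Sum>z\<in>Z. f z\<bar> \<le> (\<Sum>z\<in>Z. K)" using assms by (intro order_trans[OF sum_abs] sum_mono)
  then show ?thesis using assms by (simp add: divide_le_eq card_gt_0_iff mult.commute)
qed

lemma box_time_bounded:
  fixes v :: "int ^ 'd::finite"
  assumes "l1_norm v < int L" "0 < m" "0 \<le> K" "\<And>e. e \<in> lattice_edges \<Longrightarrow> 0 \<le> x e"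
  shows "\<bar>box_time m K L v x\<bar> \<le> K"
  unfolding box_time_def
proof (rule avg_abs_le[OF finite_box])
  show "(lattice_box m :: (int ^ 'd) set) \<noteq> {}" using zero_in_box assms by blast
  fix z :: "int ^ 'd" assume "z \<in> lattice_box m"
  have "0 \<le> short_time L v (shift_weights z x)"
    using assms by (intro short_time_nonneg) (auto simp: shift_weights_def shift_lattice_edges)
  then show "\<bar>min K (short_time L v (shift_weights z x))\<bar> \<le> K" using assms(3) by auto
qed

lemma box_time_measurable:
  fixes v :: "int ^ 'd::finite"
  assumes "l1_norm v < int L" "\<And>e. e \<in> box_support L v m \<Longrightarrow> (\<lambda>x. x e) \<in> borel_measurable M"
  shows "box_time m K L v \<in> borel_measurable M"
  unfolding box_time_def[abs_def]
proof (intro borel_measurable_divide borel_measurable_const borel_measurable_sum borel_measurable_min)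
  fix z :: "int ^ 'd" assume z: "z \<in> lattice_box m"
  show "(\<lambda>x. short_time L v (shift_weights z x)) \<in> borel_measurable M"
  proof (rule borel_measurable_short_time[OF assms(1)])
    fix p e assume "p \<in> short_paths L v" "e \<in> set (path_edges p)"
    then have "(+) z ` e \<in> box_support L v m" using z by (auto simp: box_support_def path_support_def)
    then show "(\<lambda>x. shift_weights z x e) \<in> borel_measurable M" unfolding shift_weights_def by (rule assms(2))
  qed
qed

lemma box_time_cong:
  fixes v :: "int ^ 'd::finite"
  assumes "\<And>e. e \<in> box_support L v m \<Longrightarrow> x e = y e"
  shows "box_time m K L v x = box_time m K L v y"
proof -
  have "short_time L v (shift_weights z x) = short_time L v (shift_weights z y)" if "z \<in> lattice_box m" for z :: "int ^ 'd"
    unfolding shift_weights_def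
    by (rule short_time_cong(1)) (use that assms in \<open>auto simp: box_support_def path_support_def\<close>)
  then show ?thesis unfolding box_time_def by (intro arg_cong2[where f="(/)"] sum.cong) auto
qed

lemma box_time_tendsto:
  fixes v :: "int ^ 'd::finite"
  assumes "l1_norm v < int L" "\<And>e. (\<lambda>n. X n e) \<longlonglongrightarrow> x e"
  shows "(\<lambda>n. box_time m K L v (X n)) \<longlonglongrightarrow> box_time m K L v x"
proof -
  have "(\<lambda>n. short_time L v (shift_weights z (X n))) \<longlonglongrightarrow> short_time L v (shift_weights z x)" for z :: "int ^ 'd"
    by (rule short_time_seq_continuous[OF assms(1)]) (simp add: shift_weights_def assms(2))
  then show ?thesis unfolding box_time_def
    by (cases "card (lattice_box m :: (int ^ 'd) set) = 0") (auto intro!: tendsto_intros)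
qed

locale transported_weights = edge_weights +
  fixes U :: "real \<Rightarrow> real" and A :: real
  assumes A_nonneg: "0 \<le> A" and U_nonneg: "\<And>s. 0 \<le> U s"
    and sqrt_U_lipschitz: "\<And>s t. \<bar>sqrt (U s) - sqrt (U t)\<bar> \<le> A * \<bar>s - t\<bar>"
    and U_law: "distr std_normal_distribution borel U = distr \<nu> borel (\<lambda>x. x)"
begin

lemma U_isCont: "isCont U s"
proof -
  have lim: "((\<lambda>t. A * \<bar>t - s\<bar>) \<longlongrightarrow> A * \<bar>s - s\<bar>) (at s)" by (intro tendsto_intros)
  have "((\<lambda>t. sqrt (U t) - sqrt (U s)) \<longlongrightarrow> 0) (at s)"
  proof (rule Lim_null_comparison)
    show "\<forall>\<^sub>F t in at s. norm (sqrt (U t) - sqrt (U s)) \<le> A * \<bar>t - s\<bar>"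
      using sqrt_U_lipschitz by (intro always_eventually) simp
    show "((\<lambda>t. A * \<bar>t - s\<bar>) \<longlongrightarrow> 0) (at s)" using lim by simp
  qed
  then have "isCont (\<lambda>t. sqrt (U t)) s" unfolding isCont_def by (rule LIM_zero_cancel)
  then have "isCont (\<lambda>t. (sqrt (U t))\<^sup>2) s" by (rule isCont_power)
  then show ?thesis by (simp add: U_nonneg)
qed

lemma cube_avg_tendsto_edge_measure:
  fixes \<Phi> :: "((int ^ 'd::finite) set \<Rightarrow> real) \<Rightarrow> real"
  assumes "finite E" "E \<subseteq> lattice_edges" "\<Phi> \<in> borel_measurable (PiM E (\<lambda>_. borel))"
    and "\<And>x. (\<And>e. 0 \<le> x e) \<Longrightarrow> \<bar>\<Phi> x\<bar> \<le> B"
    and "\<And>x y. (\<And>e. e \<in> E \<Longrightarrow> x e = y e) \<Longrightarrow> \<Phi> x = \<Phi> y"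
    and "\<And>X x. (\<And>e. (\<lambda>n. X n e) \<longlonglongrightarrow> x e) \<Longrightarrow> (\<And>n e. 0 \<le> X n e) \<Longrightarrow> (\<lambda>n. \<Phi> (X n)) \<longlonglongrightarrow> \<Phi> x"
  shows "(\<lambda>N. cube_avg (E \<times> {..<N}) (\<lambda>\<omega>. \<Phi> (\<lambda>e. U (signsum N \<omega> e)))) \<longlonglongrightarrow> (LINT x|edge_measure \<nu>. \<Phi> x)"
  unfolding edge_measure_def
  by (rule cube_avg_limit[OF prob_space_axioms id_measurable U_law U_isCont U_nonneg assms])

end


section \<open>Variances of exponentials of the averaged passage time\<close>

context transported_weights
begin

text \<open>
  The bound on the mean of \<open>visit_bound\<close> for a set of \<open>c\<close> vertices with diameter at most \<open>r\<close>.
\<close>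

definition visit_mean :: "real \<Rightarrow> real \<Rightarrow> nat \<Rightarrow> nat \<Rightarrow> real" where
  "visit_mean s \<delta> c r = 1 + s / \<delta> * ln ((real c)\<^sup>2 * (LINT y|\<nu>. exp (\<delta> * y)) ^ r) + ln (2 * real c)"

text \<open>
  The choice of \<open>s\<close> that makes the mean of \<open>walk_sum\<close> a convergent geometric series. The lattice occurs only
  through the number of unit steps, so the dimension is passed as a type.
\<close>

definition path_decay :: "'d::finite itself \<Rightarrow> real \<Rightarrow> bool" where
  "path_decay _ s \<longleftrightarrow> 0 \<le> s \<and>
    real (card (unit_steps :: (int ^ 'd) set)) * exp 1 * (LINT y|\<nu>. exp (- s * y)) \<le> 1 / 2"

text \<open>
  Both logarithms are estimated through the means of their arguments; therefore the mean number of visits to a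
  cube is only linear in its side length, up to logarithms.
\<close>

lemma visit_bound_integral:
  fixes R :: "(int ^ 'd::finite) set"
  assumes R: "finite R" "R \<noteq> {}" and L: "0 < L" and \<delta>: "0 < \<delta>" "integrable \<nu> (\<lambda>y. exp (\<delta> * y))"
    and s: "path_decay TYPE('d) s"
    and r: "\<And>a b. a \<in> R \<Longrightarrow> b \<in> R \<Longrightarrow> l1_norm (b - a) \<le> int r"
  shows "integrable (edge_measure \<nu>) (visit_bound s \<delta> L R)"
    "(LINT x|edge_measure \<nu>. visit_bound s \<delta> L R x) \<le> visit_mean s \<delta> (card R) r"
proof -
  interpret M: prob_space "edge_measure \<nu> :: ((int ^ 'd) set \<Rightarrow> real) measure" by (rule prob_space_edge_measure)
  have s': "0 \<le> s" "real (card (unit_steps :: (int ^ 'd) set)) * exp 1 * (LINT y|\<nu>. exp (- s * y)) \<le> 1 / 2"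
    using s by (auto simp: path_decay_def)
  have d0: "0 \<le> \<delta>" using \<delta>(1) by simp
  note D = detour_sum_integral[OF R(1) d0 \<delta>(2) r]
  note W = walk_sum_integral[OF R(1) s']
  have D1: "1 \<le> detour_sum \<delta> R x" if "x \<in> space (edge_measure \<nu>)" for x
    using weight_nonneg[OF that] by (intro detour_sum_ge_1 R d0)
  have W1: "1 \<le> walk_sum s L R x" for x by (intro walk_sum_ge_1 R L)
  note ED = M.expectation_ln_le[OF D(1) D1 D(2)]
  note EW = M.expectation_ln_le[OF W(1)[of L] W1 W(2)[of L]]
  show "integrable (edge_measure \<nu>) (visit_bound s \<delta> L R)"
    unfolding visit_bound_def[abs_def]
    by (intro Bochner_Integration.integrable_add integrable_mult_right ED(1) EW(1)) simp
  have "(LINT x|edge_measure \<nu>. visit_bound s \<delta> L R x)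
      = 1 + s / \<delta> * (LINT x|edge_measure \<nu>. ln (detour_sum \<delta> R x)) + (LINT x|edge_measure \<nu>. ln (walk_sum s L R x))"
    unfolding visit_bound_def using ED(1) EW(1) by (simp add: M.prob_space)
  also have "\<dots> \<le> visit_mean s \<delta> (card R) r"
    unfolding visit_mean_def using ED(2) EW(2) s'(1) \<delta>(1)
    by (intro add_mono mult_left_mono) auto
  finally show "(LINT x|edge_measure \<nu>. visit_bound s \<delta> L R x) \<le> visit_mean s \<delta> (card R) r" .
qed

definition reflected_box :: "nat \<Rightarrow> int ^ 'd::finite \<Rightarrow> (int ^ 'd) set" where
  "reflected_box m a = (\<lambda>z. a - z) ` lattice_box m"

lemma reflected_box:
  fixes a :: "int ^ 'd::finite"
  shows "finite (reflected_box m a)" "card (reflected_box m a) = card (lattice_box m :: (int ^ 'd) set)"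
    "0 < m \<Longrightarrow> reflected_box m a \<noteq> {}"
    "b \<in> reflected_box m a \<Longrightarrow> c \<in> reflected_box m a \<Longrightarrow> l1_norm (c - b) \<le> int (CARD('d) * m)"
proof -
  show "finite (reflected_box m a)" by (simp add: reflected_box_def finite_box)
  show "card (reflected_box m a) = card (lattice_box m :: (int ^ 'd) set)"
    unfolding reflected_box_def by (intro card_image inj_onI) simp
  show "reflected_box m a \<noteq> {}" if "0 < m" using zero_in_box[OF that] by (auto simp: reflected_box_def)
  assume "b \<in> reflected_box m a" "c \<in> reflected_box m a"
  then obtain z w where zw: "z \<in> lattice_box m" "w \<in> lattice_box m" "b = a - z" "c = a - w"
    by (auto simp: reflected_box_def)
  then have "c - b = z - w" by simp
  then show "l1_norm (c - b) \<le> int (CARD('d) * m)" using l1_norm_box_diff[OF zw(1,2)] by simp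
qed

text \<open>
  An edge \<open>e\<close> with end point \<open>a\<close> lies on the geodesic shifted by \<open>z\<close> only if the unshifted geodesic, in the shifted
  weights, visits \<open>a - z\<close>. By translation invariance the average over \<open>z\<close> is the expected proportion of
  the reflected cube \<open>a - z\<close> that one fixed geodesic visits.
\<close>

lemma cube_avg_influence_le:
  fixes v :: "int ^ 'd::finite"
  assumes L: "l1_norm v < int L" and m: "0 < m" and K: "0 \<le> K"
    and E: "finite E" "box_support L v m \<subseteq> E"
    and a: "a \<in> e" and s: "0 \<le> s" "0 < \<delta>"
  shows "cube_avg (E \<times> {..<N}) (\<lambda>\<omega>. optimal_sets.influence (lattice_box m) K (box_opt L v)
        (\<lambda>z x. short_time L v (shift_weights z x)) e (\<lambda>e. U (signsum N \<omega> e)))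
    \<le> cube_avg (E \<times> {..<N}) (\<lambda>\<omega>. min (card (lattice_box m :: (int ^ 'd) set))
        (visit_bound s \<delta> L (reflected_box m a) (\<lambda>e. U (signsum N \<omega> e)))) / card (lattice_box m :: (int ^ 'd) set)"
proof -
  interpret O: optimal_sets E "lattice_box m" K "box_opt L v" "\<lambda>z x. short_time L v (shift_weights z x)"
    by (rule optimal_sets_box[OF L E m K])
  define X where "X N \<omega> e = U (signsum N \<omega> e)" for N and \<omega> :: "((int ^ 'd) set \<times> nat) set" and e
  define c where "c = real (card (lattice_box m :: (int ^ 'd) set))"
  define \<phi> where "\<phi> z x = (if a - z \<in> set (short_geodesic L v x) then 1 else 0 :: real)" for z x
  have infl: "O.influence e x \<le> (1 / c) * (\<Sum>z\<in>lattice_box m. \<phi> z (shift_weights z x))" for x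
  proof -
    have "(\<Sum>z\<in>lattice_box m. if e \<in> box_opt L v z x \<and> short_time L v (shift_weights z x) < K then 1 else 0)
      \<le> (\<Sum>z\<in>lattice_box m. \<phi> z (shift_weights z x))"
    proof (rule sum_mono)
      fix z :: "int ^ 'd"
      have "a - z \<in> set (short_geodesic L v (shift_weights z x))" if eo: "e \<in> box_opt L v z x"
      proof -
        obtain e' where e': "e = (+) z ` e'" "e' \<in> set (path_edges (short_geodesic L v (shift_weights z x)))"
          using eo unfolding box_opt_def by (elim imageE)
        then show ?thesis using a path_edges_subset[OF e'(2)] by auto
      qed
      then show "(if e \<in> box_opt L v z x \<and> short_time L v (shift_weights z x) < K then 1 else 0) \<le> \<phi> z (shift_weights z x)"
        by (auto simp: \<phi>_def)
    qed
    then show ?thesis unfolding O.influence_def by (simp add: c_def divide_right_mono)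
  qed
  have count: "(\<Sum>z\<in>lattice_box m. \<phi> z x) \<le> min c (visit_bound s \<delta> L (reflected_box m a) x)"
    if x: "\<And>e. 0 \<le> x e" for x
  proof -
    have "(\<Sum>z\<in>lattice_box m. \<phi> z x) = real (card {z \<in> lattice_box m. a - z \<in> set (short_geodesic L v x)})"
      unfolding \<phi>_def by (subst sum.inter_filter[OF finite_box, symmetric]) simp
    also have "card {z \<in> lattice_box m. a - z \<in> set (short_geodesic L v x)}
        = card ((\<lambda>z. a - z) ` {z \<in> lattice_box m. a - z \<in> set (short_geodesic L v x)})"
      by (intro card_image[symmetric] inj_onI) simp
    also have "(\<lambda>z. a - z) ` {z \<in> lattice_box m. a - z \<in> set (short_geodesic L v x)}
        = set (short_geodesic L v x) \<inter> reflected_box m a"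
      by (auto simp: reflected_box_def)
    finally have eq: "(\<Sum>z\<in>lattice_box m. \<phi> z x) = real (card (set (short_geodesic L v x) \<inter> reflected_box m a))" .
    have "card (set (short_geodesic L v x) \<inter> reflected_box m a) \<le> card (reflected_box m a)"
      by (intro card_mono reflected_box) auto
    moreover have "real (card (set (short_geodesic L v x) \<inter> reflected_box m a)) \<le> visit_bound s \<delta> L (reflected_box m a) x"
      unfolding visit_bound_def using x by (intro card_geodesic_inter_le L reflected_box m s)
    ultimately show ?thesis unfolding eq by (simp add: c_def reflected_box)
  qed
  have zero_box: "path_support L v \<subseteq> E"
  proof
    fix e' assume "e' \<in> path_support L v"
    then have "(+) 0 ` e' \<in> box_support L v m" unfolding box_support_def using zero_in_box[OF m] by blast
    moreover have "(+) 0 ` e' = e'" by (auto simp: image_iff)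
    ultimately show "e' \<in> E" using E(2) by auto
  qed
  have "cube_avg (E \<times> {..<N}) (\<lambda>\<omega>. O.influence e (X N \<omega>))
      \<le> cube_avg (E \<times> {..<N}) (\<lambda>\<omega>. (1 / c) * (\<Sum>z\<in>lattice_box m. \<phi> z (shift_weights z (X N \<omega>))))"
    by (intro cube_avg_mono infl)
  also have "\<dots> = (1 / c) * (\<Sum>z\<in>lattice_box m. cube_avg (E \<times> {..<N}) (\<lambda>\<omega>. \<phi> z (shift_weights z (X N \<omega>))))"
    by (simp only: cube_avg_cmult cube_avg_sum)
  also have "(\<Sum>z\<in>lattice_box m. cube_avg (E \<times> {..<N}) (\<lambda>\<omega>. \<phi> z (shift_weights z (X N \<omega>))))
      = (\<Sum>z\<in>lattice_box m. cube_avg (E \<times> {..<N}) (\<lambda>\<omega>. \<phi> z (X N \<omega>)))"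
  proof (intro sum.cong refl)
    fix z :: "int ^ 'd" assume z: "z \<in> lattice_box m"
    show "cube_avg (E \<times> {..<N}) (\<lambda>\<omega>. \<phi> z (shift_weights z (X N \<omega>))) = cube_avg (E \<times> {..<N}) (\<lambda>\<omega>. \<phi> z (X N \<omega>))"
      unfolding X_def[abs_def]
    proof (rule cube_avg_shift[OF E(1) zero_box])
      show "(`) ((+) z) ` path_support L v \<subseteq> E" using E(2) z by (auto simp: box_support_def)
      fix x y :: "(int ^ 'd) set \<Rightarrow> real" assume "\<And>e. e \<in> path_support L v \<Longrightarrow> x e = y e"
      then have "short_geodesic L v x = short_geodesic L v y"
        by (intro short_time_cong(2)) (auto simp: path_support_def)
      then show "\<phi> z x = \<phi> z y" by (simp add: \<phi>_def)
    qed
  qed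
  also have "\<dots> = cube_avg (E \<times> {..<N}) (\<lambda>\<omega>. \<Sum>z\<in>lattice_box m. \<phi> z (X N \<omega>))" by (rule cube_avg_sum[symmetric])
  also have "(1 / c) * \<dots> \<le> (1 / c) * cube_avg (E \<times> {..<N}) (\<lambda>\<omega>. min c (visit_bound s \<delta> L (reflected_box m a) (X N \<omega>)))"
    by (intro mult_left_mono cube_avg_mono count) (auto simp: X_def U_nonneg c_def)
  finally show ?thesis by (simp add: X_def[abs_def] c_def)
qed

text \<open>
  The truncation at the number \<open>c\<close> of vertices of the cube, which is harmless for the count, makes the
  function bounded, so the estimate for independent \<open>\<nu>\<close>-distributed weights carries over to many coin flips.
\<close>

lemma visit_cube_avg_eventually:
  fixes a :: "int ^ 'd::finite"
  assumes L: "0 < L" and m: "0 < m" and \<delta>: "0 < \<delta>" "integrable \<nu> (\<lambda>y. exp (\<delta> * y))"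
    and s: "path_decay TYPE('d) s"
    and E: "finite E" "E \<subseteq> lattice_edges" "visit_support L (reflected_box m a) \<subseteq> E"
  defines "c \<equiv> card (lattice_box m :: (int ^ 'd) set)"
  shows "\<forall>\<^sub>F N in sequentially. cube_avg (E \<times> {..<N}) (\<lambda>\<omega>. min c
      (visit_bound s \<delta> L (reflected_box m a) (\<lambda>e. U (signsum N \<omega> e)))) \<le> visit_mean s \<delta> c (CARD('d) * m) + 1"
proof -
  let ?R = "reflected_box m a"
  define \<Phi> where "\<Phi> x = min (real c) (visit_bound s \<delta> L ?R x)" for x
  interpret M: prob_space "edge_measure \<nu> :: ((int ^ 'd) set \<Rightarrow> real) measure" by (rule prob_space_edge_measure)
  have R: "finite ?R" "?R \<noteq> {}" by (rule reflected_box(1), rule reflected_box(3)[OF m])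
  have d0: "0 \<le> \<delta>" using \<delta> by simp
  have s0: "0 \<le> s" using s by (simp add: path_decay_def)
  have nn: "0 \<le> visit_bound s \<delta> L ?R x" if "\<And>e. e \<in> lattice_edges \<Longrightarrow> 0 \<le> x e" for x
  proof -
    have "1 \<le> detour_sum \<delta> ?R x" using that by (intro detour_sum_ge_1 R d0)
    moreover have "1 \<le> walk_sum s L ?R x" by (intro walk_sum_ge_1 R L)
    ultimately show ?thesis using s0 \<delta>(1) by (simp add: visit_bound_def)
  qed
  have lim: "(\<lambda>N. cube_avg (E \<times> {..<N}) (\<lambda>\<omega>. \<Phi> (\<lambda>e. U (signsum N \<omega> e)))) \<longlonglongrightarrow> (LINT x|edge_measure \<nu>. \<Phi> x)"
  proof (rule cube_avg_tendsto_edge_measure[OF E(1,2), where B="real c"])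
    have "visit_bound s \<delta> L ?R \<in> borel_measurable (PiM E (\<lambda>_. borel))"
      by (rule visit_bound_measurable) (use E(3) in \<open>auto intro: measurable_component_singleton\<close>)
    then show "\<Phi> \<in> borel_measurable (PiM E (\<lambda>_. borel))" unfolding \<Phi>_def[abs_def] by measurable
    show "\<bar>\<Phi> x\<bar> \<le> real c" if "\<And>e. 0 \<le> x e" for x using nn[of x] that by (simp add: \<Phi>_def)
    show "\<Phi> x = \<Phi> y" if "\<And>e. e \<in> E \<Longrightarrow> x e = y e" for x y
    proof -
      have "visit_bound s \<delta> L ?R x = visit_bound s \<delta> L ?R y" using that E(3) by (intro visit_bound_cong) auto
      then show ?thesis by (simp add: \<Phi>_def)
    qed
    show "(\<lambda>n. \<Phi> (X n)) \<longlonglongrightarrow> \<Phi> x" if "\<And>e. (\<lambda>n. X n e) \<longlonglongrightarrow> x e" "\<And>n e. 0 \<le> X n e" for X x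
      unfolding \<Phi>_def by (intro tendsto_min tendsto_const visit_bound_tendsto[OF R L d0 that])
  qed
  note I = visit_bound_integral[OF R L \<delta> s reflected_box(4)]
  have "(LINT x|edge_measure \<nu>. \<Phi> x) \<le> (LINT x|edge_measure \<nu>. visit_bound s \<delta> L ?R x)"
  proof (intro integral_mono_AE AE_I2 I(1))
    show "integrable (edge_measure \<nu>) \<Phi>"
      unfolding \<Phi>_def[abs_def] using I(1) by (intro integrable_min) auto
  qed (simp_all add: \<Phi>_def)
  also have "\<dots> \<le> visit_mean s \<delta> c (CARD('d) * m)" using I(2) by (simp add: reflected_box c_def)
  finally have "(LINT x|edge_measure \<nu>. \<Phi> x) < visit_mean s \<delta> c (CARD('d) * m) + 1" by simp
  from order_tendstoD(2)[OF lim this] show ?thesis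
    by eventually_elim (simp add: \<Phi>_def)
qed

text \<open>
  On the cube with \<open>N\<close> signs per edge the inequality is \<open>cube_exp_variance_bound\<close>; the influences are at most
  \<open>\<kappa>\<^sup>2 / 2\<close> once \<open>N\<close> is large. Both sides are averages of bounded continuous functions of finitely many
  weights, and \<open>N\<close> tends to infinity.
\<close>

theorem box_time_variance:
  fixes v :: "int ^ 'd::finite"
  assumes L: "l1_norm v < int L" and m: "0 < m" and K: "0 \<le> K" and k: "0 < k"
    and \<delta>: "0 < \<delta>" "integrable \<nu> (\<lambda>y. exp (\<delta> * y))" and s: "path_decay TYPE('d) s"
    and \<kappa>: "0 \<le> \<kappa>" "2 * ((visit_mean s \<delta> (m ^ CARD('d)) (CARD('d) * m) + 1) / real (m ^ CARD('d))) \<le> \<kappa>\<^sup>2"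
    and u: "\<bar>u\<bar> \<le> 1"
  shows "(LINT x|edge_measure \<nu>. exp (u * box_time m K L v x)) - (LINT x|edge_measure \<nu>. exp (u / 2 * box_time m K L v x))\<^sup>2
    \<le> (3 ^ k * \<kappa> + 1 / k) * (A\<^sup>2 * exp (4 * A * (sqrt (U 0) + A)) * (4 * K + 1)) * u\<^sup>2
      * (LINT x|edge_measure \<nu>. exp (u * box_time m K L v x))"
proof -
  define vx where "vx e = (SOME a. a \<in> e)" for e :: "(int ^ 'd) set"
  have vx: "vx e \<in> e" if "e \<in> box_support L v m" for e
  proof -
    have "e \<in> lattice_edges" using that box_support by blast
    then have "\<exists>a. a \<in> e" by (auto simp: lattice_edges_def)
    then show ?thesis unfolding vx_def by (rule someI_ex)
  qed
  \<comment> \<open>All edges that occur in the averaged passage time or in one of the visit bounds.\<close>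
  define E where "E = box_support L v m \<union> (\<Union>e\<in>box_support L v m. visit_support L (reflected_box m (vx e)))"
  have finE: "finite E" unfolding E_def using box_support visit_support(1)[OF reflected_box(1)] by blast
  have Elat: "E \<subseteq> lattice_edges" unfolding E_def using box_support visit_support(2)[OF reflected_box(1)] by blast
  have Ebox: "box_support L v m \<subseteq> E" by (simp add: E_def)
  have L0: "0 < L" using L l1_norm_nonneg[of v] by linarith
  have s0: "0 \<le> s" using s by (simp add: path_decay_def)
  define c where "c = card (lattice_box m :: (int ^ 'd) set)"
  have c: "c = m ^ CARD('d)" by (simp add: c_def card_box)
  have c0: "0 < real c" using m by (simp add: c)
  interpret O: optimal_sets E "lattice_box m" K "box_opt L v" "\<lambda>z x. short_time L v (shift_weights z x)"
    by (rule optimal_sets_box[OF L finE Ebox m K])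
  have avg: "O.avg_time = box_time m K L v"
    by (rule ext) (simp add: O.avg_time_def box_time_def)
  define V where "V = visit_mean s \<delta> c (CARD('d) * m) + 1"
  have ev1: "\<forall>\<^sub>F N in sequentially. \<forall>e\<in>box_support L v m. cube_avg (E \<times> {..<N}) (\<lambda>\<omega>. min c
      (visit_bound s \<delta> L (reflected_box m (vx e)) (\<lambda>e. U (signsum N \<omega> e)))) \<le> V"
    unfolding V_def c_def
    by (intro eventually_ball_finite ballI box_support visit_cube_avg_eventually[OF L0 m \<delta> s finE Elat]) (auto simp: E_def)
  have ev2: "\<forall>\<^sub>F N in sequentially. 4 * A\<^sup>2 * real (card E) \<le> real N" by real_asymp
  have ev3: "\<forall>\<^sub>F N in sequentially. 0 < N" by (rule eventually_gt_at_top)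
  define W where "W q N = cube_avg (E \<times> {..<N}) (\<lambda>\<omega>. exp (q * box_time m K L v (\<lambda>e. U (signsum N \<omega> e))))" for q N
  define D where "D = (3 ^ k * \<kappa> + 1 / k) * (A\<^sup>2 * exp (4 * A * (sqrt (U 0) + A)) * (4 * K + 1)) * u\<^sup>2"
  have ineq: "\<forall>\<^sub>F N in sequentially. W u N - (W (u / 2) N)\<^sup>2 \<le> D * W u N"
    using ev1 ev2 ev3
  proof eventually_elim
    case (elim N)
    have "2 * cube_avg (E \<times> {..<N}) (\<lambda>\<omega>. O.influence e (\<lambda>e. U (signsum N \<omega> e))) \<le> \<kappa>\<^sup>2" if e: "e \<in> E" for e
    proof (cases "e \<in> box_support L v m")
      case True
      have "cube_avg (E \<times> {..<N}) (\<lambda>\<omega>. O.influence e (\<lambda>e. U (signsum N \<omega> e)))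
        \<le> cube_avg (E \<times> {..<N}) (\<lambda>\<omega>. min c (visit_bound s \<delta> L (reflected_box m (vx e)) (\<lambda>e. U (signsum N \<omega> e)))) / c"
        unfolding c_def by (rule cube_avg_influence_le[OF L m K finE Ebox vx[OF True] s0 \<delta>(1)])
      also have "\<dots> \<le> V / c" using elim(1) True c0 by (intro divide_right_mono) auto
      finally have "2 * cube_avg (E \<times> {..<N}) (\<lambda>\<omega>. O.influence e (\<lambda>e. U (signsum N \<omega> e))) \<le> 2 * (V / c)"
        by simp
      also have "\<dots> \<le> \<kappa>\<^sup>2" using \<kappa>(2) unfolding V_def c .
      finally show ?thesis .
    next
      case False
      have "O.influence e x = 0" for x
      proof -
        have "e \<notin> box_opt L v z x" if "z \<in> lattice_box m" for z using box_opt_subset[OF L that] False by blast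
        then show ?thesis by (simp add: O.influence_def)
      qed
      then show ?thesis by (simp add: cube_avg_def)
    qed
    from O.cube_exp_variance_bound[OF A_nonneg U_nonneg sqrt_U_lipschitz elim(3,2) k \<kappa>(1) this u]
    show ?case unfolding avg W_def D_def by simp
  qed
  have lim: "W q \<longlonglongrightarrow> (LINT x|edge_measure \<nu>. exp (q * box_time m K L v x))" for q
    unfolding W_def[abs_def]
  proof (rule cube_avg_tendsto_edge_measure[OF finE Elat, where B="exp (\<bar>q\<bar> * K)"])
    have "box_time m K L v \<in> borel_measurable (PiM E (\<lambda>_. borel))"
      by (rule box_time_measurable[OF L]) (use Ebox in \<open>auto intro: measurable_component_singleton\<close>)
    then show "(\<lambda>x. exp (q * box_time m K L v x)) \<in> borel_measurable (PiM E (\<lambda>_. borel))" by measurable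
    show "\<bar>exp (q * box_time m K L v x)\<bar> \<le> exp (\<bar>q\<bar> * K)" if "\<And>e. 0 \<le> x e" for x
    proof -
      have "\<bar>q * box_time m K L v x\<bar> \<le> \<bar>q\<bar> * K"
        unfolding abs_mult using that by (intro mult_left_mono box_time_bounded L m K) auto
      then show ?thesis by simp
    qed
    show "exp (q * box_time m K L v x) = exp (q * box_time m K L v y)" if "\<And>e. e \<in> E \<Longrightarrow> x e = y e" for x y
    proof -
      have "box_time m K L v x = box_time m K L v y" using that Ebox by (intro box_time_cong) auto
      then show ?thesis by simp
    qed
    show "(\<lambda>n. exp (q * box_time m K L v (X n))) \<longlonglongrightarrow> exp (q * box_time m K L v x)"
      if "\<And>e. (\<lambda>n. X n e) \<longlonglongrightarrow> x e" "\<And>n e. 0 \<le> X n e" for X x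
      by (intro tendsto_intros box_time_tendsto[OF L] that(1))
  qed
  have "(LINT x|edge_measure \<nu>. exp (u * box_time m K L v x)) - (LINT x|edge_measure \<nu>. exp (u / 2 * box_time m K L v x))\<^sup>2
      \<le> D * (LINT x|edge_measure \<nu>. exp (u * box_time m K L v x))"
    by (rule tendsto_le[OF sequentially_bot _ _ ineq]) (intro tendsto_intros lim)+
  then show ?thesis by (simp add: D_def)
qed

text \<open>
  The limit of \<open>box_time\<close> as the bound on the length of the paths is removed.
\<close>

definition box_passage :: "nat \<Rightarrow> real \<Rightarrow> int ^ 'd::finite \<Rightarrow> ((int ^ 'd) set \<Rightarrow> real) \<Rightarrow> real" where
  "box_passage m K v x = (\<Sum>z\<in>lattice_box m. min K (passage_time (shift_weights z x) 0 v)) / card (lattice_box m :: (int ^ 'd) set)"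

lemma box_passage_measurable:
  fixes v :: "int ^ 'd::finite"
  shows "box_passage m K v \<in> borel_measurable (edge_measure \<nu>)"
  unfolding box_passage_def[abs_def]
  by (intro borel_measurable_divide borel_measurable_const borel_measurable_sum borel_measurable_min passage_time_measurable)

lemma box_passage_bounded:
  fixes v :: "int ^ 'd::finite"
  assumes "0 < m" "0 \<le> K" "x \<in> space (edge_measure \<nu>)"
  shows "\<bar>box_passage m K v x\<bar> \<le> K"
  unfolding box_passage_def
proof (rule avg_abs_le[OF finite_box])
  show "(lattice_box m :: (int ^ 'd) set) \<noteq> {}" using zero_in_box assms by blast
  fix z :: "int ^ 'd"
  have "0 \<le> passage_time (shift_weights z x) 0 v"
    using assms(3) by (intro passage_time_nonneg shift_weight_nonneg)
  then show "\<bar>min K (passage_time (shift_weights z x) 0 v)\<bar> \<le> K" using assms(2) by auto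
qed

text \<open>
  All averaged times are bounded by \<open>K\<close>, so dominated convergence carries \<open>box_time_variance\<close> to the limit.
\<close>

theorem box_passage_variance:
  fixes v :: "int ^ 'd::finite"
  assumes m: "0 < m" and K: "0 \<le> K" and k: "0 < k"
    and \<delta>: "0 < \<delta>" "integrable \<nu> (\<lambda>y. exp (\<delta> * y))" and s: "path_decay TYPE('d) s"
    and \<kappa>: "0 \<le> \<kappa>" "2 * ((visit_mean s \<delta> (m ^ CARD('d)) (CARD('d) * m) + 1) / real (m ^ CARD('d))) \<le> \<kappa>\<^sup>2"
    and u: "\<bar>u\<bar> \<le> 1"
  shows "(LINT x|edge_measure \<nu>. exp (u * box_passage m K v x)) - (LINT x|edge_measure \<nu>. exp (u / 2 * box_passage m K v x))\<^sup>2
    \<le> (3 ^ k * \<kappa> + 1 / k) * (A\<^sup>2 * exp (4 * A * (sqrt (U 0) + A)) * (4 * K + 1)) * u\<^sup>2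
      * (LINT x|edge_measure \<nu>. exp (u * box_passage m K v x))"
proof -
  define L where "L n = n + Suc (nat (l1_norm v))" for n
  have L: "l1_norm v < int (L n)" for n using l1_norm_nonneg[of v] by (simp add: L_def)
  interpret M: prob_space "edge_measure \<nu> :: ((int ^ 'd) set \<Rightarrow> real) measure" by (rule prob_space_edge_measure)
  have lim: "(\<lambda>n. LINT x|edge_measure \<nu>. exp (q * box_time m K (L n) v x)) \<longlonglongrightarrow> (LINT x|edge_measure \<nu>. exp (q * box_passage m K v x))" for q
  proof (rule integral_dominated_convergence[where w="\<lambda>_. exp (\<bar>q\<bar> * K)"])
    show "(\<lambda>x. exp (q * box_passage m K v x)) \<in> borel_measurable (edge_measure \<nu>)"
      using box_passage_measurable[of m K v] by measurable
    show "(\<lambda>x. exp (q * box_time m K (L n) v x)) \<in> borel_measurable (edge_measure \<nu>)" for n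
    proof -
      have "box_time m K (L n) v \<in> borel_measurable (edge_measure \<nu>)"
        by (intro box_time_measurable[OF L] weight_measurable) (use box_support in blast)
      then show ?thesis by measurable
    qed
    show "AE x in edge_measure \<nu>. (\<lambda>n. exp (q * box_time m K (L n) v x)) \<longlonglongrightarrow> exp (q * box_passage m K v x)"
    proof (rule AE_I2)
      fix x assume x: "x \<in> space (edge_measure \<nu> :: ((int ^ 'd) set \<Rightarrow> real) measure)"
      have "(\<lambda>n. short_time (L n) v (shift_weights z x)) \<longlonglongrightarrow> passage_time (shift_weights z x) 0 v" for z
        unfolding L_def by (intro LIMSEQ_ignore_initial_segment short_time_tendsto shift_weight_nonneg x)
      moreover have "real (card (lattice_box m :: (int ^ 'd) set)) \<noteq> 0" using m by (simp add: card_box)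
      ultimately show "(\<lambda>n. exp (q * box_time m K (L n) v x)) \<longlonglongrightarrow> exp (q * box_passage m K v x)"
        unfolding box_time_def box_passage_def by (intro tendsto_intros)
    qed
    show "AE x in edge_measure \<nu>. norm (exp (q * box_time m K (L n) v x)) \<le> exp (\<bar>q\<bar> * K)" for n
    proof (rule AE_I2)
      fix x assume x: "x \<in> space (edge_measure \<nu> :: ((int ^ 'd) set \<Rightarrow> real) measure)"
      have "\<bar>box_time m K (L n) v x\<bar> \<le> K" by (rule box_time_bounded[OF L m K weight_nonneg[OF x]])
      then have "\<bar>q * box_time m K (L n) v x\<bar> \<le> \<bar>q\<bar> * K"
        unfolding abs_mult by (intro mult_left_mono) auto
      then show "norm (exp (q * box_time m K (L n) v x)) \<le> exp (\<bar>q\<bar> * K)" by simp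
    qed
  qed simp
  define W where "W q n = (LINT x|edge_measure \<nu>. exp (q * box_time m K (L n) v x))" for q n
  define D where "D = (3 ^ k * \<kappa> + 1 / k) * (A\<^sup>2 * exp (4 * A * (sqrt (U 0) + A)) * (4 * K + 1)) * u\<^sup>2"
  have lim': "W q \<longlonglongrightarrow> (LINT x|edge_measure \<nu>. exp (q * box_passage m K v x))" for q
    unfolding W_def[abs_def] by (rule lim)
  have ineq: "\<forall>\<^sub>F n in sequentially. W u n - (W (u / 2) n)\<^sup>2 \<le> D * W u n"
    unfolding W_def D_def by (intro always_eventually allI box_time_variance[OF L m K k \<delta> s \<kappa> u])
  have "(LINT x|edge_measure \<nu>. exp (u * box_passage m K v x)) - (LINT x|edge_measure \<nu>. exp (u / 2 * box_passage m K v x))\<^sup>2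
      \<le> D * (LINT x|edge_measure \<nu>. exp (u * box_passage m K v x))"
    by (rule tendsto_le[OF sequentially_bot _ _ ineq]) (intro tendsto_intros lim')+
  then show ?thesis by (simp add: D_def)
qed

end


section \<open>Distance between the passage time and its average\<close>

text \<open>
  Jensen's inequality for a finite average, from the tangent line of \<open>exp\<close> at the mean.
\<close>

lemma exp_avg_le:
  fixes f :: "'i \<Rightarrow> real"
  assumes "finite I" "I \<noteq> {}"
  shows "exp ((\<Sum>i\<in>I. f i) / card I) \<le> (\<Sum>i\<in>I. exp (f i)) / card I"
proof -
  define \<mu> where "\<mu> = (\<Sum>i\<in>I. f i) / card I"
  have c: "0 < real (card I)" using assms by (simp add: card_gt_0_iff)
  have "(\<Sum>i\<in>I. exp \<mu> * (1 + (f i - \<mu>))) \<le> (\<Sum>i\<in>I. exp (f i))"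
  proof (rule sum_mono)
    fix i
    have "exp \<mu> * (1 + (f i - \<mu>)) \<le> exp \<mu> * exp (f i - \<mu>)"
      by (intro mult_left_mono exp_ge_add_one_self) simp
    then show "exp \<mu> * (1 + (f i - \<mu>)) \<le> exp (f i)" by (simp add: exp_add[symmetric])
  qed
  moreover have "(\<Sum>i\<in>I. exp \<mu> * (1 + (f i - \<mu>))) = exp \<mu> * card I"
  proof -
    have "(\<Sum>i\<in>I. f i) = \<mu> * card I" using c by (simp add: \<mu>_def)
    then show ?thesis by (simp add: sum_distrib_left[symmetric] sum.distrib sum_subtractf)
  qed
  ultimately show ?thesis using c unfolding \<mu>_def[symmetric] by (simp add: field_simps)
qed

lemma shift_weights_0: "shift_weights 0 x = x"
  by (rule ext) (simp add: shift_weights_def)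

context transported_weights
begin

text \<open>
  The three terms are the cost of joining \<open>0\<close> to \<open>z\<close>, the cost of joining \<open>v\<close> to \<open>z + v\<close>, and the excess
  over the truncation level \<open>K\<close>, bounded along a shortest path.
\<close>

definition deviation :: "nat \<Rightarrow> real \<Rightarrow> int ^ 'd::finite \<Rightarrow> ((int ^ 'd) set \<Rightarrow> real) \<Rightarrow> real" where
  "deviation m K v x = (\<Sum>z\<in>lattice_box m. path_time x (shortest_path 0 z) + path_time x (shortest_path v (z + v))
      + max 0 (path_time x (shortest_path z (z + v)) - K)) / card (lattice_box m :: (int ^ 'd) set)"

text \<open>
  A majorant of \<open>exp (\<delta> / 3 * deviation)\<close> that is a linear combination of exponentials of path times and can
  therefore be integrated exactly.
\<close>

definition exp_deviation :: "real \<Rightarrow> nat \<Rightarrow> real \<Rightarrow> int ^ 'd::finite \<Rightarrow> ((int ^ 'd) set \<Rightarrow> real) \<Rightarrow> real" where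
  "exp_deviation \<delta> m K v x = (\<Sum>z\<in>lattice_box m. exp (\<delta> * path_time x (shortest_path 0 z))
      + exp (\<delta> * path_time x (shortest_path v (z + v)))
      + (1 + exp (- \<delta> * K) * exp (\<delta> * path_time x (shortest_path z (z + v))))) / card (lattice_box m :: (int ^ 'd) set)"

lemma box_passage_deviation:
  fixes v :: "int ^ 'd::finite"
  assumes m: "0 < m" and x: "x \<in> space (edge_measure \<nu>)"
  shows "\<bar>passage_time x 0 v - box_passage m K v x\<bar> \<le> deviation m K v x"
proof -
  let ?c = "real (card (lattice_box m :: (int ^ 'd) set))"
  have c: "0 < ?c" using m by (simp add: card_box)
  note nn = weight_nonneg[OF x]
  have term_le: "\<bar>passage_time x 0 v - min K (passage_time (shift_weights z x) 0 v)\<bar>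
     \<le> path_time x (shortest_path 0 z) + path_time x (shortest_path v (z + v))
      + max 0 (path_time x (shortest_path z (z + v)) - K)" for z
  proof -
    have 1: "\<bar>passage_time x 0 v - passage_time (shift_weights z x) 0 v\<bar>
      \<le> path_time x (shortest_path 0 z) + path_time x (shortest_path v (z + v))"
      by (rule passage_time_shift_diff[OF nn])
    have 2: "passage_time (shift_weights z x) 0 v \<le> path_time x (shortest_path z (z + v))"
      unfolding passage_time_shift by (simp add: passage_time_le[OF shortest_path(1) nn])
    from 1 2 show ?thesis by (auto simp: min_def max_def abs_if split: if_splits)
  qed
  have "passage_time x 0 v - box_passage m K v x
      = (\<Sum>z\<in>(lattice_box m :: (int ^ 'd) set). passage_time x 0 v - min K (passage_time (shift_weights z x) 0 v)) / ?c"
    using c by (simp add: box_passage_def sum_subtractf diff_divide_distrib)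
  also have "\<bar>\<dots>\<bar> \<le> deviation m K v x"
    unfolding deviation_def abs_divide using c
    by (simp, intro divide_right_mono order_trans[OF sum_abs] sum_mono term_le) simp
  finally show ?thesis .
qed

lemma deviation_nonneg:
  assumes "x \<in> space (edge_measure \<nu>)"
  shows "0 \<le> deviation m K v x"
  unfolding deviation_def
  by (intro divide_nonneg_nonneg sum_nonneg add_nonneg_nonneg path_time_nonneg[OF shortest_path(1)]
      weight_nonneg[OF assms]) auto

text \<open>
  Convexity moves the average over \<open>z\<close> out of the exponential, and \<open>(a + b + c) / 3\<close> is at most the maximum
  of the three terms, whence the factor \<open>1 / 3\<close>.
\<close>

lemma exp_deviation_le:
  fixes v :: "int ^ 'd::finite"
  assumes m: "0 < m" and \<delta>: "0 < \<delta>"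
  shows "exp (\<delta> / 3 * deviation m K v x) \<le> exp_deviation \<delta> m K v x"
proof -
  define Y where "Y z = path_time x (shortest_path 0 z) + path_time x (shortest_path v (z + v))
      + max 0 (path_time x (shortest_path z (z + v)) - K)" for z
  have ne: "(lattice_box m :: (int ^ 'd) set) \<noteq> {}" using zero_in_box[OF m] by auto
  have "exp (\<delta> / 3 * deviation m K v x) = exp ((\<Sum>z\<in>lattice_box m. \<delta> / 3 * Y z) / card (lattice_box m :: (int ^ 'd) set))"
    by (simp add: deviation_def Y_def sum_distrib_left)
  also have "\<dots> \<le> (\<Sum>z\<in>lattice_box m. exp (\<delta> / 3 * Y z)) / card (lattice_box m :: (int ^ 'd) set)"
    by (rule exp_avg_le[OF finite_box ne])
  also have "\<dots> \<le> exp_deviation \<delta> m K v x"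
    unfolding exp_deviation_def
  proof (intro divide_right_mono sum_mono)
    fix z
    define a b c where "a = \<delta> * path_time x (shortest_path 0 z)" and "b = \<delta> * path_time x (shortest_path v (z + v))"
      and "c = \<delta> * max 0 (path_time x (shortest_path z (z + v)) - K)"
    have "\<delta> / 3 * Y z = (a + b + c) / 3" by (simp add: Y_def a_def b_def c_def algebra_simps)
    moreover have "exp ((a + b + c) / 3) \<le> exp a + exp b + exp c"
    proof -
      have "exp ((a + b + c) / 3) \<le> exp (max a (max b c))" by (simp add: max_def)
      also have "\<dots> \<le> exp a + exp b + exp c" by (simp add: max_def add_increasing add_increasing2)
      finally show ?thesis .
    qed
    moreover have "exp c \<le> 1 + exp (- \<delta> * K) * exp (\<delta> * path_time x (shortest_path z (z + v)))"
    proof (cases "path_time x (shortest_path z (z + v)) \<le> K")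
      case True
      then show ?thesis by (simp add: c_def)
    next
      case False
      then have "exp c = exp (- \<delta> * K) * exp (\<delta> * path_time x (shortest_path z (z + v)))"
        by (simp add: c_def exp_add[symmetric] algebra_simps)
      then show ?thesis by simp
    qed
    ultimately show "exp (\<delta> / 3 * Y z) \<le> exp (\<delta> * path_time x (shortest_path 0 z))
      + exp (\<delta> * path_time x (shortest_path v (z + v)))
      + (1 + exp (- \<delta> * K) * exp (\<delta> * path_time x (shortest_path z (z + v))))"
      by (simp add: a_def b_def)
  qed simp
  finally show ?thesis .
qed

lemma exp_deviation_integral:
  fixes v :: "int ^ 'd::finite"
  assumes m: "0 < m" and \<delta>: "0 < \<delta>" "integrable \<nu> (\<lambda>y. exp (\<delta> * y))"
    and K: "(LINT y|\<nu>. exp (\<delta> * y)) ^ nat (l1_norm v) \<le> exp (\<delta> * K)"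
  shows "integrable (edge_measure \<nu>) (exp_deviation \<delta> m K v)"
    and "(LINT x|edge_measure \<nu>. exp_deviation \<delta> m K v x) \<le> 4 * (LINT y|\<nu>. exp (\<delta> * y)) ^ (CARD('d) * m)"
proof -
  interpret M: prob_space "edge_measure \<nu> :: ((int ^ 'd) set \<Rightarrow> real) measure" by (rule prob_space_edge_measure)
  define C where "C = (LINT y|\<nu>. exp (\<delta> * y))"
  have C: "1 \<le> C" unfolding C_def using \<delta> by (intro exp_integral_ge_1) auto
  define I where "I u w = (LINT x|edge_measure \<nu>. exp (\<delta> * path_time x (shortest_path u w)))" for u w :: "int ^ 'd"
  have int: "integrable (edge_measure \<nu>) (\<lambda>x. exp (\<delta> * path_time x (shortest_path u w)))" for u w :: "int ^ 'd"
    by (rule exp_path_time_integral(1)[OF shortest_path(1,2) \<delta>(2)])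
  have I: "I u w = C ^ nat (l1_norm (w - u))" for u w :: "int ^ 'd"
  proof -
    have "length (shortest_path u w) - 1 = nat (l1_norm (w - u))" using shortest_path(3)[of u w] by linarith
    then show ?thesis
      using exp_path_time_integral(2)[OF shortest_path(1,2) \<delta>(2), of u w] by (simp add: I_def C_def)
  qed
  show "integrable (edge_measure \<nu>) (exp_deviation \<delta> m K v)"
    unfolding exp_deviation_def[abs_def]
    by (intro integrable_divide Bochner_Integration.integrable_sum Bochner_Integration.integrable_add
        integrable_mult_right int) simp
  let ?c = "real (card (lattice_box m :: (int ^ 'd) set))"
  have c: "0 < ?c" using m by (simp add: card_box)
  have "(LINT x|edge_measure \<nu>. exp_deviation \<delta> m K v x)
      = (\<Sum>z\<in>lattice_box m. LINT x|edge_measure \<nu>. (exp (\<delta> * path_time x (shortest_path 0 z))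
      + exp (\<delta> * path_time x (shortest_path v (z + v)))
      + (1 + exp (- \<delta> * K) * exp (\<delta> * path_time x (shortest_path z (z + v)))))) / ?c"
    unfolding exp_deviation_def
    by (subst integral_divide_zero, subst Bochner_Integration.integral_sum)
      (intro Bochner_Integration.integrable_add integrable_mult_right int, simp_all)
  also have "\<dots> = (\<Sum>z\<in>lattice_box m. I 0 z + I v (z + v) + (1 + exp (- \<delta> * K) * I z (z + v))) / ?c"
    using int by (simp add: I_def M.prob_space)
  also have "\<dots> \<le> (\<Sum>z\<in>(lattice_box m :: (int ^ 'd) set). 4 * C ^ (CARD('d) * m)) / ?c"
  proof (intro divide_right_mono sum_mono)
    fix z :: "int ^ 'd" assume z: "z \<in> lattice_box m"
    have "l1_norm z \<le> int (CARD('d) * m)" using l1_norm_box_diff[OF z zero_in_box[OF m]] by simp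
    then have "nat (l1_norm z) \<le> CARD('d) * m" by linarith
    then have 1: "C ^ nat (l1_norm z) \<le> C ^ (CARD('d) * m)" using C by (intro power_increasing)
    have 2: "exp (- \<delta> * K) * C ^ nat (l1_norm v) \<le> 1"
    proof -
      have "exp (- \<delta> * K) * C ^ nat (l1_norm v) \<le> exp (- \<delta> * K) * exp (\<delta> * K)"
        using K by (intro mult_left_mono) (auto simp: C_def)
      then show ?thesis by (simp add: exp_add[symmetric])
    qed
    have 3: "1 \<le> C ^ (CARD('d) * m)" using C by (rule one_le_power)
    show "I 0 z + I v (z + v) + (1 + exp (- \<delta> * K) * I z (z + v)) \<le> 4 * C ^ (CARD('d) * m)"
      using 1 2 3 by (simp add: I)
  qed simp
  also have "\<dots> = 4 * C ^ (CARD('d) * m)" using c by simp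
  finally show "(LINT x|edge_measure \<nu>. exp_deviation \<delta> m K v x) \<le> 4 * (LINT y|\<nu>. exp (\<delta> * y)) ^ (CARD('d) * m)"
    by (simp add: C_def)
qed

lemma deviation_measurable:
  fixes v :: "int ^ 'd::finite"
  shows "deviation m K v \<in> borel_measurable (edge_measure \<nu>)"
  unfolding deviation_def[abs_def]
  by (intro borel_measurable_divide borel_measurable_const borel_measurable_sum borel_measurable_add
      borel_measurable_max borel_measurable_diff path_time_measurable[OF shortest_path(1,2)])

text \<open>
  The mean comes from Jensen's inequality for the logarithm of \<open>exp_deviation\<close> and the tail from Markov's
  inequality. The condition on \<open>K\<close> places the truncation level at the exponential growth rate of the moments of a
  shortest path from \<open>0\<close> to \<open>v\<close>, so the excess over \<open>K\<close> has a bounded exponential moment.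
\<close>

lemma deviation_bounds:
  fixes v :: "int ^ 'd::finite"
  assumes m: "0 < m" and \<delta>: "0 < \<delta>" "integrable \<nu> (\<lambda>y. exp (\<delta> * y))"
    and K: "(LINT y|\<nu>. exp (\<delta> * y)) ^ nat (l1_norm v) \<le> exp (\<delta> * K)"
  defines "Q \<equiv> 4 * (LINT y|\<nu>. exp (\<delta> * y)) ^ (CARD('d) * m)"
  shows "integrable (edge_measure \<nu>) (deviation m K v)"
    and "(LINT x|edge_measure \<nu>. deviation m K v x) \<le> 3 / \<delta> * ln Q"
    and "measure (edge_measure \<nu>) {x \<in> space (edge_measure \<nu>). a \<le> deviation m K v x} \<le> Q * exp (- \<delta> / 3 * a)"
proof -
  interpret M: prob_space "edge_measure \<nu> :: ((int ^ 'd) set \<Rightarrow> real) measure" by (rule prob_space_edge_measure)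
  note [measurable] = deviation_measurable[of m K v]
  note G = exp_deviation_integral[OF m \<delta> K, folded Q_def]
  have G1: "1 \<le> exp_deviation \<delta> m K v x" if "x \<in> space (edge_measure \<nu>)" for x
  proof -
    have "1 \<le> exp (\<delta> / 3 * deviation m K v x)" using \<delta>(1) deviation_nonneg[OF that] by simp
    then show ?thesis using exp_deviation_le[OF m \<delta>(1), of K v x] by linarith
  qed
  note ln = M.expectation_ln_le[OF G(1) G1 G(2)]
  have dev_le: "deviation m K v x \<le> 3 / \<delta> * ln (exp_deviation \<delta> m K v x)" for x
  proof -
    have pos: "0 < exp_deviation \<delta> m K v x"
      using exp_deviation_le[OF m \<delta>(1), of K v x] exp_gt_zero[of "\<delta> / 3 * deviation m K v x"] by linarith
    have "\<delta> / 3 * deviation m K v x \<le> ln (exp_deviation \<delta> m K v x)"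
      by (rule ln_ge_iff[THEN iffD2, OF pos exp_deviation_le[OF m \<delta>(1)]])
    then have "3 / \<delta> * (\<delta> / 3 * deviation m K v x) \<le> 3 / \<delta> * ln (exp_deviation \<delta> m K v x)"
      using \<delta>(1) by (intro mult_left_mono) auto
    then show ?thesis using \<delta>(1) by simp
  qed
  show i: "integrable (edge_measure \<nu>) (deviation m K v)"
  proof (rule Bochner_Integration.integrable_bound)
    show "integrable (edge_measure \<nu>) (\<lambda>x. 3 / \<delta> * ln (exp_deviation \<delta> m K v x))"
      by (intro integrable_mult_right ln(1))
    show "AE x in edge_measure \<nu>. norm (deviation m K v x) \<le> norm (3 / \<delta> * ln (exp_deviation \<delta> m K v x))"
    proof (rule AE_I2)
      fix x assume "x \<in> space (edge_measure \<nu> :: ((int ^ 'd) set \<Rightarrow> real) measure)"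
      then have "0 \<le> deviation m K v x" by (rule deviation_nonneg)
      then show "norm (deviation m K v x) \<le> norm (3 / \<delta> * ln (exp_deviation \<delta> m K v x))"
        using dev_le[of x] unfolding real_norm_def by linarith
    qed
  qed measurable
  have "(LINT x|edge_measure \<nu>. deviation m K v x) \<le> (LINT x|edge_measure \<nu>. 3 / \<delta> * ln (exp_deviation \<delta> m K v x))"
    by (intro integral_mono_AE AE_I2 i integrable_mult_right ln(1) dev_le)
  also have "\<dots> = 3 / \<delta> * (LINT x|edge_measure \<nu>. ln (exp_deviation \<delta> m K v x))"
    by (rule integral_mult_right_zero)
  also have "\<dots> \<le> 3 / \<delta> * ln Q"
    by (rule mult_left_mono[OF ln(2)], assumption) (rule divide_nonneg_pos[OF _ \<delta>(1)], simp)
  finally show "(LINT x|edge_measure \<nu>. deviation m K v x) \<le> 3 / \<delta> * ln Q" .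
  have "M.prob {x \<in> space (edge_measure \<nu>). a \<le> deviation m K v x}
      \<le> M.prob {x \<in> space (edge_measure \<nu>). exp (\<delta> / 3 * a) \<le> exp_deviation \<delta> m K v x}"
  proof (rule M.finite_measure_mono)
    show "{x \<in> space (edge_measure \<nu>). a \<le> deviation m K v x} \<subseteq> {x \<in> space (edge_measure \<nu>). exp (\<delta> / 3 * a) \<le> exp_deviation \<delta> m K v x}"
    proof safe
      fix x assume "a \<le> deviation m K v x"
      then have "exp (\<delta> / 3 * a) \<le> exp (\<delta> / 3 * deviation m K v x)" using \<delta>(1) by simp
      then show "exp (\<delta> / 3 * a) \<le> exp_deviation \<delta> m K v x" using exp_deviation_le[OF m \<delta>(1), of K v x] by linarith
    qed
    have [measurable]: "exp_deviation \<delta> m K v \<in> borel_measurable (edge_measure \<nu>)" using G(1) by simp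
    show "{x \<in> space (edge_measure \<nu>). exp (\<delta> / 3 * a) \<le> exp_deviation \<delta> m K v x} \<in> M.events" by measurable
  qed
  also have "\<dots> \<le> (LINT x|edge_measure \<nu>. exp_deviation \<delta> m K v x) / exp (\<delta> / 3 * a)"
  proof (rule integral_Markov_inequality_measure[OF G(1) sets.empty_sets])
    show "AE x in edge_measure \<nu>. 0 \<le> exp_deviation \<delta> m K v x"
      by (rule AE_I2) (rule order_trans[OF zero_le_one G1])
    show "0 < exp (\<delta> / 3 * a)" by (rule exp_gt_zero)
  qed
  also have "\<dots> \<le> Q / exp (\<delta> / 3 * a)" by (rule divide_right_mono[OF G(2)]) simp
  also have "\<dots> = Q * exp (- (\<delta> / 3 * a))" by (simp only: exp_minus divide_inverse)
  also have "- (\<delta> / 3 * a) = - \<delta> / 3 * a" by simp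
  finally show "M.prob {x \<in> space (edge_measure \<nu>). a \<le> deviation m K v x} \<le> Q * exp (- \<delta> / 3 * a)" .
qed

end

lemma (in prob_space) two_sided_exponential_Markov:
  fixes F :: "'a \<Rightarrow> real"
  assumes [measurable]: "F \<in> borel_measurable M" and bdd: "\<And>x. x \<in> space M \<Longrightarrow> \<bar>F x\<bar> \<le> B"
    and r: "0 < r" "\<And>\<mu>. \<bar>\<mu>\<bar> = r \<Longrightarrow> expectation (\<lambda>x. exp (\<mu> * (F x - e))) \<le> b"
  shows "prob {x \<in> space M. a \<le> \<bar>F x - e\<bar>} \<le> 2 * b * exp (- r * a)"
proof -
  have one: "prob {x \<in> space M. r * a \<le> \<mu> * (F x - e)} \<le> b * exp (- r * a)" if \<mu>: "\<bar>\<mu>\<bar> = r" for \<mu>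
  proof -
    have int: "integrable M (\<lambda>x. exp (\<mu> * (F x - e)))"
    proof (rule integrable_const_bound[where B="exp (r * (B + \<bar>e\<bar>))"])
      show "AE x in M. norm (exp (\<mu> * (F x - e))) \<le> exp (r * (B + \<bar>e\<bar>))"
      proof (rule AE_I2)
        fix x assume "x \<in> space M"
        then have "\<bar>F x - e\<bar> \<le> B + \<bar>e\<bar>" using bdd[of x] by linarith
        then have "\<bar>\<mu> * (F x - e)\<bar> \<le> r * (B + \<bar>e\<bar>)"
          unfolding abs_mult \<mu> using r(1) by (intro mult_left_mono) auto
        then show "norm (exp (\<mu> * (F x - e))) \<le> exp (r * (B + \<bar>e\<bar>))" by simp
      qed
    qed measurable
    have "prob {x \<in> space M. exp (r * a) \<le> exp (\<mu> * (F x - e))} \<le> expectation (\<lambda>x. exp (\<mu> * (F x - e))) / exp (r * a)"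
      by (rule integral_Markov_inequality_measure[OF int sets.empty_sets]) auto
    also have "\<dots> \<le> b / exp (r * a)" using r(2)[OF \<mu>] by (intro divide_right_mono) auto
    also have "\<dots> = b * exp (- (r * a))" by (simp only: exp_minus divide_inverse)
    finally show ?thesis by simp
  qed
  have "prob {x \<in> space M. a \<le> \<bar>F x - e\<bar>}
      \<le> prob ({x \<in> space M. r * a \<le> r * (F x - e)} \<union> {x \<in> space M. r * a \<le> (- r) * (F x - e)})"
  proof (rule finite_measure_mono)
    show "{x \<in> space M. a \<le> \<bar>F x - e\<bar>} \<subseteq> {x \<in> space M. r * a \<le> r * (F x - e)} \<union> {x \<in> space M. r * a \<le> (- r) * (F x - e)}"
    proof
      fix x assume x: "x \<in> {x \<in> space M. a \<le> \<bar>F x - e\<bar>}"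
      then consider "a \<le> F x - e" | "a \<le> - (F x - e)" by force
      then show "x \<in> {x \<in> space M. r * a \<le> r * (F x - e)} \<union> {x \<in> space M. r * a \<le> (- r) * (F x - e)}"
      proof cases
        case 1
        then have "r * a \<le> r * (F x - e)" using r(1) by (intro mult_left_mono) auto
        then show ?thesis using x by blast
      next
        case 2
        then have "r * a \<le> r * (- (F x - e))" using r(1) by (intro mult_left_mono) auto
        also have "\<dots> = (- r) * (F x - e)" by (simp only: minus_mult_commute)
        finally show ?thesis using x by blast
      qed
    qed
  qed measurable
  also have "\<dots> \<le> prob {x \<in> space M. r * a \<le> r * (F x - e)} + prob {x \<in> space M. r * a \<le> (- r) * (F x - e)}"
    by (rule measure_Un_le) measurable
  also have "\<dots> \<le> b * exp (- r * a) + b * exp (- r * a)"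
    using r(1) by (intro add_mono one) auto
  finally show ?thesis by simp
qed


section \<open>Concentration of the passage time\<close>

lemma nearly_gamma_edge_weights:
  assumes "nearly_gamma \<nu>"
  shows "edge_weights \<nu>"
proof -
  have P: "prob_space \<nu>" using assms unfolding nearly_gamma_def by (rule conjunct1)
  from assms have "\<exists>h :: real \<Rightarrow> real. h \<in> borel_measurable (restrict_space lborel {0..}) \<and>
      \<nu> = density (restrict_space lborel {0..}) (\<lambda>t. ennreal (h t))"
    unfolding nearly_gamma_def by blast
  then obtain h :: "real \<Rightarrow> real" where
    hm: "h \<in> borel_measurable (restrict_space lborel {0..})" and
    nu: "\<nu> = density (restrict_space lborel {0..}) (\<lambda>t. ennreal (h t))"
    by (elim exE conjE)
  have sets_nu: "sets \<nu> = sets (restrict_space borel {0..})"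
    by (simp add: nu sets_restrict_space)
  have 1: "space \<nu> = {0..}" by (simp add: nu space_restrict_space)
  have 2: "(\<lambda>x. x) \<in> borel_measurable \<nu>"
    using measurable_restrict_space1[of "\<lambda>x. x" borel borel "{0..}"] measurable_cong_sets[OF sets_nu refl] by auto
  have "AE y in restrict_space lborel {0..}. y \<noteq> (0::real)"
    by (subst AE_restrict_space_iff) (auto intro: eventually_mono[OF AE_lborel_singleton[of 0]])
  then have 3: "AE y in \<nu>. y \<noteq> 0"
    unfolding nu using hm by (subst AE_density) (auto elim: eventually_mono)
  show ?thesis
    by (rule edge_weights.intro[OF P]) (unfold_locales, fact 1, fact 2, fact 3)
qed

text \<open>
  The side \<open>m\<close> of the cube is about \<open>n\<^sup>1\<^sup>/\<^sup>4\<close>, far below the scale \<open>sqrt (n / ln n)\<close>. The influences are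
  then of order \<open>1 / m\<close>, so \<open>\<kappa>\<close> is of order \<open>n\<^sup>-\<^sup>1\<^sup>/\<^sup>8\<close>. The level \<open>k\<close> is about
  \<open>ln n / 32\<close>: this keeps \<open>3 ^ k\<close> below \<open>3 n\<^sup>1\<^sup>/\<^sup>1\<^sup>6\<close>, so that \<open>3 ^ k * \<kappa>\<close> still decays like a power
  of \<open>n\<close>, while \<open>1 / k\<close> is of order \<open>1 / ln n\<close>.
\<close>

lemma scale_parameters:
  fixes n B :: real
  assumes n: "2 \<le> n" and B: "0 \<le> B"
  obtains m k :: nat and \<kappa> :: real
  where "0 < m" "0 < k" "0 \<le> \<kappa>" "2 * B / m \<le> \<kappa>\<^sup>2" "real m \<le> sqrt (n / ln n)" "1 \<le> sqrt (n / ln n)"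
    "3 ^ k * \<kappa> + 1 / k \<le> (96 * sqrt B + 32) / ln n"
proof -
  have n0: "0 < n" and ln0: "0 < ln n" using n by auto
  define w where "w = n powr (1/4)"
  have w1: "1 \<le> w" using n by (simp add: w_def ge_one_powr_ge_zero)
  have w4: "w ^ 4 = n" using n0 by (simp add: w_def powr_realpow[symmetric] powr_powr)
  have lnw: "ln n = 4 * ln w" using n0 by (simp add: w_def ln_powr)
  define m where "m = nat \<lfloor>w\<rfloor>"
  have fl: "1 \<le> \<lfloor>w\<rfloor>" using w1 by simp
  have m: "0 < m" "real m \<le> w" "w \<le> 2 * real m"
  proof -
    have rm: "real m = real_of_int \<lfloor>w\<rfloor>" using fl by (simp add: m_def)
    show "0 < m" using fl by (simp add: m_def)
    show "real m \<le> w" unfolding rm by (rule of_int_floor_le)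
    have "w \<le> real_of_int \<lfloor>w\<rfloor> + 1" by linarith
    moreover have "1 \<le> real_of_int \<lfloor>w\<rfloor>" using fl by simp
    ultimately show "w \<le> 2 * real m" unfolding rm by linarith
  qed
  have "ln w \<le> w - 1" using w1 by (intro ln_le_minus_one) auto
  then have "ln n \<le> 4 * w - 4" using lnw by simp
  also have "\<dots> \<le> w\<^sup>2"
  proof -
    have "0 \<le> (w - 2)\<^sup>2" by simp
    then show ?thesis by (simp add: power2_eq_square algebra_simps)
  qed
  finally have lnle: "ln n \<le> w\<^sup>2" .
  have "w\<^sup>2 * ln n \<le> w\<^sup>2 * w\<^sup>2" by (intro mult_left_mono lnle) simp
  also have "\<dots> = n" using w4 by (simp add: power_add[symmetric])
  finally have "w\<^sup>2 \<le> n / ln n" using ln0 by (simp add: field_simps)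
  then have w\<sigma>: "w \<le> sqrt (n / ln n)" by (rule real_le_rsqrt)
  define k where "k = nat \<lceil>ln n / 32\<rceil>"
  have ce: "1 \<le> \<lceil>ln n / 32\<rceil>" using ln0 by (simp add: one_le_ceiling)
  have rk: "real k = real_of_int \<lceil>ln n / 32\<rceil>" using ce by (simp add: k_def)
  have k: "0 < k" "ln n / 32 \<le> real k" "real k \<le> ln n / 32 + 1"
  proof -
    show "0 < k" using ce by (simp add: k_def)
    show "ln n / 32 \<le> real k" unfolding rk by (rule le_of_int_ceiling)
    show "real k \<le> ln n / 32 + 1" unfolding rk by linarith
  qed
  have k1: "1 / real k \<le> 32 / ln n" using k ln0 by (simp add: field_simps)
  define \<kappa> where "\<kappa> = sqrt (2 * B / m)"
  have \<kappa>2: "\<kappa>\<^sup>2 = 2 * B / m" using B by (simp add: \<kappa>_def)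
  have \<kappa>le: "\<kappa> \<le> 2 * sqrt B * n powr (- (1/8))"
  proof -
    have "2 * B / m \<le> 4 * B / w"
    proof -
      have "2 * B * w \<le> 2 * B * (2 * real m)" using B m(3) by (intro mult_left_mono) auto
      then show ?thesis using m(1) w1 by (simp add: field_simps)
    qed
    also have "\<dots> = (2 * sqrt B * n powr (- (1/8)))\<^sup>2"
    proof -
      have "(n powr (- (1/8)))\<^sup>2 = n powr (- (1/4))"
        by (simp add: power2_eq_square powr_add[symmetric])
      also have "\<dots> = 1 / w" unfolding w_def by (rule powr_minus_divide)
      finally have "(n powr (- (1/8)))\<^sup>2 = 1 / w" .
      then show ?thesis using B by (simp add: power_mult_distrib)
    qed
    finally show ?thesis unfolding \<kappa>_def using B by (intro real_le_lsqrt) auto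
  qed
  have three: "3 ^ k \<le> 3 * n powr (1/16)"
  proof -
    have "(3::real) ^ k = exp (ln 3 * real k)" by (simp add: exp_of_nat2_mult)
    also have "\<dots> \<le> exp (ln 3 * (ln n / 32 + 1))" using k(3) by simp
    also have "\<dots> = 3 * exp (ln 3 * (ln n / 32))" by (simp add: distrib_left exp_add)
    also have "\<dots> \<le> 3 * exp (2 * (ln n / 32))"
    proof -
      have "ln 3 \<le> (2::real)" using ln_le_minus_one[of 3] by simp
      then have "ln 3 * (ln n / 32) \<le> 2 * (ln n / 32)" using ln0 by (intro mult_right_mono) auto
      then show ?thesis by simp
    qed
    also have "exp (2 * (ln n / 32)) = n powr (1/16)" using n0 by (simp add: powr_def)
    finally show ?thesis .
  qed
  have ln16: "ln n \<le> 16 * n powr (1/16)"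
  proof -
    have "ln (n powr (1/16)) \<le> n powr (1/16) - 1" using n0 by (intro ln_le_minus_one) simp
    then show ?thesis using n0 by (simp add: ln_powr)
  qed
  have "3 ^ k * \<kappa> \<le> (3 * n powr (1/16)) * (2 * sqrt B * n powr (- (1/8)))"
    using three \<kappa>le B by (intro mult_mono) (auto simp: \<kappa>_def)
  also have "\<dots> = 6 * sqrt B * (n powr (1/16) * n powr (- (1/8)))" by simp
  also have "n powr (1/16) * n powr (- (1/8)) = n powr (- (1/16))" by (simp add: powr_add[symmetric])
  also have "6 * sqrt B * n powr (- (1/16)) \<le> 96 * sqrt B / ln n"
  proof -
    have p: "n powr (1/16) * n powr (- (1/16)) = 1" using n0 by (simp add: powr_add[symmetric])
    have "n powr (- (1/16)) * ln n \<le> n powr (- (1/16)) * (16 * n powr (1/16))"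
      by (intro mult_left_mono ln16) simp
    also have "\<dots> = 16" using p by (simp add: mult.commute)
    finally have "n powr (- (1/16)) \<le> 16 / ln n" using ln0 by (simp add: field_simps)
    then have "6 * sqrt B * n powr (- (1/16)) \<le> 6 * sqrt B * (16 / ln n)"
      using B by (intro mult_left_mono) auto
    then show ?thesis by simp
  qed
  finally have "3 ^ k * \<kappa> + 1 / k \<le> 96 * sqrt B / ln n + 32 / ln n" using k1 by linarith
  then have fin: "3 ^ k * \<kappa> + 1 / k \<le> (96 * sqrt B + 32) / ln n" by (simp add: add_divide_distrib)
  have "0 \<le> \<kappa>" using B by (simp add: \<kappa>_def)
  from that[OF m(1) k(1) this eq_refl[OF \<kappa>2[symmetric]] order_trans[OF m(2) w\<sigma>] order_trans[OF w1 w\<sigma>] fin]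
  show ?thesis .
qed

context transported_weights
begin

text \<open>
  With \<open>m ^ d\<close> vertices and diameter \<open>d * m\<close> the logarithms in \<open>visit_mean\<close> are of order \<open>m\<close>.
\<close>

lemma visit_mean_le:
  assumes m: "0 < m" and s: "0 \<le> s" and \<delta>: "0 < \<delta>" "integrable \<nu> (\<lambda>y. exp (\<delta> * y))"
  shows "visit_mean s \<delta> (m ^ d) (d * m) + 1
    \<le> (3 + d + s / \<delta> * (2 * d + d * ln (LINT y|\<nu>. exp (\<delta> * y)))) * m"
proof -
  define C where "C = (LINT y|\<nu>. exp (\<delta> * y))"
  have C: "1 \<le> C" unfolding C_def using \<delta> by (intro exp_integral_ge_1) auto
  have m1: "1 \<le> real m" using m by simp
  have lnm: "0 \<le> ln (real m)" "ln (real m) \<le> real m" using m1 ln_le_minus_one[of "real m"] by auto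
  have e1: "ln ((real (m ^ d))\<^sup>2 * C ^ (d * m)) = 2 * (real d * ln (real m)) + real d * real m * ln C"
    using m C by (simp add: ln_mult ln_realpow)
  have e2: "ln (2 * real (m ^ d)) = ln 2 + real d * ln (real m)" using m by (simp add: ln_mult ln_realpow)
  have dm: "real d * ln (real m) \<le> real d * real m" by (intro mult_left_mono lnm) simp
  have "ln ((real (m ^ d))\<^sup>2 * C ^ (d * m)) \<le> (2 * real d + real d * ln C) * real m"
    unfolding e1 using dm by (simp add: algebra_simps)
  then have a: "s / \<delta> * ln ((real (m ^ d))\<^sup>2 * C ^ (d * m)) \<le> s / \<delta> * ((2 * real d + real d * ln C) * real m)"
    using s \<delta>(1) by (intro mult_left_mono) auto
  have b: "ln (2 * real (m ^ d)) \<le> real m + real d * real m"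
    unfolding e2 using dm m1 ln_le_minus_one[of 2] by linarith
  have "visit_mean s \<delta> (m ^ d) (d * m) + 1
      \<le> 2 * real m + s / \<delta> * ((2 * real d + real d * ln C) * real m) + (real m + real d * real m)"
    unfolding visit_mean_def C_def[symmetric] using a b m1 by linarith
  also have "\<dots> = (3 + real d + s / \<delta> * (2 * real d + real d * ln C)) * real m"
    by (simp add: algebra_simps)
  finally show ?thesis unfolding C_def by simp
qed

text \<open>
  Split \<open>T - E T\<close> into \<open>T - F\<close>, \<open>F - E F\<close> and \<open>E F - E T\<close>. The middle term has an exponential tail on the
  scale \<open>\<sigma> = sqrt (n / ln n)\<close> by the variance inequality; the others are controlled by \<open>deviation\<close>, whose
  exponential moments are \<open>exp (O(m))\<close> with \<open>m \<le> \<sigma>\<close>. This is only useful for \<open>t\<close> above a constant \<open>t0\<close>, and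
  for smaller \<open>t\<close> the bound holds trivially when \<open>C1\<close> is large.
\<close>

theorem passage_time_concentration:
  assumes d: "CARD('d::finite) \<ge> 2" and \<delta>: "0 < \<delta>" "integrable \<nu> (\<lambda>y. exp (\<delta> * y))"
  shows "\<exists>C1>0. \<exists>C2>0. \<forall>(v :: int ^ 'd) (t :: real). l1_norm v \<ge> 2 \<and> 0 < t \<longrightarrow>
    measure (edge_measure \<nu>)
      {x \<in> space (edge_measure \<nu>).
        \<bar>passage_time x 0 v - (\<integral>y. passage_time y 0 v \<partial>edge_measure \<nu>)\<bar>
          > t * sqrt (real_of_int (l1_norm v) / ln (real_of_int (l1_norm v)))}
      \<le> C1 * exp (- C2 * t)"
proof -
  interpret M: prob_space "edge_measure \<nu> :: ((int ^ 'd) set \<Rightarrow> real) measure" by (rule prob_space_edge_measure)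
  define D where "D = real CARD('d)"
  define C where "C = (LINT y|\<nu>. exp (\<delta> * y))"
  have C: "1 \<le> C" unfolding C_def using \<delta> by (intro exp_integral_ge_1) auto
  define uc where "uc = real (card (unit_steps :: (int ^ 'd) set))"
  \<comment> \<open>Adding \<open>1\<close> to the number of unit steps avoids a division by zero.\<close>
  have "0 < 1 / (2 * (uc + 1) * exp 1)" by (simp add: uc_def)
  from small_laplace_transform[OF this] obtain s where
    s: "0 \<le> s" "(LINT y|\<nu>. exp (- s * y)) \<le> 1 / (2 * (uc + 1) * exp 1)" by blast
  have decay: "path_decay TYPE('d) s"
  proof -
    have "uc * exp 1 * (LINT y|\<nu>. exp (- s * y)) \<le> (uc + 1) * exp 1 * (1 / (2 * (uc + 1) * exp 1))"
      using s(2) by (intro mult_mono) (auto simp: uc_def)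
    also have "\<dots> = 1 / 2"
    proof -
      have "(uc + 1) * exp 1 \<noteq> 0" by (simp add: uc_def add_eq_0_iff)
      then show ?thesis by (simp add: mult.assoc)
    qed
    finally show ?thesis using s(1) by (simp add: path_decay_def uc_def)
  qed
  \<comment> \<open>Truncation at \<open>K0 * n\<close>: there \<open>C ^ n = exp (\<delta> * K0 * n)\<close> balances the exponential moment of a path with \<open>n\<close> edges.\<close>
  define K0 where "K0 = ln C / \<delta>"
  have K0: "0 \<le> K0" using C \<delta>(1) by (simp add: K0_def)
  define B where "B = 3 + D + s / \<delta> * (2 * D + D * ln C)"
  have B: "0 \<le> B" using s(1) \<delta>(1) C by (simp add: B_def D_def)
  define G where "G = A\<^sup>2 * exp (4 * A * (sqrt (U 0) + A))"
  have G: "0 \<le> G" by (simp add: G_def)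
  define C0 where "C0 = (96 * sqrt B + 32) * (G * (4 * K0 + 1)) + 1"
  have C0: "1 \<le> C0" using B G K0 by (simp add: C0_def)
  \<comment> \<open>The Laplace transform is evaluated at \<open>\<theta> / \<sigma>\<close>; the minimum keeps this argument within \<open>[-1, 1]\<close>.\<close>
  define \<theta> where "\<theta> = min 1 (1 / sqrt (2 * C0))"
  have \<theta>: "0 < \<theta>" "\<theta> \<le> 1" "C0 * \<theta>\<^sup>2 \<le> 1 / 2"
  proof -
    show "0 < \<theta>" "\<theta> \<le> 1" using C0 by (auto simp: \<theta>_def)
    have "\<theta>\<^sup>2 \<le> (1 / sqrt (2 * C0))\<^sup>2" using C0 by (intro power_mono) (auto simp: \<theta>_def)
    also have "\<dots> = 1 / (2 * C0)" using C0 by (simp add: power_divide)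
    finally have "C0 * \<theta>\<^sup>2 \<le> C0 * (1 / (2 * C0))" using C0 by (intro mult_left_mono) auto
    then show "C0 * \<theta>\<^sup>2 \<le> 1 / 2" using C0 by simp
  qed
  define H where "H = 3 + D * ln C"
  have H: "0 \<le> H" using C by (simp add: H_def D_def)
  \<comment> \<open>For \<open>t \<ge> t0\<close> the exponential moment \<open>exp (H * \<sigma>)\<close> of the deviation costs at most half of the exponential gain.\<close>
  define t0 where "t0 = 24 * H / \<delta>"
  define C2 where "C2 = min (\<delta> / 24) (\<theta> / 4)"
  have C2: "0 < C2" "C2 \<le> \<delta> / 24" "C2 \<le> \<theta> / 4" using \<delta>(1) \<theta>(1) by (auto simp: C2_def)
  define C1 where "C1 = exp (C2 * t0) + (1 + 2 * exp 2)"
  have C1: "0 < C1" "exp (C2 * t0) \<le> C1" "1 + 2 * exp 2 \<le> C1"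
  proof -
    have "0 < exp (2 :: real)" "0 < exp (C2 * t0)" by simp_all
    then show "0 < C1" "exp (C2 * t0) \<le> C1" "1 + 2 * exp 2 \<le> C1" unfolding C1_def by linarith+
  qed
  have main: "measure (edge_measure \<nu>) {x \<in> space (edge_measure \<nu>).
        \<bar>passage_time x 0 v - (\<integral>y. passage_time y 0 v \<partial>edge_measure \<nu>)\<bar>
          > t * sqrt (real_of_int (l1_norm v) / ln (real_of_int (l1_norm v)))} \<le> C1 * exp (- C2 * t)"
    if v: "l1_norm v \<ge> 2" and t: "0 < t" for v :: "int ^ 'd" and t :: real
  proof (cases "t < t0")
    case True
    have "C2 * t \<le> C2 * t0" using True C2 by (intro mult_left_mono) auto
    then have "1 \<le> exp (C2 * t0) * exp (- C2 * t)" by (simp add: exp_add[symmetric])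
    also have "\<dots> \<le> C1 * exp (- C2 * t)" using C1 by (intro mult_right_mono) auto
    finally show ?thesis using M.prob_le_1 by (rule order_trans[rotated])
  next
    case False
    define n where "n = real_of_int (l1_norm v)"
    have n: "2 \<le> n" using v by (simp add: n_def)
    have ln0: "0 < ln n" using n by simp
    define \<sigma> where "\<sigma> = sqrt (n / ln n)"
    obtain m k :: nat and \<kappa> :: real where
      m: "0 < m" and k: "0 < k" and \<kappa>: "0 \<le> \<kappa>" "2 * B / m \<le> \<kappa>\<^sup>2" and m\<sigma>: "real m \<le> \<sigma>" and \<sigma>1: "1 \<le> \<sigma>"
      and k\<kappa>: "3 ^ k * \<kappa> + 1 / k \<le> (96 * sqrt B + 32) / ln n"
      by (rule scale_parameters[OF n B, folded \<sigma>_def])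
    have \<sigma>2: "\<sigma>\<^sup>2 = n / ln n" using n ln0 by (simp add: \<sigma>_def)
    define K where "K = K0 * n"
    have K: "0 \<le> K" using K0 n by (simp add: K_def)
    have Kexp: "(LINT y|\<nu>. exp (\<delta> * y)) ^ nat (l1_norm v) \<le> exp (\<delta> * K)"
    proof -
      have "C ^ nat (l1_norm v) = exp (real (nat (l1_norm v)) * ln C)" using C by (simp add: exp_of_nat_mult)
      also have "real (nat (l1_norm v)) * ln C = \<delta> * K" using v \<delta>(1) by (simp add: K_def K0_def n_def)
      finally show ?thesis by (simp add: C_def)
    qed
    have \<kappa>': "2 * ((visit_mean s \<delta> (m ^ CARD('d)) (CARD('d) * m) + 1) / real (m ^ CARD('d))) \<le> \<kappa>\<^sup>2"
    proof -
      have "visit_mean s \<delta> (m ^ CARD('d)) (CARD('d) * m) + 1 \<le> B * m"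
        using visit_mean_le[OF m s(1) \<delta>, of "CARD('d)"] by (simp add: B_def D_def C_def)
      then have "(visit_mean s \<delta> (m ^ CARD('d)) (CARD('d) * m) + 1) / real (m ^ CARD('d)) \<le> B * m / real (m ^ CARD('d))"
        by (intro divide_right_mono) auto
      also have "\<dots> \<le> B * m / real (m ^ 2)"
      proof (rule divide_left_mono)
        have "m ^ 2 \<le> m ^ CARD('d)" using m d by (intro power_increasing) auto
        then show "real (m ^ 2) \<le> real (m ^ CARD('d))" by (rule of_nat_mono)
      qed (use B m in auto)
      also have "\<dots> = B / m" using m by (simp add: power2_eq_square)
      finally have "2 * ((visit_mean s \<delta> (m ^ CARD('d)) (CARD('d) * m) + 1) / real (m ^ CARD('d))) \<le> 2 * (B / m)"
        by (rule mult_left_mono) simp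
      also have "\<dots> = 2 * B / m" by simp
      also have "\<dots> \<le> \<kappa>\<^sup>2" by (rule \<kappa>(2))
      finally show ?thesis .
    qed
    define F where "F = box_passage m K v"
    have Fm [measurable]: "F \<in> borel_measurable (edge_measure \<nu>)" unfolding F_def by (rule box_passage_measurable)
    have Fb: "\<bar>F x\<bar> \<le> K" if "x \<in> space (edge_measure \<nu>)" for x
      unfolding F_def by (rule box_passage_bounded[OF m K that])
    define R where "R = \<theta> / \<sigma>"
    have R: "0 < R" "R \<le> 1" using \<theta> \<sigma>1 by (auto simp: R_def divide_le_eq)
    have DR: "C0 * \<sigma>\<^sup>2 * R\<^sup>2 \<le> 1 / 2" using \<theta>(3) \<sigma>1 by (simp add: R_def power_divide)
    have var: "M.expectation (\<lambda>x. exp (u * F x)) - (M.expectation (\<lambda>x. exp (u / 2 * F x)))\<^sup>2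
        \<le> (C0 * \<sigma>\<^sup>2) * u\<^sup>2 * M.expectation (\<lambda>x. exp (u * F x))" if u: "\<bar>u\<bar> \<le> R" for u
    proof -
      have "\<bar>u\<bar> \<le> 1" using u R by linarith
      note V = box_passage_variance[OF m K k \<delta> decay \<kappa>(1) \<kappa>' this, of v]
      have "(3 ^ k * \<kappa> + 1 / k) * (A\<^sup>2 * exp (4 * A * (sqrt (U 0) + A)) * (4 * K + 1))
          \<le> ((96 * sqrt B + 32) / ln n) * (G * ((4 * K0 + 1) * n))"
      proof (rule mult_mono[OF k\<kappa>])
        show "A\<^sup>2 * exp (4 * A * (sqrt (U 0) + A)) * (4 * K + 1) \<le> G * ((4 * K0 + 1) * n)"
          unfolding G_def K_def using n K0 by (intro mult_left_mono) (auto simp: algebra_simps)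
      qed (use B ln0 K in auto)
      also have "\<dots> = (96 * sqrt B + 32) * (G * (4 * K0 + 1)) * \<sigma>\<^sup>2" by (simp add: \<sigma>2)
      also have "\<dots> \<le> C0 * \<sigma>\<^sup>2" by (intro mult_right_mono) (auto simp: C0_def)
      finally have "(3 ^ k * \<kappa> + 1 / k) * (A\<^sup>2 * exp (4 * A * (sqrt (U 0) + A)) * (4 * K + 1)) * (u\<^sup>2 * M.expectation (\<lambda>x. exp (u * F x)))
          \<le> C0 * \<sigma>\<^sup>2 * (u\<^sup>2 * M.expectation (\<lambda>x. exp (u * F x)))"
        by (intro mult_right_mono) auto
      then show ?thesis using V unfolding F_def by (simp add: mult.assoc)
    qed
    have lap: "M.expectation (\<lambda>x. exp (u * (F x - M.expectation F))) \<le> exp 2" if "\<bar>u\<bar> = R" for u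
    proof -
      have "M.expectation (\<lambda>x. exp (u * (F x - M.expectation F))) \<le> exp (4 * (C0 * \<sigma>\<^sup>2) * u\<^sup>2)"
        by (rule M.laplace_bound[OF Fm Fb _ DR var]) (use that C0 in auto)
      also have "u\<^sup>2 = R\<^sup>2" using that by (metis power2_abs)
      also have "4 * (C0 * \<sigma>\<^sup>2) * R\<^sup>2 = 4 * (C0 * \<sigma>\<^sup>2 * R\<^sup>2)" by (simp only: mult.assoc)
      also have "exp (4 * (C0 * \<sigma>\<^sup>2 * R\<^sup>2)) \<le> exp 2" unfolding exp_le_cancel_iff using DR by linarith
      finally show ?thesis .
    qed
    have tail1: "M.prob {x \<in> space (edge_measure \<nu>). t * \<sigma> / 4 \<le> \<bar>F x - M.expectation F\<bar>} \<le> 2 * exp 2 * exp (- (\<theta> * t / 4))"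
    proof -
      have eq: "- R * (t * \<sigma> / 4) = - (\<theta> * t / 4)" using \<sigma>1 by (simp add: R_def)
      show ?thesis
        using M.two_sided_exponential_Markov[OF Fm Fb R(1) lap, of "t * \<sigma> / 4"] unfolding eq .
    qed
    define Q where "Q = 4 * (LINT y|\<nu>. exp (\<delta> * y)) ^ (CARD('d) * m)"
    note dev = deviation_bounds[OF m \<delta> Kexp, folded Q_def]
    have Q0: "0 < Q" using C by (simp add: Q_def C_def[symmetric])
    have lnQ: "ln Q \<le> H * \<sigma>"
    proof -
      have "ln Q = ln 4 + CARD('d) * m * ln C" using C by (simp add: Q_def C_def[symmetric] ln_mult ln_realpow)
      also have "ln 4 \<le> (3::real)" using ln_le_minus_one[of 4] by simp
      finally have "ln Q \<le> 3 * 1 + D * ln C * m" by (simp add: D_def mult_ac)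
      also have "\<dots> \<le> 3 * m + D * ln C * m" using m by simp
      also have "\<dots> = H * m" by (simp add: H_def algebra_simps)
      also have "\<dots> \<le> H * \<sigma>" using H m\<sigma> by (intro mult_left_mono)
      finally show ?thesis .
    qed
    have Ht: "H * \<sigma> \<le> \<delta> * t * \<sigma> / 24"
    proof -
      have "H \<le> \<delta> * t / 24" using False \<delta>(1) by (simp add: t0_def field_simps)
      then have "H * \<sigma> \<le> (\<delta> * t / 24) * \<sigma>" using \<sigma>1 by (intro mult_right_mono) auto
      then show ?thesis by simp
    qed
    define T where "T x = passage_time x 0 v" for x
    have T_eq: "T = (\<lambda>x. passage_time x 0 v)" by (rule ext) (simp add: T_def)
    have Tm [measurable]: "T \<in> borel_measurable (edge_measure \<nu>)"
      using passage_time_measurable[of 0 v] by (simp add: T_def[abs_def] shift_weights_0)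
    have TF: "\<bar>T x - F x\<bar> \<le> deviation m K v x" if "x \<in> space (edge_measure \<nu>)" for x
      unfolding T_def F_def by (rule box_passage_deviation[OF m that])
    have Fi: "integrable (edge_measure \<nu>) F"
      by (rule M.integrable_const_bound[of _ K]) (use Fb in auto)
    have TFi: "integrable (edge_measure \<nu>) (\<lambda>x. T x - F x)"
    proof (rule Bochner_Integration.integrable_bound[OF dev(1)])
      show "AE x in edge_measure \<nu>. norm (T x - F x) \<le> norm (deviation m K v x)"
      proof (rule AE_I2)
        fix x assume "x \<in> space (edge_measure \<nu> :: ((int ^ 'd) set \<Rightarrow> real) measure)"
        from TF[OF this] show "norm (T x - F x) \<le> norm (deviation m K v x)" unfolding real_norm_def by linarith
      qed
    qed measurable
    have Ti: "integrable (edge_measure \<nu>) T"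
      using Bochner_Integration.integrable_add[OF TFi Fi] by simp
    have mean: "\<bar>M.expectation T - M.expectation F\<bar> \<le> t * \<sigma> / 8"
    proof -
      have "\<bar>M.expectation T - M.expectation F\<bar> = \<bar>M.expectation (\<lambda>x. T x - F x)\<bar>" using Ti Fi by simp
      also have "\<dots> \<le> M.expectation (\<lambda>x. \<bar>T x - F x\<bar>)" by (rule integral_abs_bound)
      also have "\<dots> \<le> M.expectation (deviation m K v)"
        using TFi dev(1) TF by (intro integral_mono_AE AE_I2) auto
      also have "\<dots> \<le> 3 / \<delta> * ln Q" by (rule dev(2))
      also have "\<dots> \<le> 3 / \<delta> * (\<delta> * t * \<sigma> / 24)"
        using \<delta>(1) order_trans[OF lnQ Ht] by (intro mult_left_mono divide_nonneg_pos) auto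
      also have "\<dots> = t * \<sigma> / 8" using \<delta>(1) by simp
      finally show ?thesis .
    qed
    have tail2: "M.prob {x \<in> space (edge_measure \<nu>). t * \<sigma> / 4 \<le> deviation m K v x} \<le> exp (- (\<delta> / 24 * t))"
    proof -
      have "Q * exp (- \<delta> / 3 * (t * \<sigma> / 4)) = exp (ln Q - \<delta> * t * \<sigma> / 12)"
      proof -
        have "Q * exp (- \<delta> / 3 * (t * \<sigma> / 4)) = exp (ln Q + - \<delta> / 3 * (t * \<sigma> / 4))"
          unfolding exp_add using Q0 by simp
        also have "ln Q + - \<delta> / 3 * (t * \<sigma> / 4) = ln Q - \<delta> * t * \<sigma> / 12" by simp
        finally show ?thesis .
      qed
      also have "\<dots> \<le> exp (- (\<delta> / 24 * t))"
      proof -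
        have "\<delta> * t / 24 * 1 \<le> \<delta> * t / 24 * \<sigma>" using \<sigma>1 \<delta>(1) t by (intro mult_left_mono) auto
        moreover have "\<delta> * t / 24 * 1 = \<delta> / 24 * t" "\<delta> * t / 24 * \<sigma> = \<delta> * t * \<sigma> / 24" by simp_all
        ultimately have "ln Q - \<delta> * t * \<sigma> / 12 \<le> - (\<delta> / 24 * t)" using lnQ Ht by linarith
        then show ?thesis by simp
      qed
      finally show ?thesis using dev(3)[of "t * \<sigma> / 4"] by linarith
    qed
    note [measurable] = deviation_measurable[of m K v]
    have "M.prob {x \<in> space (edge_measure \<nu>). t * \<sigma> < \<bar>T x - M.expectation T\<bar>}
        \<le> M.prob ({x \<in> space (edge_measure \<nu>). t * \<sigma> / 4 \<le> \<bar>F x - M.expectation F\<bar>}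
          \<union> {x \<in> space (edge_measure \<nu>). t * \<sigma> / 4 \<le> deviation m K v x})"
    proof (rule M.finite_measure_mono)
      have ts: "0 < t * \<sigma>" using t \<sigma>1 by simp
      show "{x \<in> space (edge_measure \<nu>). t * \<sigma> < \<bar>T x - M.expectation T\<bar>}
        \<subseteq> {x \<in> space (edge_measure \<nu>). t * \<sigma> / 4 \<le> \<bar>F x - M.expectation F\<bar>}
          \<union> {x \<in> space (edge_measure \<nu>). t * \<sigma> / 4 \<le> deviation m K v x}"
      proof
        fix x assume "x \<in> {x \<in> space (edge_measure \<nu>). t * \<sigma> < \<bar>T x - M.expectation T\<bar>}"
        then have x: "x \<in> space (edge_measure \<nu>)" "t * \<sigma> < \<bar>T x - M.expectation T\<bar>" by auto
        have "t * \<sigma> / 4 \<le> \<bar>F x - M.expectation F\<bar> \<or> t * \<sigma> / 4 \<le> deviation m K v x"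
          using x(2) TF[OF x(1)] mean ts by linarith
        then show "x \<in> {x \<in> space (edge_measure \<nu>). t * \<sigma> / 4 \<le> \<bar>F x - M.expectation F\<bar>}
          \<union> {x \<in> space (edge_measure \<nu>). t * \<sigma> / 4 \<le> deviation m K v x}" using x(1) by blast
      qed
    qed measurable
    also have "\<dots> \<le> M.prob {x \<in> space (edge_measure \<nu>). t * \<sigma> / 4 \<le> \<bar>F x - M.expectation F\<bar>}
          + M.prob {x \<in> space (edge_measure \<nu>). t * \<sigma> / 4 \<le> deviation m K v x}"
      by (rule measure_Un_le) measurable
    also have "\<dots> \<le> 2 * exp 2 * exp (- (\<theta> * t / 4)) + exp (- (\<delta> / 24 * t))"
      by (intro add_mono tail1 tail2)
    also have "\<dots> \<le> 2 * exp 2 * exp (- C2 * t) + exp (- C2 * t)"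
    proof (intro add_mono mult_left_mono)
      have "C2 * t \<le> \<theta> / 4 * t" "C2 * t \<le> \<delta> / 24 * t" using C2 t by (auto intro!: mult_right_mono)
      then show "exp (- (\<theta> * t / 4)) \<le> exp (- C2 * t)" "exp (- (\<delta> / 24 * t)) \<le> exp (- C2 * t)" by auto
    qed auto
    also have "\<dots> = (1 + 2 * exp 2) * exp (- C2 * t)" by (simp add: algebra_simps)
    also have "\<dots> \<le> C1 * exp (- C2 * t)" using C1 by (intro mult_right_mono) auto
    finally show ?thesis unfolding T_eq \<sigma>_def n_def .
  qed
  show ?thesis
  proof (rule exI[of _ C1], rule conjI[OF C1(1)], rule exI[of _ C2], rule conjI[OF C2(1)], intro allI impI)
    fix v :: "int ^ 'd" and t :: real
    assume vt: "l1_norm v \<ge> 2 \<and> 0 < t"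
    show "measure (edge_measure \<nu>) {x \<in> space (edge_measure \<nu>).
        \<bar>passage_time x 0 v - (\<integral>y. passage_time y 0 v \<partial>edge_measure \<nu>)\<bar>
          > t * sqrt (real_of_int (l1_norm v) / ln (real_of_int (l1_norm v)))} \<le> C1 * exp (- C2 * t)"
      by (rule main[OF conjunct1[OF vt] conjunct2[OF vt]])
  qed
qed

end

theorem theorem5p4:
  fixes \<nu> :: "real measure"
  assumes "CARD('d::finite) \<ge> 2"
    and "nearly_gamma \<nu>"
    and "\<exists>\<delta>>0. (\<integral>\<^sup>+ x. ennreal (exp (\<delta> * x)) \<partial>\<nu>) < \<infinity>"
  shows "\<exists>C1>0. \<exists>C2>0. \<forall>(v :: int ^ 'd) (t :: real).
    l1_norm v \<ge> 2 \<and> 0 < t \<and> t \<le> real_of_int (l1_norm v) \<longrightarrow>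
    measure (edge_measure \<nu>)
      {x \<in> space (edge_measure \<nu>).
        \<bar>passage_time x 0 v - (\<integral>y. passage_time y 0 v \<partial>edge_measure \<nu>)\<bar>
          > t * sqrt (real_of_int (l1_norm v) / ln (real_of_int (l1_norm v)))}
      \<le> C1 * exp (- C2 * t)"
proof -
  interpret edge_weights \<nu> by (rule nearly_gamma_edge_weights[OF assms(2)])
  obtain U :: "real \<Rightarrow> real" and A :: real where
    UA: "0 < A" "\<And>s. 0 \<le> U s" "\<And>s t. \<bar>sqrt (U s) - sqrt (U t)\<bar> \<le> A * \<bar>s - t\<bar>"
    "U \<in> borel_measurable borel" "distr std_normal_distribution borel U = distr \<nu> borel (\<lambda>x. x)"
    by (rule nearly_gamma_transport[OF assms(2)]) (rule that)
  interpret transported_weights \<nu> U A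
    by unfold_locales (rule less_imp_le[OF UA(1)], rule UA(2), rule UA(3), rule UA(5))
  obtain \<delta> where \<delta>: "0 < \<delta>" "(\<integral>\<^sup>+ x. ennreal (exp (\<delta> * x)) \<partial>\<nu>) < \<infinity>" using assms(3) by blast
  have "integrable \<nu> (\<lambda>y. exp (\<delta> * y))"
  proof (rule integrableI_nonneg)
    show "(\<lambda>y. exp (\<delta> * y)) \<in> borel_measurable \<nu>" using id_measurable by measurable
  qed (use \<delta> in auto)
  note conc = passage_time_concentration[OF assms(1) \<delta>(1) this]
  define tail where "tail v t = measure (edge_measure \<nu>)
      {x \<in> space (edge_measure \<nu>).
        \<bar>passage_time x 0 v - (\<integral>y. passage_time y 0 v \<partial>edge_measure \<nu>)\<bar>
          > t * sqrt (real_of_int (l1_norm v) / ln (real_of_int (l1_norm v)))}"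
    for v :: "int ^ 'd" and t :: real
  show ?thesis using conc unfolding tail_def[symmetric] by blast
qed

end
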